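(* Let $T>0$, $I=[0,T]$, $a\in L^\alpha(I)$ real-valued with $\alpha\ge 1$, and assume $\lambda_P<0\le\lambda_A$. Let $[c,d]\subset I$ with $c<d$. Let $f\colon I\times[0,\infty)\to[0,\infty)$ be $L^1$-Carathéodory: $f(\cdot,x)$ is measurable for every $x\ge 0$, $f(t,\cdot)$ is continuous for a.e. $t\in I$, and for each $r>0$ there is $\phi_r\in L^1(I)$ with $f(t,x)\le\phi_r(t)$ for all $x\in[0,r]$ and a.e. $t\in I$. If $$f_0=\lim_{x\to 0^+}\Big\{\min_{t\in[c,d]}\frac{f(t,x)}{x}\Big\}=\infty\qquad\text{and}\qquad f^\infty=\lim_{x\to\infty}\Big\{\max_{t\in I}\frac{f(t,x)}{x}\Big\}=0,$$ then the problem $$u''(t)+a(t)\,u(t)=f(t,u(t)),\ t\in I,\qquad u(0)=u(T),\ u'(0)=u'(T),$$ has at least one positive solution in the cone $$K=\Big\{u\in\mathcal{C}(I,\mathbb{R}):\ u\ge 0\text{ on }I,\ \int_0^T u(s)\,ds\ge\sigma\|u\|\Big\},\qquad \sigma=\frac{\min_{s\in[c,d]}\int_c^d G_P(t,s)\,dt}{\max_{t,s\in I}G_P(t,s)}.$$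
   Context: $\|\cdot\|$ is the supremum norm on $\mathcal{C}(I,\mathbb{R})$. Solutions are functions $u\in W^{2,1}(I)$ satisfying the equation a.e. on $I$ together with the boundary conditions; a positive solution in $K$ means a solution $u\in K$ that is not identically zero (so $u\ge 0$ on $I$). The min and max in $f_0$, $f^\infty$ are read as infimum and supremum when not attained. $\lambda_P$ is the smallest eigenvalue $\lambda$ of $u''+(a(t)+\lambda)u=0$ a.e. on $I$ with periodic conditions $u(0)=u(T)$, $u'(0)=u'(T)$; $\lambda_A$ is the smallest eigenvalue of the same equation with anti-periodic conditions $u(0)=-u(T)$, $u'(0)=-u'(T)$. Under $\lambda_P<0\le\lambda_A$, the periodic problem $u''+a(t)u=0$, $u(0)=u(T)$, $u'(0)=u'(T)$ has only the trivial solution, and $G_P$ denotes its Green's function: for every $h\in L^1(I)$, the unique solution $u\in W^{2,1}(I)$ of $u''+a(t)u=h(t)$ a.e. on $I$, $u(0)=u(T)$, $u'(0)=u'(T)$ is $u(t)=\int_0^T G_P(t,s)h(s)\,ds$. It is known that $\lambda_P<0\le\lambda_A$ is equivalent to $G_P\ge 0$ on $I\times I$. *)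

theory Defs
  imports "HOL-Analysis.Analysis"
begin

abbreviation L1 :: "real \<Rightarrow> (real \<Rightarrow> real) \<Rightarrow> bool" where
  "L1 T h \<equiv> integrable (lebesgue_on {0..T}) h"

definition Lp :: "real \<Rightarrow> real \<Rightarrow> (real \<Rightarrow> real) \<Rightarrow> bool" where
  "Lp p T h \<longleftrightarrow> h \<in> borel_measurable (lebesgue_on {0..T}) \<and>
     integrable (lebesgue_on {0..T}) (\<lambda>t. \<bar>h t\<bar> powr p)"

text \<open>
  \<open>u\<close> is (the continuously differentiable representative of) an element of \<open>W\<^sup>2\<^sup>,\<^sup>1([0,T])\<close>, with first
  derivative \<open>u'\<close> and second weak derivative \<open>u''\<close>. The last two conjuncts say that \<open>u'\<close> is absolutely
  continuous with a.e. derivative \<open>u''\<close>. At the endpoints the derivative of \<open>u\<close> is one-sided.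
\<close>

definition W21 :: "real \<Rightarrow> (real \<Rightarrow> real) \<Rightarrow> (real \<Rightarrow> real) \<Rightarrow> (real \<Rightarrow> real) \<Rightarrow> bool" where
  "W21 T u u' u'' \<longleftrightarrow>
     (\<forall>t\<in>{0..T}. (u has_real_derivative u' t) (at t within {0..T})) \<and>
     L1 T u'' \<and>
     (\<forall>t\<in>{0..T}. u' t = u' 0 + (LINT s|lebesgue_on {0..t}. u'' s))"

text \<open>
  \<open>u\<close> solves \<open>u'' + a u = h\<close> a.e. on \<open>[0,T]\<close>, \<open>u(0) = \<epsilon> u(T)\<close>, \<open>u'(0) = \<epsilon> u'(T)\<close>: periodic
  conditions for \<open>\<epsilon> = 1\<close>, anti-periodic ones for \<open>\<epsilon> = -1\<close>.
\<close>

definition hill_solution ::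
  "real \<Rightarrow> real \<Rightarrow> (real \<Rightarrow> real) \<Rightarrow> (real \<Rightarrow> real) \<Rightarrow> (real \<Rightarrow> real) \<Rightarrow> bool" where
  "hill_solution \<epsilon> T a h u \<longleftrightarrow>
     (\<exists>u' u''. W21 T u u' u'' \<and>
        (AE t in lebesgue_on {0..T}. u'' t + a t * u t = h t) \<and>
        u 0 = \<epsilon> * u T \<and> u' 0 = \<epsilon> * u' T)"

abbreviation periodic_solution where "periodic_solution \<equiv> hill_solution 1"

definition hill_eigenvalue :: "real \<Rightarrow> real \<Rightarrow> (real \<Rightarrow> real) \<Rightarrow> real \<Rightarrow> bool" where
  "hill_eigenvalue \<epsilon> T a l \<longleftrightarrow>
     (\<exists>u. hill_solution \<epsilon> T (\<lambda>t. a t + l) (\<lambda>_. 0) u \<and> (\<exists>t\<in>{0..T}. u t \<noteq> 0))"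

definition smallest_eigenvalue :: "real \<Rightarrow> real \<Rightarrow> (real \<Rightarrow> real) \<Rightarrow> real \<Rightarrow> bool" where
  "smallest_eigenvalue \<epsilon> T a l \<longleftrightarrow>
     hill_eigenvalue \<epsilon> T a l \<and> (\<forall>m. hill_eigenvalue \<epsilon> T a m \<longrightarrow> l \<le> m)"

abbreviation smallest_periodic_eigenvalue where
  "smallest_periodic_eigenvalue \<equiv> smallest_eigenvalue 1"

abbreviation smallest_antiperiodic_eigenvalue where
  "smallest_antiperiodic_eigenvalue \<equiv> smallest_eigenvalue (-1)"

text \<open>
  The integral representation alone determines \<open>G(t,s)\<close> only for almost every \<open>s\<close>; the Green's
  function is the continuous kernel, and continuity makes it unique on \<open>[0,T] \<times> [0,T]\<close>.
\<close>

definition periodic_green :: "real \<Rightarrow> (real \<Rightarrow> real) \<Rightarrow> (real \<Rightarrow> real \<Rightarrow> real) \<Rightarrow> bool" where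
  "periodic_green T a G \<longleftrightarrow>
     continuous_on ({0..T} \<times> {0..T}) (\<lambda>(t, s). G t s) \<and>
     (\<forall>h. L1 T h \<longrightarrow>
        periodic_solution T a h (\<lambda>t. LINT s|lebesgue_on {0..T}. G t s * h s) \<and>
        (\<forall>u. periodic_solution T a h u \<longrightarrow>
           (\<forall>t\<in>{0..T}. u t = (LINT s|lebesgue_on {0..T}. G t s * h s))))"

definition L1_caratheodory :: "real \<Rightarrow> (real \<Rightarrow> real \<Rightarrow> real) \<Rightarrow> bool" where
  "L1_caratheodory T f \<longleftrightarrow>
     (\<forall>x\<ge>0. (\<lambda>t. f t x) \<in> borel_measurable (lebesgue_on {0..T})) \<and>
     (AE t in lebesgue_on {0..T}. continuous_on {0..} (f t)) \<and>
     (\<forall>r>0. \<exists>\<phi>. L1 T \<phi> \<and> (AE t in lebesgue_on {0..T}. \<forall>x\<in>{0..r}. f t x \<le> \<phi> t))"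

definition green_sigma :: "real \<Rightarrow> real \<Rightarrow> real \<Rightarrow> (real \<Rightarrow> real \<Rightarrow> real) \<Rightarrow> real" where
  "green_sigma T c d G =
     (INF s\<in>{c..d}. LINT t|lebesgue_on {c..d}. G t s) /
     (SUP (t, s)\<in>{0..T} \<times> {0..T}. G t s)"

definition positive_cone :: "real \<Rightarrow> real \<Rightarrow> (real \<Rightarrow> real) set" where
  "positive_cone T \<sigma> = {u. continuous_on {0..T} u \<and> (\<forall>t\<in>{0..T}. 0 \<le> u t) \<and>
     (LINT s|lebesgue_on {0..T}. u s) \<ge> \<sigma> * (SUP t\<in>{0..T}. \<bar>u t\<bar>)}"

end

theory Submission
  imports Defs "HOL-Complex_Analysis.Great_Picard"
begin

text \<open>
  Solutions of \<open>x'' + a x = 0\<close> (with \<open>a\<close> extended periodically) have no two zeros at distance less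
  than \<open>T\<close>: otherwise, decreasing \<open>\<lambda>\<close> from \<open>0\<close>, a solution of \<open>x'' + (a + \<lambda>) x = 0\<close> would acquire zeros at
  distance exactly \<open>T\<close> for some \<open>\<lambda> < 0\<close>, so that the trace of the monodromy matrix is at most \<open>-2\<close>
  there; it exceeds \<open>-2\<close> for very negative \<open>\<lambda>\<close>, and by continuity there would be a negative
  antiperiodic eigenvalue. Hence supersolutions obey the maximum principle on arcs shorter than \<open>T\<close>.
  With the negative periodic eigenvalue this yields \<open>G \<ge> 0\<close>.

  Let \<open>v\<close> be the solution with right-hand side the indicator of \<open>[c, d]\<close>, and \<open>m\<close>, \<open>M\<close> the minimum of \<open>v\<close>
  on \<open>[c, d]\<close> and the maximum of \<open>G\<close>, so that \<open>\<sigma> = m / M\<close>. The maximum principle on the arc complementary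
  to \<open>[c, d]\<close> gives \<open>m G(s, t) \<le> M v(s)\<close> for all \<open>s\<close>, \<open>t\<close>. Integrating this against the right-hand side
  puts every solution with nonnegative right-hand side into the cone. A nonnegative fixed point of the
  Hammerstein operator comes from Brouwer's theorem for step functions and Arzela-Ascoli.
\<close>

section \<open>Hill's equation on an interval\<close>

text \<open>Two obstacles shape the proof. Since \<open>a\<close> is only integrable, second
  derivatives carry no pointwise information at a point of contact;
  \<open>hill_on_nonneg_eq_zero\<close>, a one-sided Gronwall argument, takes the part of the strong
  maximum principle. And \<open>G\<close> may have zeros: for constant
  \<open>a = (pi / T)^2\<close>, where \<open>lA = 0\<close>, it vanishes on the diagonal. So
  \<open>G\<close> has no lower bound by a positive multiple of its maximum, and it is compared with
  the average \<open>v\<close> instead, which is strictly positive.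

  As \<open>\<lambda>\<close> varies, a solution started at \<open>s\<close> with slope 1 cannot
  acquire its first zero in the interior of an arc, for that would be a double zero; the zero enters
  through the right end point \<open>s + T\<close>. This is why the trace, which sees full periods
  only, controls zeros at all smaller distances.

  The fixed point is sought among functions with values in \<open>[0, R]\<close>. Membership in the
  cone is then a matter of the linear theory, because a fixed point solves the linear problem with a
  nonnegative right-hand side.\<close>

lemmas hk_combine = Henstock_Kurzweil_Integration.integral_combine
  and hk_add = Henstock_Kurzweil_Integration.integral_add
  and hk_diff = Henstock_Kurzweil_Integration.integral_diff
  and hk_cong = Henstock_Kurzweil_Integration.integral_cong

text \<open>Both sides are increments, so an estimate on steps of length at most
  \<open>\<delta>\<close> adds up along a partition; the induction counts the steps. This reduces
  the product rule to short intervals.\<close>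

lemma local_bound_imp_bound:
  fixes P M :: "real \<Rightarrow> real"
  assumes "\<delta> > 0"
    and loc: "\<And>s t. p \<le> s \<Longrightarrow> s \<le> t \<Longrightarrow> t \<le> q \<Longrightarrow> t - s \<le> \<delta> \<Longrightarrow> \<bar>P t - P s\<bar> \<le> M t - M s"
    and "p \<le> q"
  shows "\<bar>P q - P p\<bar> \<le> M q - M p"
proof -
  have step: "\<forall>t\<in>{p..q}. t - p \<le> of_nat n * \<delta> \<longrightarrow> \<bar>P t - P p\<bar> \<le> M t - M p" for n
  proof (induction n)
    case 0
    then show ?case by auto
  next
    case (Suc n)
    show ?case
    proof (intro ballI impI)
      fix t assume t: "t \<in> {p..q}" "t - p \<le> of_nat (Suc n) * \<delta>"
      define s where "s = max p (t - \<delta>)"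
      have s: "s \<in> {p..q}" "s \<le> t" "t - s \<le> \<delta>" "s - p \<le> of_nat n * \<delta>"
        using t \<open>\<delta> > 0\<close> unfolding s_def by (auto simp: max_def algebra_simps)
      have "\<bar>P s - P p\<bar> \<le> M s - M p" using Suc s by blast
      moreover have "\<bar>P t - P s\<bar> \<le> M t - M s" using loc s t by auto
      ultimately show "\<bar>P t - P p\<bar> \<le> M t - M p" by linarith
    qed
  qed
  obtain n :: nat where "(q - p) / \<delta> \<le> of_nat n" using real_arch_simple by blast
  then have "q - p \<le> of_nat n * \<delta>" using \<open>\<delta> > 0\<close> by (simp add: field_simps)
  then show ?thesis using step[of n] \<open>p \<le> q\<close> by auto
qed

lemma abs_integrable_mult:
  fixes g F :: "real \<Rightarrow> real"
  assumes "g absolutely_integrable_on {p..q}" "continuous_on {p..q} F"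
  shows "(\<lambda>r. g r * F r) absolutely_integrable_on {p..q}" 
    and "(\<lambda>r. F r * g r) absolutely_integrable_on {p..q}"
proof -
  show *: "(\<lambda>r. F r * g r) absolutely_integrable_on {p..q}"
    by (rule absolutely_integrable_bounded_measurable_product_real)
      (use assms in \<open>auto intro!: compact_imp_bounded compact_continuous_image
         continuous_imp_measurable_on_sets_lebesgue\<close>)
  then show "(\<lambda>r. g r * F r) absolutely_integrable_on {p..q}"
    by (simp add: mult.commute)
qed

text \<open>The error in the product rule over \<open>[s,t]\<close> is bounded by the oscillation of the factors
  times the mass of \<open>[s,t]\<close>, so it vanishes in the limit of fine partitions.\<close>

lemma has_integral_by_parts:
  fixes g H F F' :: "real \<Rightarrow> real"
  assumes "p \<le> q" and g: "g absolutely_integrable_on {p..q}"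
    and H: "\<And>s t. p \<le> s \<Longrightarrow> s \<le> t \<Longrightarrow> t \<le> q \<Longrightarrow> (g has_integral (H t - H s)) {s..t}"
    and F: "\<And>t. t \<in> {p..q} \<Longrightarrow> (F has_real_derivative F' t) (at t within {p..q})"
    and F': "continuous_on {p..q} F'"
  shows "((\<lambda>r. g r * F r + H r * F' r) has_integral (H q * F q - H p * F p)) {p..q}"
proof -
  have gi: "g integrable_on {s..t}" if "p \<le> s" "t \<le> q" for s t
    using absolutely_integrable_on_def g integrable_on_subinterval that by (metis atLeastatMost_subset_iff)
  have contF: "continuous_on {p..q} F" by (rule DERIV_continuous_on[OF F])
  have contH: "continuous_on {p..q} H"
  proof -
    have "continuous_on {p..q} (\<lambda>t. H p + integral {p..t} g)"
      by (intro continuous_intros indefinite_integral_continuous_1 gi) auto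
    moreover have "H p + integral {p..t} g = H t" if "t \<in> {p..q}" for t
      using integral_unique[OF H[of p t]] that by auto
    ultimately show ?thesis by (metis (no_types, lifting) continuous_on_cong)
  qed
  let ?k = "\<lambda>r. g r * F r + H r * F' r"
  have ki: "?k absolutely_integrable_on {p..q}"
    by (intro set_integral_add abs_integrable_mult(1) g contF
         absolutely_integrable_continuous_real continuous_intros contH F')
  then have ki': "?k integrable_on {s..t}" if "p \<le> s" "t \<le> q" for s t
    using integrable_on_subinterval that by (metis atLeastatMost_subset_iff absolutely_integrable_on_def)
  let ?m = "\<lambda>r. \<bar>g r\<bar> + \<bar>F' r\<bar>"
  have mi: "?m absolutely_integrable_on {p..q}"
    using absolutely_integrable_norm[OF g] absolutely_integrable_norm[OF absolutely_integrable_continuous_real[OF F']]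
    by (intro set_integral_add) (auto simp: o_def)
  then have mi': "?m integrable_on {s..t}" if "p \<le> s" "t \<le> q" for s t
    using integrable_on_subinterval that by (metis atLeastatMost_subset_iff absolutely_integrable_on_def)
  define P where "P t = integral {p..t} ?k - H t * F t" for t
  define M where "M t = integral {p..t} ?m" for t
  have bound: "\<bar>P q - P p\<bar> \<le> \<epsilon> * M q" if "\<epsilon> > 0" for \<epsilon>
  proof -
    have "uniformly_continuous_on {p..q} F" "uniformly_continuous_on {p..q} H"
      using contF contH by (auto intro: compact_uniformly_continuous)
    then obtain d1 d2 where d: "d1 > 0" "d2 > 0"
      "\<And>x y. x \<in> {p..q} \<Longrightarrow> y \<in> {p..q} \<Longrightarrow> dist y x < d1 \<Longrightarrow> dist (F y) (F x) < \<epsilon>"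
      "\<And>x y. x \<in> {p..q} \<Longrightarrow> y \<in> {p..q} \<Longrightarrow> dist y x < d2 \<Longrightarrow> dist (H y) (H x) < \<epsilon>"
      using \<open>\<epsilon> > 0\<close> unfolding uniformly_continuous_on_def by metis
    have "\<bar>P t - P s\<bar> \<le> \<epsilon> * M t - \<epsilon> * M s" if st: "p \<le> s" "s \<le> t" "t \<le> q" "t - s \<le> min d1 d2 / 2" for s t
    proof -
      have "t - s < d1" "t - s < d2" using st d by linarith+
      have "((\<lambda>r. F' r) has_integral (F t - F s)) {s..t}"
        using st by (intro fundamental_theorem_of_calculus)
          (auto simp flip: has_real_derivative_iff_has_vector_derivative intro: DERIV_subset[OF F])
      \<comment> \<open>Freezing \<open>F\<close> at the right end and \<open>H\<close> at the left
        end makes the integral exactly \<open>H t * F t - H s * F s\<close>, so that only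
        oscillations remain to be estimated.\<close>
      then have i1: "((\<lambda>r. g r * F t + H s * F' r) has_integral ((H t - H s) * F t + H s * (F t - F s))) {s..t}"
        using st by (intro has_integral_add has_integral_mult_left has_integral_mult_right H)
      have "(?k has_integral (integral {s..t} ?k)) {s..t}"
        using ki' st by (intro integrable_integral) auto
      then have i2: "((\<lambda>r. ?k r - (g r * F t + H s * F' r)) has_integral (integral {s..t} ?k - ((H t - H s) * F t + H s * (F t - F s)))) {s..t}"
        using i1 by (rule has_integral_diff)
      have i3: "((\<lambda>r. \<epsilon> * ?m r) has_integral (\<epsilon> * integral {s..t} ?m)) {s..t}"
        using mi' st by (intro has_integral_mult_right integrable_integral) auto
      have "norm (integral {s..t} ?k - ((H t - H s) * F t + H s * (F t - F s))) \<le> \<epsilon> * integral {s..t} ?m"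
      proof -
        have "norm (?k r - (g r * F t + H s * F' r)) \<le> \<epsilon> * ?m r" if "r \<in> {s..t}" for r
        proof -
          have "\<bar>F r - F t\<bar> \<le> \<epsilon>"  using d(3)[of t r] st that \<open>t - s < d1\<close> by (auto simp: dist_real_def)
          moreover have "\<bar>H r - H s\<bar> \<le> \<epsilon>"  using d(4)[of s r] st that \<open>t - s < d2\<close> by (auto simp: dist_real_def)
          ultimately have le1: "\<bar>g r\<bar> * \<bar>F r - F t\<bar> \<le> \<bar>g r\<bar> * \<epsilon>" and le2: "\<bar>H r - H s\<bar> * \<bar>F' r\<bar> \<le> \<epsilon> * \<bar>F' r\<bar>"
            by (auto intro: mult_left_mono mult_right_mono)
          have "?k r - (g r * F t + H s * F' r) = g r * (F r - F t) + (H r - H s) * F' r"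
            by (simp add: algebra_simps)
          then have "\<bar>?k r - (g r * F t + H s * F' r)\<bar> \<le> \<bar>g r\<bar> * \<bar>F r - F t\<bar> + \<bar>H r - H s\<bar> * \<bar>F' r\<bar>"
            by (metis abs_mult abs_triangle_ineq)
          also have "\<dots> \<le> \<bar>g r\<bar> * \<epsilon> + \<epsilon> * \<bar>F' r\<bar>"
            by (intro add_mono le1 le2)
          finally show ?thesis by (simp add: distrib_left mult.commute)
        qed
        then show ?thesis
          using i2 i3 by (metis (no_types, lifting) integral_norm_bound_integral has_integral_integrable integral_unique)
      qed
      moreover have k: "integral {p..s} ?k + integral {s..t} ?k = integral {p..t} ?k"
        using st by (intro hk_combine ki') auto
      moreover have m: "integral {p..s} ?m + integral {s..t} ?m = integral {p..t} ?m"
        using st by (intro hk_combine mi') auto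
      moreover have "P t - P s = integral {s..t} ?k - ((H t - H s) * F t + H s * (F t - F s))"
        unfolding P_def k[symmetric] by (simp add: left_diff_distrib right_diff_distrib)
      moreover have "\<epsilon> * M t - \<epsilon> * M s = \<epsilon> * integral {s..t} ?m"
        unfolding M_def m[symmetric] by (simp add: distrib_left)
      ultimately show ?thesis by simp
    qed
    then have "\<bar>P q - P p\<bar> \<le> \<epsilon> * M q - \<epsilon> * M p"
      using local_bound_imp_bound[of "min d1 d2 / 2" p q P "\<lambda>t. \<epsilon> * M t"] d \<open>p \<le> q\<close> by auto
    then show ?thesis by (simp add: M_def)
  qed
  have "\<bar>P q - P p\<bar> \<le> 0"
  proof (rule field_le_epsilon)
    fix e :: real assume "e > 0"
    have "M q \<ge> 0" unfolding M_def by (intro integral_nonneg mi') auto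
    then have "e / (M q + 1) * M q \<le> e" using \<open>e > 0\<close> by (simp add: field_simps)
    moreover have "\<bar>P q - P p\<bar> \<le> e / (M q + 1) * M q" using \<open>e > 0\<close> \<open>M q \<ge> 0\<close> by (intro bound) auto
    ultimately show "\<bar>P q - P p\<bar> \<le> 0 + e" by linarith
  qed
  then have "integral {p..q} ?k = H q * F q - H p * F p" unfolding P_def by simp
  moreover have "?k integrable_on {p..q}" using ki' by auto
  ultimately show ?thesis using integrable_integral by fastforce
qed

text \<open>The equation \<open>x'' + a x = h\<close> enters through the increments of
  \<open>x'\<close> over all subintervals. No second derivative and no exceptional null set has to
  be carried along, and restriction, translation and gluing become operations on intervals.\<close>

definition hill_on :: "(real \<Rightarrow> real) \<Rightarrow> (real \<Rightarrow> real) \<Rightarrow> real \<Rightarrow> real \<Rightarrow> (real \<Rightarrow> real) \<Rightarrow> (real \<Rightarrow> real) \<Rightarrow> bool" where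
  "hill_on a h p q x x' \<longleftrightarrow>
     (\<forall>t\<in>{p..q}. (x has_real_derivative x' t) (at t within {p..q})) \<and>
     (\<forall>s t. p \<le> s \<longrightarrow> s \<le> t \<longrightarrow> t \<le> q \<longrightarrow> ((\<lambda>r. h r - a r * x r) has_integral (x' t - x' s)) {s..t})"

lemma hill_on_deriv:
  "hill_on a h p q x x' \<Longrightarrow> t \<in> {p..q} \<Longrightarrow> (x has_real_derivative x' t) (at t within {p..q})"
  by (auto simp: hill_on_def)

lemma hill_on_integral:
  "hill_on a h p q x x' \<Longrightarrow> p \<le> s \<Longrightarrow> s \<le> t \<Longrightarrow> t \<le> q \<Longrightarrow>
     ((\<lambda>r. h r - a r * x r) has_integral (x' t - x' s)) {s..t}"
  by (auto simp: hill_on_def)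

lemma hill_on_subset:
  assumes "hill_on a h p q x x'" "p \<le> p'" "q' \<le> q"
  shows "hill_on a h p' q' x x'"
  using assms unfolding hill_on_def
  by (intro conjI ballI) (auto intro: DERIV_subset[where s="{p..q}"])

lemma hill_on_continuous: "hill_on a h p q x x' \<Longrightarrow> continuous_on {p..q} x"
  by (rule DERIV_continuous_on[OF hill_on_deriv])

lemma hill_on_C1: 
  assumes "hill_on a h p q x x'"
  shows "continuous_on {p..q} x'"
proof (cases "p \<le> q")
  case True
  have "continuous_on {p..q} (\<lambda>t. x' p + integral {p..t} (\<lambda>r. h r - a r * x r))"
    using hill_on_integral[OF assms, of p q] True
    by (intro continuous_intros indefinite_integral_continuous_1) auto
  moreover have "x' p + integral {p..t} (\<lambda>r. h r - a r * x r) = x' t" if "t \<in> {p..q}" for t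
    using integral_unique[OF hill_on_integral[OF assms, of p t]] that by auto
  ultimately show ?thesis by (metis (no_types, lifting) continuous_on_cong)
qed auto

lemma hill_on_cong:
  assumes "hill_on a h p q x x'"
    and "\<And>t. p \<le> t \<Longrightarrow> t \<le> q \<Longrightarrow> x t = y t" "\<And>t. p \<le> t \<Longrightarrow> t \<le> q \<Longrightarrow> x' t = y' t"
    and "\<And>t. p \<le> t \<Longrightarrow> t \<le> q \<Longrightarrow> h t - a t * x t = k t - b t * y t"
  shows "hill_on b k p q y y'"
  unfolding hill_on_def
proof (intro conjI ballI allI impI)
  fix t assume t: "t \<in> {p..q}"
  then show "(y has_real_derivative y' t) (at t within {p..q})"
    using has_field_derivative_transform_within[OF hill_on_deriv[OF assms(1) t] zero_less_one t, of y] assms t by auto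
next
  fix s t assume "p \<le> s" "s \<le> t" "t \<le> q"
  then show "((\<lambda>r. k r - b r * y r) has_integral y' t - y' s) {s..t}"
    using has_integral_cong[of "{s..t}" "\<lambda>r. h r - a r * x r" "\<lambda>r. k r - b r * y r" "x' t - x' s"]
      hill_on_integral[OF assms(1), of s t] assms by auto
qed

text \<open>A periodic extension is ambiguous where two periods meet, and an indicator has the wrong
  value at the ends of a complementary arc. Both are repaired by changing the data at finitely many
  points.\<close>

lemma hill_on_spike:
  assumes "hill_on a h p q x x'" "finite N"
    and "\<And>t. p \<le> t \<Longrightarrow> t \<le> q \<Longrightarrow> t \<notin> N \<Longrightarrow> h t - a t * x t = k t - b t * x t"
  shows "hill_on b k p q x x'"
  unfolding hill_on_def
proof (intro conjI ballI allI impI)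
  fix s t assume st: "p \<le> s" "s \<le> t" "t \<le> q"
  show "((\<lambda>r. k r - b r * x r) has_integral x' t - x' s) {s..t}"
    by (rule has_integral_spike_finite[OF assms(2) _ hill_on_integral[OF assms(1) st]])
      (use assms(3) st in auto)
qed (use hill_on_deriv[OF assms(1)] in auto)

lemma hill_on_lincomb:
  assumes "hill_on a h p q x x'" "hill_on a k p q y y'"
  shows "hill_on a (\<lambda>t. c * h t + e * k t) p q (\<lambda>t. c * x t + e * y t) (\<lambda>t. c * x' t + e * y' t)"
  unfolding hill_on_def
proof (intro conjI ballI allI impI)
  fix t assume "t \<in> {p..q}"
  then show "((\<lambda>t. c * x t + e * y t) has_real_derivative c * x' t + e * y' t) (at t within {p..q})"
    using hill_on_deriv[OF assms(1)] hill_on_deriv[OF assms(2)]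
    by (auto intro!: derivative_eq_intros)
next
  fix s t assume st: "p \<le> s" "s \<le> t" "t \<le> q"
  have "((\<lambda>r. c * (h r - a r * x r) + e * (k r - a r * y r)) has_integral
     (c * (x' t - x' s) + e * (y' t - y' s))) {s..t}"
    by (intro has_integral_add has_integral_mult_right hill_on_integral[OF assms(1)] hill_on_integral[OF assms(2)] st)
  then show "((\<lambda>r. c * h r + e * k r - a r * (c * x r + e * y r)) has_integral
        c * x' t + e * y' t - (c * x' s + e * y' s)) {s..t}"
    by (simp add: algebra_simps)
qed

lemma hill_on_shift:
  assumes "hill_on a h p q x x'"
  shows "hill_on (\<lambda>t. a (t + c)) (\<lambda>t. h (t + c)) (p - c) (q - c) (\<lambda>t. x (t + c)) (\<lambda>t. x' (t + c))"
  unfolding hill_on_def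
proof (intro conjI ballI allI impI)
  fix t assume t: "t \<in> {p - c..q - c}"
  have "(x has_real_derivative x' (t + c)) (at (t + c) within {p..q})"
    using hill_on_deriv[OF assms] t by auto
  moreover have "((\<lambda>t. t + c) has_real_derivative 1) (at t within {p - c..q - c})"
    by (auto intro!: derivative_eq_intros)
  moreover have "(\<lambda>t. t + c) ` {p - c..q - c} = {p..q}" by (simp add: add.commute)
  ultimately show "((\<lambda>t. x (t + c)) has_real_derivative x' (t + c)) (at t within {p - c..q - c})"
    using DERIV_image_chain[of x "x' (t+c)" "\<lambda>t. t + c" t "{p - c..q - c}" 1] by (simp add: o_def)
next
  fix s t assume "p - c \<le> s" "s \<le> t" "t \<le> q - c"
  then have "((\<lambda>r. h r - a r * x r) has_integral (x' (t + c) - x' (s + c))) (cbox (s + c) (t + c))"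
    using hill_on_integral[OF assms] by auto
  from has_integral_affinity[OF this, of 1 c]
  have "((\<lambda>r. h (r + c) - a (r + c) * x (r + c)) has_integral (x' (t + c) - x' (s + c))) ((\<lambda>z. z - c) ` {s + c..t + c})"
    by simp
  moreover have "(\<lambda>z. z - c) ` {s + c..t + c} = {s..t}" 
    by (simp add: diff_conv_add_uminus del: add_uminus_conv_diff)
  ultimately show "((\<lambda>r. h (r + c) - a (r + c) * x (r + c)) has_integral x' (t + c) - x' (s + c)) {s..t}"
    by simp
qed

section \<open>Gronwall estimates in an exponentially weighted norm\<close>

lemma abs_integrable_subinterval:
  fixes a :: "real \<Rightarrow> real"
  assumes "a absolutely_integrable_on {p..q}" "p \<le> p'" "q' \<le> q"
  shows "a absolutely_integrable_on {p'..q'}"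
  by (rule absolutely_integrable_on_subinterval[OF assms(1)]) (use assms(2,3) in auto)

lemma abs_integrable_onD:
  fixes a :: "real \<Rightarrow> real"
  assumes "a absolutely_integrable_on {p..q}" "p \<le> p'" "q' \<le> q"
  shows "a integrable_on {p'..q'}" "(\<lambda>t. \<bar>a t\<bar>) integrable_on {p'..q'}"
  using abs_integrable_subinterval[OF assms]
  by (auto simp: absolutely_integrable_on_def)

lemma integral_abs_subinterval_le:
  fixes a :: "real \<Rightarrow> real"
  assumes "a absolutely_integrable_on {p..q}" "p \<le> p'" "q' \<le> q"
  shows "integral {p'..q'} (\<lambda>t. \<bar>a t\<bar>) \<le> integral {p..q} (\<lambda>t. \<bar>a t\<bar>)"
  using assms abs_integrable_onD[OF assms] abs_integrable_onD[OF assms(1), of p q]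
  by (intro integral_subset_le) auto

lemma increment_le_of_deriv_le:
  fixes x D :: "real \<Rightarrow> real"
  assumes "\<And>t. t \<in> {p..q} \<Longrightarrow> (x has_real_derivative x' t) (at t within {p..q})"
    and "\<And>t. t \<in> {p..q} \<Longrightarrow> (D has_real_derivative D' t) (at t within {p..q})"
    and "\<And>t. t \<in> {p..q} \<Longrightarrow> x' t \<le> D' t" "t \<in> {p..q}"
  shows "x t - x p \<le> D t - D p"
proof (cases "p < t")
  case True
  have "((\<lambda>t. D t - x t) has_derivative (\<lambda>h. (D' s - x' s) * h)) (at s within {p..t})"
    if "p \<le> s" "s \<le> t" for s
  proof -
    have "((\<lambda>t. D t - x t) has_real_derivative (D' s - x' s)) (at s within {p..q})"
      using that assms by (intro DERIV_diff) auto
    then show ?thesis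
      using assms(4) DERIV_subset[of _ _ s "{p..q}" "{p..t}"] by (auto simp: has_field_derivative_def)
  qed
  from mvt_simple[OF True this] obtain s where "s \<in> {p<..<t}"
      "D t - x t - (D p - x p) = (D' s - x' s) * (t - p)" by auto
  moreover have "(D' s - x' s) * (t - p) \<ge> 0" 
    using \<open>s \<in> {p<..<t}\<close> True assms(3)[of s] assms(4) by (intro mult_nonneg_nonneg) auto
  ultimately show ?thesis by linarith
qed (use assms(4) in auto)

text \<open>Basic estimate for Bielecki's norm \<open>N = sup |x s| exp (- K (s - p))\<close>: the
  weight is increasing and can be pulled out at its value at \<open>t\<close>. A second integration
  gains \<open>1 / K\<close>, so with \<open>K = A + 1\<close> and \<open>A\<close> the integral of
  \<open>|a|\<close> the total factor \<open>A / K\<close> is less than 1.\<close>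

lemma integral_abs_mult_exp_le:
  fixes a x :: "real \<Rightarrow> real"
  assumes "a absolutely_integrable_on {p..q}" "K \<ge> 0" "N \<ge> 0" "p \<le> t" "t \<le> q"
    and x: "continuous_on {p..q} x" "\<And>s. s \<in> {p..q} \<Longrightarrow> \<bar>x s\<bar> \<le> N * exp (K * (s - p))"
  shows "integral {p..t} (\<lambda>r. \<bar>a r\<bar> * \<bar>x r\<bar>) \<le> integral {p..q} (\<lambda>r. \<bar>a r\<bar>) * N * exp (K * (t - p))"
    and "(\<lambda>r. \<bar>a r\<bar> * \<bar>x r\<bar>) integrable_on {p..t}"
proof -
  have "(\<lambda>r. a r * x r) absolutely_integrable_on {p..q}"
    by (intro abs_integrable_mult assms)
  from abs_integrable_onD(2)[OF this, of p t] show i: "(\<lambda>r. \<bar>a r\<bar> * \<bar>x r\<bar>) integrable_on {p..t}"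
    using assms by (simp add: abs_mult)
  have "integral {p..t} (\<lambda>r. \<bar>a r\<bar> * \<bar>x r\<bar>) \<le> integral {p..t} (\<lambda>r. \<bar>a r\<bar> * (N * exp (K * (t - p))))"
  proof (rule integral_le[OF i])
    show "(\<lambda>r. \<bar>a r\<bar> * (N * exp (K * (t - p)))) integrable_on {p..t}"
      using abs_integrable_onD(2)[OF assms(1), of p t] assms by (intro integrable_on_mult_left) auto
  next
    fix s assume "s \<in> {p..t}"
    then have "\<bar>x s\<bar> \<le> N * exp (K * (s - p))" "K * (s - p) \<le> K * (t - p)" 
      using assms by (auto intro: mult_left_mono)
    then have "\<bar>x s\<bar> \<le> N * exp (K * (t - p))" using \<open>N \<ge> 0\<close>
      by (meson exp_le_cancel_iff mult_left_mono order_trans)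
    then show "\<bar>a s\<bar> * \<bar>x s\<bar> \<le> \<bar>a s\<bar> * (N * exp (K * (t - p)))" by (intro mult_left_mono) auto
  qed
  also have "\<dots> = integral {p..t} (\<lambda>r. \<bar>a r\<bar>) * (N * exp (K * (t - p)))"
    by simp
  also have "\<dots> \<le> integral {p..q} (\<lambda>r. \<bar>a r\<bar>) * (N * exp (K * (t - p)))"
    using assms by (intro mult_right_mono integral_abs_subinterval_le) auto
  finally show "integral {p..t} (\<lambda>r. \<bar>a r\<bar> * \<bar>x r\<bar>) \<le> integral {p..q} (\<lambda>r. \<bar>a r\<bar>) * N * exp (K * (t - p))"
    by (simp add: mult.assoc)
qed

lemma attains_weighted_sup:
  fixes x :: "real \<Rightarrow> real"
  assumes "continuous_on {p..q} x" "p \<le> q"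
  obtains N t where "t \<in> {p..q}" "N \<ge> 0" "\<bar>x t\<bar> = N * exp (K * (t - p))"
    "\<And>s. s \<in> {p..q} \<Longrightarrow> \<bar>x s\<bar> \<le> N * exp (K * (s - p))"
proof -
  have "continuous_on {p..q} (\<lambda>s. \<bar>x s\<bar> * exp (- K * (s - p)))"
    using assms by (intro continuous_intros)
  then have "\<exists>t\<in>{p..q}. \<forall>s\<in>{p..q}. \<bar>x s\<bar> * exp (- K * (s - p)) \<le> \<bar>x t\<bar> * exp (- K * (t - p))"
    using assms(2) by (intro continuous_attains_sup) auto
  then obtain t where t: "t \<in> {p..q}" "\<forall>s\<in>{p..q}. \<bar>x s\<bar> * exp (- K * (s - p)) \<le> \<bar>x t\<bar> * exp (- K * (t - p))"
    by blast
  show thesis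
  proof (rule that[OF t(1), of "\<bar>x t\<bar> * exp (- K * (t - p))"])
    fix s assume "s \<in> {p..q}"
    then have "\<bar>x s\<bar> * exp (- K * (s - p)) * exp (K * (s - p)) \<le> \<bar>x t\<bar> * exp (- K * (t - p)) * exp (K * (s - p))"
      using t by (intro mult_right_mono) auto
    moreover have "exp (- K * (s - p)) * exp (K * (s - p)) = 1"
      unfolding exp_add[symmetric] by simp
    ultimately show "\<bar>x s\<bar> \<le> \<bar>x t\<bar> * exp (- K * (t - p)) * exp (K * (s - p))"
      by (metis mult.assoc mult.right_neutral)
  next
    have "exp (- K * (t - p)) * exp (K * (t - p)) = 1"
      unfolding exp_add[symmetric] by simp
    then show "\<bar>x t\<bar> = \<bar>x t\<bar> * exp (- K * (t - p)) * exp (K * (t - p))"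
      by (metis mult.assoc mult.right_neutral)
  qed auto
qed

text \<open>As \<open>z\<close> is nonnegative, upper bounds alone control it, and
  \<open>h \<le> 0\<close> provides an upper bound for \<open>z'\<close>. At the point
  \<open>t1\<close> where the weighted norm \<open>N\<close> is attained this gives
  \<open>N \<le> A * N / K\<close> with \<open>A < K\<close>, hence \<open>N = 0\<close>.\<close>

lemma hill_on_nonneg_eq_zero:
  assumes z: "hill_on a h p q z z'" and a: "a absolutely_integrable_on {p..q}"
    and nn: "\<And>t. t \<in> {p..q} \<Longrightarrow> z t \<ge> 0" "\<And>t. t \<in> {p..q} \<Longrightarrow> h t \<le> 0"
    and z0: "z p = 0" "z' p = 0" and t: "t \<in> {p..q}"
  shows "z t = 0"
proof -
  have "p \<le> q" using t by simp
  define A where "A = integral {p..q} (\<lambda>r. \<bar>a r\<bar>)"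
  define K where "K = A + 1"
  have "A \<ge> 0" unfolding A_def using abs_integrable_onD(2)[OF a] by (intro integral_nonneg) auto
  then have "K > 0" by (simp add: K_def)
  obtain N t1 where N: "t1 \<in> {p..q}" "N \<ge> 0" "\<bar>z t1\<bar> = N * exp (K * (t1 - p))"
    "\<And>s. s \<in> {p..q} \<Longrightarrow> \<bar>z s\<bar> \<le> N * exp (K * (s - p))"
    by (rule attains_weighted_sup[OF hill_on_continuous[OF z] \<open>p \<le> q\<close>, where K=K]) (rule that; assumption)
  have bd: "z' s \<le> A * N * exp (K * (s - p))" if "s \<in> {p..q}" for s
  proof -
    have "z' s - z' p \<le> integral {p..s} (\<lambda>r. \<bar>a r\<bar> * \<bar>z r\<bar>)"
    proof (rule has_integral_le)
      show "((\<lambda>r. h r - a r * z r) has_integral (z' s - z' p)) {p..s}"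
        using hill_on_integral[OF z] that by auto
      show "((\<lambda>r. \<bar>a r\<bar> * \<bar>z r\<bar>) has_integral integral {p..s} (\<lambda>r. \<bar>a r\<bar> * \<bar>z r\<bar>)) {p..s}"
        using integral_abs_mult_exp_le(2)[OF a _ N(2) _ _ hill_on_continuous[OF z] N(4)] that \<open>K > 0\<close>
        by (intro integrable_integral) auto
    next
      fix r assume "r \<in> {p..s}"
      then have "h r \<le> 0" using nn(2)[of r] that by auto
      moreover have "- (a r * z r) \<le> \<bar>a r\<bar> * \<bar>z r\<bar>" by (simp flip: abs_mult)
      ultimately show "h r - a r * z r \<le> \<bar>a r\<bar> * \<bar>z r\<bar>" by linarith
    qed
    also have "\<dots> \<le> A * N * exp (K * (s - p))" unfolding A_def
      using integral_abs_mult_exp_le(1)[OF a _ N(2) _ _ hill_on_continuous[OF z] N(4)] that \<open>K > 0\<close> by auto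
    finally show ?thesis using z0 by simp
  qed
  have "z t1 - z p \<le> A * N / K * exp (K * (t1 - p)) - A * N / K * exp (K * (p - p))"
  proof (rule increment_le_of_deriv_le[OF hill_on_deriv[OF z] _ bd N(1)])
    fix s
    show "((\<lambda>s. A * N / K * exp (K * (s - p))) has_real_derivative A * N * exp (K * (s - p))) (at s within {p..q})"
      using \<open>K > 0\<close> by (auto intro!: derivative_eq_intros)
  qed auto
  moreover have "A * N / K * exp (K * (p - p)) \<ge> 0" using \<open>A \<ge> 0\<close> \<open>N \<ge> 0\<close> \<open>K > 0\<close> by auto
  moreover have "z t1 = N * exp (K * (t1 - p))" using N nn(1)[of t1] by auto
  ultimately have "N * exp (K * (t1 - p)) \<le> A * N / K * exp (K * (t1 - p))" using z0 by linarith
  then have "N \<le> A * N / K" by (simp only: mult_le_cancel_right) auto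
  then have "N * K \<le> A * N" using \<open>K > 0\<close> by (simp add: pos_le_divide_eq)
  then have "N \<le> 0" by (simp add: K_def algebra_simps)
  then have "N = 0" using N(2) by simp
  then show ?thesis using N(4)[OF t] by simp
qed

text \<open>The constants are explicit because three features are used later: the bounds are linear
  in the initial data and in \<open>H\<close>, vanish when these vanish (uniqueness), and depend on
  \<open>a\<close> only through \<open>A\<close> (uniformity in the spectral parameter).\<close>

lemma hill_on_bound:
  assumes x: "hill_on a h p q x x'" and a: "a absolutely_integrable_on {p..q}"
    and h: "h absolutely_integrable_on {p..q}"
    and A: "integral {p..q} (\<lambda>r. \<bar>a r\<bar>) \<le> A" and H: "integral {p..q} (\<lambda>r. \<bar>h r\<bar>) \<le> H"
    and t: "t \<in> {p..q}"
  shows "\<bar>x t\<bar> \<le> (A + 1) * (\<bar>x p\<bar> + (\<bar>x' p\<bar> + H) * (q - p)) * exp ((A + 1) * (q - p))"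
    and "\<bar>x' t\<bar> \<le> \<bar>x' p\<bar> + H + A * ((A + 1) * (\<bar>x p\<bar> + (\<bar>x' p\<bar> + H) * (q - p))) * exp ((A + 1) * (q - p))"
proof -
  have "p \<le> q" using t by simp
  define K where "K = A + 1"
  have "integral {p..q} (\<lambda>r. \<bar>a r\<bar>) \<ge> 0" using abs_integrable_onD(2)[OF a] by (intro integral_nonneg) auto
  then have "A \<ge> 0" "K > 0" using A by (simp_all add: K_def)
  have "integral {p..q} (\<lambda>r. \<bar>h r\<bar>) \<ge> 0" using abs_integrable_onD(2)[OF h] by (intro integral_nonneg) auto
  then have "H \<ge> 0" using H by simp
  obtain N t1 where N: "t1 \<in> {p..q}" "N \<ge> 0" "\<bar>x t1\<bar> = N * exp (K * (t1 - p))"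
    "\<And>s. s \<in> {p..q} \<Longrightarrow> \<bar>x s\<bar> \<le> N * exp (K * (s - p))"
    by (rule attains_weighted_sup[OF hill_on_continuous[OF x] \<open>p \<le> q\<close>, where K=K]) (rule that; assumption)
  have bd: "\<bar>x' s\<bar> \<le> \<bar>x' p\<bar> + H + A * N * exp (K * (s - p))" if s: "s \<in> {p..q}" for s
  proof -
    have ax: "(\<lambda>r. \<bar>a r\<bar> * \<bar>x r\<bar>) integrable_on {p..s}"
      using integral_abs_mult_exp_le(2)[OF a _ N(2) _ _ hill_on_continuous[OF x] N(4)] that \<open>K > 0\<close> by auto
    have hh: "(\<lambda>r. \<bar>h r\<bar>) integrable_on {p..s}" using abs_integrable_onD(2)[OF h] s by auto
    have "((\<lambda>r. h r - a r * x r) has_integral (x' s - x' p)) {p..s}"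
      using hill_on_integral[OF x] s by auto
    moreover have "norm (integral {p..s} (\<lambda>r. h r - a r * x r)) \<le> integral {p..s} (\<lambda>r. \<bar>h r\<bar> + \<bar>a r\<bar> * \<bar>x r\<bar>)"
      using calculation ax hh
      by (intro integral_norm_bound_integral integrable_add)
        (auto simp flip: abs_mult)
    ultimately have "\<bar>x' s - x' p\<bar> \<le> integral {p..s} (\<lambda>r. \<bar>h r\<bar> + \<bar>a r\<bar> * \<bar>x r\<bar>)"
      by (simp add: integral_unique)
    also have "\<dots> = integral {p..s} (\<lambda>r. \<bar>h r\<bar>) + integral {p..s} (\<lambda>r. \<bar>a r\<bar> * \<bar>x r\<bar>)"
      by (intro hk_add ax hh)
    also have "integral {p..s} (\<lambda>r. \<bar>h r\<bar>) \<le> H"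
      using integral_abs_subinterval_le[OF h, of p s] H s by auto
    also have "integral {p..s} (\<lambda>r. \<bar>a r\<bar> * \<bar>x r\<bar>) \<le> integral {p..q} (\<lambda>r. \<bar>a r\<bar>) * N * exp (K * (s - p))"
      using integral_abs_mult_exp_le(1)[OF a _ N(2) _ _ hill_on_continuous[OF x] N(4)] s \<open>K > 0\<close> by auto
    also have "\<dots> \<le> A * N * exp (K * (s - p))"
      using A N by (intro mult_right_mono) auto
    finally show ?thesis by linarith
  qed
  have "\<bar>x t1\<bar> \<le> \<bar>x p\<bar> + (\<bar>x' p\<bar> + H) * (t1 - p) + A * N / K * exp (K * (t1 - p))"
  proof -
    let ?D = "\<lambda>s. (\<bar>x' p\<bar> + H) * s + A * N / K * exp (K * (s - p))"
    have D: "(?D has_real_derivative (\<bar>x' p\<bar> + H) + A * N * exp (K * (s - p))) (at s within {p..q})" for s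
      using \<open>K > 0\<close> by (auto intro!: derivative_eq_intros)
    have "x t1 - x p \<le> ?D t1 - ?D p"
      by (rule increment_le_of_deriv_le[OF hill_on_deriv[OF x] D _ N(1)]) (use bd in fastforce)+
    moreover have "- x t1 - (- x p) \<le> ?D t1 - ?D p"
      by (rule increment_le_of_deriv_le[OF DERIV_minus[OF hill_on_deriv[OF x]] D _ N(1)]) (use bd in fastforce)+
    moreover have "A * N / K * exp (K * (p - p)) \<ge> 0" using \<open>A \<ge> 0\<close> \<open>N \<ge> 0\<close> \<open>K > 0\<close> by auto
    ultimately show ?thesis by (auto simp: algebra_simps)
  qed
  also have "(\<bar>x' p\<bar> + H) * (t1 - p) \<le> (\<bar>x' p\<bar> + H) * (q - p)"
    using N(1) \<open>H \<ge> 0\<close> by (intro mult_left_mono) auto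
  also have "\<bar>x p\<bar> + (\<bar>x' p\<bar> + H) * (q - p) \<le> (\<bar>x p\<bar> + (\<bar>x' p\<bar> + H) * (q - p)) * exp (K * (t1 - p))"
    using N(1) \<open>H \<ge> 0\<close> \<open>K > 0\<close> by (simp add: mult_le_cancel_left1) (smt (verit) mult_nonneg_nonneg)
  finally have "N * exp (K * (t1 - p)) \<le> ((\<bar>x p\<bar> + (\<bar>x' p\<bar> + H) * (q - p)) + A * N / K) * exp (K * (t1 - p))"
    unfolding N(3) by (simp add: distrib_right)
  then have "N \<le> (\<bar>x p\<bar> + (\<bar>x' p\<bar> + H) * (q - p)) + A * N / K"
    by (simp only: mult_le_cancel_right) auto
  \<comment> \<open>Solving for \<open>N\<close> uses \<open>1 - A / K = 1 / K\<close>; this is the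
    origin of the factor \<open>A + 1\<close>.\<close>
  then have NN: "N \<le> (A + 1) * (\<bar>x p\<bar> + (\<bar>x' p\<bar> + H) * (q - p))"
    using \<open>K > 0\<close> by (simp add: K_def field_simps)
  have ee: "exp (K * (t - p)) \<le> exp (K * (q - p))" using t \<open>K > 0\<close> by simp
  have "N * exp (K * (t - p)) \<le> (A + 1) * (\<bar>x p\<bar> + (\<bar>x' p\<bar> + H) * (q - p)) * exp (K * (q - p))"
    using NN ee \<open>N \<ge> 0\<close> by (intro mult_mono) auto
  then show "\<bar>x t\<bar> \<le> (A + 1) * (\<bar>x p\<bar> + (\<bar>x' p\<bar> + H) * (q - p)) * exp ((A + 1) * (q - p))"
    using N(4)[OF t] by (simp add: K_def)
  have "A * (N * exp (K * (t - p))) \<le> A * ((A + 1) * (\<bar>x p\<bar> + (\<bar>x' p\<bar> + H) * (q - p)) * exp (K * (q - p)))"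
    using \<open>N * exp (K * (t - p)) \<le> _\<close> \<open>A \<ge> 0\<close> by (rule mult_left_mono)
  then show "\<bar>x' t\<bar> \<le> \<bar>x' p\<bar> + H + A * ((A + 1) * (\<bar>x p\<bar> + (\<bar>x' p\<bar> + H) * (q - p))) * exp ((A + 1) * (q - p))"
    using bd[OF t] by (simp add: K_def mult.assoc)
qed

text \<open>Integrate \<open>x'' y\<close> and \<open>y'' x\<close> by parts and subtract: the terms
  \<open>a x y\<close> and \<open>x' y'\<close> cancel. Zero right-hand sides give the constancy of
  the Wronskian, periodic boundary values the symmetry of the solution operator.\<close>

lemma hill_lagrange_identity:
  assumes x: "hill_on a h p q x x'" and y: "hill_on a k p q y y'" and "p \<le> q"
    and a: "a absolutely_integrable_on {p..q}"
    and h: "h absolutely_integrable_on {p..q}" and k: "k absolutely_integrable_on {p..q}"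
  shows "((\<lambda>r. h r * y r - k r * x r) has_integral
     (x' q * y q - x q * y' q) - (x' p * y p - x p * y' p)) {p..q}"
proof -
  have gx: "(\<lambda>r. h r - a r * x r) absolutely_integrable_on {p..q}"
    by (intro set_integral_diff h abs_integrable_mult a hill_on_continuous[OF x])
  have gy: "(\<lambda>r. k r - a r * y r) absolutely_integrable_on {p..q}"
    by (intro set_integral_diff k abs_integrable_mult a hill_on_continuous[OF y])
  have 1: "((\<lambda>r. (h r - a r * x r) * y r + x' r * y' r) has_integral x' q * y q - x' p * y p) {p..q}"
    by (rule has_integral_by_parts[OF \<open>p \<le> q\<close> gx hill_on_integral[OF x] hill_on_deriv[OF y]
          hill_on_C1[OF y]])
  have 2: "((\<lambda>r. (k r - a r * y r) * x r + y' r * x' r) has_integral y' q * x q - y' p * x p) {p..q}"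
    by (rule has_integral_by_parts[OF \<open>p \<le> q\<close> gy hill_on_integral[OF y] hill_on_deriv[OF x]
          hill_on_C1[OF x]])
  show ?thesis using has_integral_diff[OF 1 2] by (simp add: algebra_simps)
qed

text \<open>Touching argument: raise \<open>y\<close> by the multiple of \<open>X\<close> that makes it touch zero from above; the
  contact is of second order, so the sum vanishes up to the right end point, where it is positive.\<close>

lemma hill_max_principle:
  assumes X: "hill_on a k p q X X'" "\<And>t. t \<in> {p..q} \<Longrightarrow> k t \<le> 0" "\<And>t. t \<in> {p..q} \<Longrightarrow> X t > 0"
    and y: "hill_on a h p q y y'" "\<And>t. t \<in> {p..q} \<Longrightarrow> h t \<le> 0" "y p \<ge> 0" "y q \<ge> 0"
    and a: "a absolutely_integrable_on {p..q}" and t: "t \<in> {p..q}"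
  shows "y t \<ge> 0"
proof (rule ccontr)
  assume "\<not> 0 \<le> y t"
  have "continuous_on {p..q} (\<lambda>s. y s / X s)"
    using X(3) by (intro continuous_intros hill_on_continuous[OF X(1)] hill_on_continuous[OF y(1)]) force
  then have "\<exists>s\<in>{p..q}. \<forall>r\<in>{p..q}. y s / X s \<le> y r / X r"
    using t by (intro continuous_attains_inf) auto
  then obtain s where s: "s \<in> {p..q}" "\<forall>r\<in>{p..q}. y s / X s \<le> y r / X r" by blast
  define \<kappa> where "\<kappa> = - (y s / X s)"
  have "y s / X s \<le> y t / X t" using s t by auto
  moreover have "y t / X t < 0" using X(3)[OF t] \<open>\<not> 0 \<le> y t\<close> by (simp add: divide_less_0_iff)
  ultimately have "\<kappa> > 0" by (simp add: \<kappa>_def)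
  have zn: "y r + \<kappa> * X r \<ge> 0" if "r \<in> {p..q}" for r
  proof -
    have "y s / X s \<le> y r / X r" using s(2) that by blast
    then have "y s / X s * X r \<le> y r" by (simp only: pos_le_divide_eq[OF X(3)[OF that]])
    then show ?thesis by (simp add: \<kappa>_def)
  qed
  have zs: "y s + \<kappa> * X s = 0" using X(3)[OF s(1)] by (simp add: \<kappa>_def)
  have "s \<noteq> p" "s \<noteq> q" 
    using zs y(3,4) mult_pos_pos[OF \<open>\<kappa> > 0\<close> X(3)[OF s(1)]] by (auto simp del: zero_less_mult_iff)
  then have si: "p < s" "s < q" using s(1) by auto
  have z: "hill_on a (\<lambda>t. h t + \<kappa> * k t) p q (\<lambda>t. y t + \<kappa> * X t) (\<lambda>t. y' t + \<kappa> * X' t)"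
    using hill_on_lincomb[OF y(1) X(1), of 1 \<kappa>] by simp
  have "((\<lambda>t. y t + \<kappa> * X t) has_real_derivative (y' s + \<kappa> * X' s)) (at s)"
    using hill_on_deriv[OF z s(1)] si by (simp add: at_within_Icc_at)
  then have z': "y' s + \<kappa> * X' s = 0"
    by (rule DERIV_local_min[where d="min (s - p) (q - s)"]) (use si zn zs in \<open>auto simp: abs_real_def split: if_splits\<close>)
  have hk: "h r + \<kappa> * k r \<le> 0" if "r \<in> {p..q}" for r
    using y(2)[OF that] X(2)[OF that] \<open>\<kappa> > 0\<close> by (smt (verit) mult_nonneg_nonpos)
  have "y q + \<kappa> * X q = 0"
    by (rule hill_on_nonneg_eq_zero[OF hill_on_subset[OF z, of s q] abs_integrable_subinterval[OF a] zn hk zs z'])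
      (use si in auto)
  moreover have "\<kappa> * X q > 0" using \<open>\<kappa> > 0\<close> X(3)[of q] si by auto
  ultimately show False using y(4) by linarith
qed

text \<open>Banach's fixed point theorem for the twice integrated equation. The unknown is
  \<open>w t = exp (- K * t) * x t\<close>, so that the ordinary sup norm of \<open>w\<close> is the
  weighted norm of \<open>x\<close> and the map contracts with factor \<open>A / K\<close> on all of
  \<open>[0, L]\<close> at once.\<close>

lemma hill_ivp:
  assumes a: "a absolutely_integrable_on {0..L}" and "L \<ge> 0"
  obtains x x' where "hill_on a (\<lambda>_. 0) 0 L x x'" "x 0 = \<alpha>" "x' 0 = \<beta>"
proof -
  define A where "A = integral {0..L} (\<lambda>r. \<bar>a r\<bar>)"
  define K where "K = A + 1"
  have "A \<ge> 0" unfolding A_def using abs_integrable_onD(2)[OF a] by (intro integral_nonneg) auto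
  then have "K > 0" by (simp add: K_def)
  define I1 where "I1 w s = integral {0..s} (\<lambda>r. a r * (exp (K * r) * w r))" for w :: "real \<Rightarrow> real" and s
  define V where "V w t = exp (- K * t) * (\<alpha> + \<beta> * t - integral {0..t} (I1 w))" for w :: "real \<Rightarrow> real" and t
  have ai: "(\<lambda>r. a r * (exp (K * r) * w r)) absolutely_integrable_on {0..L}" if "continuous_on {0..L} w" for w
    using that by (intro abs_integrable_mult a continuous_intros)
  have I1c: "continuous_on {0..L} (I1 w)" if "continuous_on {0..L} w" for w
    unfolding I1_def using abs_integrable_onD(1)[OF ai[OF that]]
    by (intro indefinite_integral_continuous_1) auto
  have Vc: "continuous_on (cbox 0 L) (V w)" if "continuous_on {0..L} w" for w
    unfolding V_def using integrable_continuous_real[OF I1c[OF that]]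
    by (auto intro!: continuous_intros indefinite_integral_continuous_1)
  \<comment> \<open>The complete space at hand consists of bounded continuous functions on the whole
    line; \<open>clamp\<close> extends \<open>V w\<close> beyond \<open>[0, L]\<close> by its end
    values.\<close>
  have "\<exists>g :: real \<Rightarrow>\<^sub>C real. \<forall>t. g t = V w (clamp 0 L t)" for w :: "real \<Rightarrow>\<^sub>C real"
    using continuous_on_cbox_bcontfunE[OF Vc] continuous_on_apply_bcontfun by metis
  then obtain \<Phi> :: "(real \<Rightarrow>\<^sub>C real) \<Rightarrow> (real \<Rightarrow>\<^sub>C real)" where \<Phi>: "\<And>w t. \<Phi> w t = V w (clamp 0 L t)"
    by metis
  have "dist (\<Phi> v) (\<Phi> w) \<le> A / K * dist v w" for v w
  proof (rule dist_bound)
    fix t0 :: real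
    define t where "t = clamp 0 L t0"
    have t: "t \<in> {0..L}" using clamp_in_interval[of 0 L t0] \<open>L \<ge> 0\<close> by (simp add: t_def)
    define D where "D = dist v w"
    have vw: "\<bar>v r - w r\<bar> \<le> D" for r using dist_bounded[of v r w] by (simp add: D_def dist_real_def)
    have I1d: "norm (I1 v s - I1 w s) \<le> A * D * exp (K * s)" if s: "s \<in> {0..t}" for s
    proof -
      have i: "(\<lambda>r. a r * (exp (K * r) * v r)) integrable_on {0..s}" "(\<lambda>r. a r * (exp (K * r) * w r)) integrable_on {0..s}"
        using abs_integrable_onD(1)[OF ai] s t by auto
      have D0: "0 \<le> D" by (simp add: D_def)
      have cc: "continuous_on {0..L} (\<lambda>r. exp (K * r) * (v r - w r))" by (intro continuous_intros) auto
      have bb: "\<bar>exp (K * r) * (v r - w r)\<bar> \<le> D * exp (K * (r - 0))" for r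
        using vw[of r] by (simp add: abs_mult mult.commute)
      have j: "(\<lambda>r. \<bar>a r\<bar> * \<bar>exp (K * r) * (v r - w r)\<bar>) integrable_on {0..s}"
          "integral {0..s} (\<lambda>r. \<bar>a r\<bar> * \<bar>exp (K * r) * (v r - w r)\<bar>) \<le> integral {0..L} (\<lambda>r. \<bar>a r\<bar>) * D * exp (K * (s - 0))"
        using integral_abs_mult_exp_le[OF a _ D0 _ _ cc bb] s t \<open>K > 0\<close> by auto
      have "I1 v s - I1 w s = integral {0..s} (\<lambda>r. a r * (exp (K * r) * (v r - w r)))"
        unfolding I1_def right_diff_distrib by (rule integral_diff[symmetric]) (use i in auto)
      also have "norm \<dots> \<le> integral {0..s} (\<lambda>r. \<bar>a r\<bar> * \<bar>exp (K * r) * (v r - w r)\<bar>)"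
        by (rule integral_norm_bound_integral[OF _ j(1)])
          (use integrable_diff[OF i] in \<open>simp_all only: right_diff_distrib flip: abs_mult, simp\<close>)
      finally show ?thesis using j(2) by (simp add: A_def)
    qed
    have e: "((\<lambda>s. A * D * exp (K * s)) has_integral (A * D / K * exp (K * t) - A * D / K * exp (K * 0))) {0..t}"
      using t \<open>K > 0\<close>
      by (intro fundamental_theorem_of_calculus)
        (auto intro!: derivative_eq_intros simp flip: has_real_derivative_iff_has_vector_derivative)
    have i: "I1 v integrable_on {0..t}" "I1 w integrable_on {0..t}"
      using t by (auto intro!: integrable_continuous_real continuous_on_subset[OF I1c])
    have "norm (integral {0..t} (I1 v) - integral {0..t} (I1 w)) = norm (integral {0..t} (\<lambda>s. I1 v s - I1 w s))"
      using i by (simp add: integral_diff)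
    also have "\<dots> \<le> integral {0..t} (\<lambda>s. A * D * exp (K * s))"
      by (rule integral_norm_bound_integral[OF integrable_diff[OF i] has_integral_integrable[OF e] I1d])
    also have "\<dots> \<le> A * D / K * exp (K * t)"
      unfolding integral_unique[OF e] using \<open>A \<ge> 0\<close> \<open>K > 0\<close> by (simp add: D_def)
    finally have *: "\<bar>integral {0..t} (I1 v) - integral {0..t} (I1 w)\<bar> \<le> A * D / K * exp (K * t)" by simp
    have "dist (\<Phi> v t0) (\<Phi> w t0) = exp (- K * t) * \<bar>integral {0..t} (I1 v) - integral {0..t} (I1 w)\<bar>"
      unfolding \<Phi> t_def[symmetric] V_def dist_real_def right_diff_distrib[symmetric] abs_mult by simp
    also have "\<dots> \<le> exp (- K * t) * (A * D / K * exp (K * t))" using * by (intro mult_left_mono) auto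
    also have "\<dots> = A / K * D" by (simp flip: exp_add)
    finally show "dist (\<Phi> v t0) (\<Phi> w t0) \<le> A / K * dist v w" by (simp add: D_def)
  qed
  then have "\<exists>!w\<in>UNIV. \<Phi> w = w"
    using \<open>A \<ge> 0\<close> \<open>K > 0\<close> by (intro Banach_fix[of _ "A / K"]) (auto simp: K_def complete_UNIV)
  then obtain w where "\<Phi> w = w" by auto
  define x where "x t = \<alpha> + \<beta> * t - integral {0..t} (I1 w)" for t
  define x' where "x' t = \<beta> - I1 w t" for t
  have wx: "exp (K * t) * w t = x t" if "t \<in> {0..L}" for t
  proof -
    have "w t = V w t" using \<Phi>[of w t] \<open>\<Phi> w = w\<close> that by (simp add: clamp_cancel_cbox)
    then show ?thesis by (simp add: V_def x_def flip: exp_add mult.assoc)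
  qed
  have "hill_on a (\<lambda>_. 0) 0 L x x'"
    unfolding hill_on_def
  proof (intro conjI ballI allI impI)
    fix t assume "t \<in> {0..L}"
    then show "(x has_real_derivative x' t) (at t within {0..L})"
      unfolding x_def x'_def
      by (auto intro!: derivative_eq_intros integral_has_real_derivative I1c)
  next
    fix s t assume st: "(0::real) \<le> s" "s \<le> t" "t \<le> L"
    let ?f = "\<lambda>r. a r * (exp (K * r) * w r)"
    have fi: "?f integrable_on {u..v}" if "0 \<le> u" "v \<le> L" for u v
      using abs_integrable_onD(1)[OF ai] that by auto
    have "integral {0..s} ?f + integral {s..t} ?f = integral {0..t} ?f"
      using st by (intro hk_combine fi) auto
    then have "- integral {s..t} ?f = x' t - x' s"
      by (simp add: x'_def I1_def)
    then have "((\<lambda>r. - ?f r) has_integral (x' t - x' s)) {s..t}"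
      using has_integral_neg[OF integrable_integral[OF fi[of s t]]] st by simp
    then show "((\<lambda>r. 0 - a r * x r) has_integral x' t - x' s) {s..t}"
      by (rule has_integral_eq[rotated]) (use st wx in auto)
  qed
  moreover have "x 0 = \<alpha>" "x' 0 = \<beta>" by (auto simp: x_def x'_def I1_def)
  ultimately show thesis using that by blast
qed

section \<open>Disconjugacy\<close>

lemma singular_matrix2_kernel:
  fixes A B C D :: real
  assumes "A * D - B * C = 0"
  obtains x y where "(x, y) \<noteq> (0, 0)" "A * x + B * y = 0" "C * x + D * y = 0"
proof (cases "A = 0 \<and> B = 0")
  case True
  show thesis
  proof (cases "C = 0 \<and> D = 0")
    case True
    then show thesis using that[of 1 0] \<open>A = 0 \<and> B = 0\<close> by auto
  next
    case False
    then show thesis using that[of "- D" C] True by auto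
  qed
next
  case False
  then show thesis using that[of "- B" A] assms by (auto simp: algebra_simps)
qed

lemma matrix2_eigenvalue_char_poly:
  fixes A B C D :: real
  assumes "A * x + B * y = r * x" "C * x + D * y = r * y" "(x, y) \<noteq> (0, 0)"
  shows "(A - r) * (D - r) - B * C = 0"
proof -
  have "(A - r) * x = - (B * y)" "(D - r) * y = - (C * x)"
    using assms by (auto simp: algebra_simps)
  then have "((A - r) * (D - r) - B * C) * x = 0" "((A - r) * (D - r) - B * C) * y = 0"
    by (simp_all add: algebra_simps) (algebra, algebra)
  then show ?thesis using assms(3) by auto
qed

text \<open>Two periods suffice: every arc considered starts in \<open>[0, T]\<close> and has length
  at most \<open>T\<close>. Periodicity is asked for \<open>t > 0\<close> only, since an extension
  of a function on \<open>[0, T]\<close> with different values at \<open>0\<close> and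
  \<open>T\<close> can keep only one of them at \<open>T\<close>.\<close>

locale periodic_hill =
  fixes T :: real and a :: "real \<Rightarrow> real"
  assumes T_pos: "T > 0"
    and a_integrable: "a absolutely_integrable_on {0..2 * T}"
    and a_periodic: "\<And>t. 0 < t \<Longrightarrow> t \<le> T \<Longrightarrow> a (t + T) = a t"

abbreviation (in periodic_hill) homogeneous :: "real \<Rightarrow> (real \<Rightarrow> real) \<Rightarrow> (real \<Rightarrow> real) \<Rightarrow> bool" where
  "homogeneous l \<equiv> hill_on (\<lambda>t. a t + l) (\<lambda>_. 0) 0 (2 * T)"

text \<open>For each parameter \<open>l\<close> the values at \<open>T\<close> form the monodromy
  matrix, with rows \<open>(u l T, v l T)\<close> and \<open>(u' l T, v' l T)\<close>. Its trace
  \<open>u l T + v' l T\<close> is Hill's discriminant.\<close>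

locale hill_fundamental = periodic_hill +
  fixes u u' v v' :: "real \<Rightarrow> real \<Rightarrow> real"
  assumes u: "\<And>l. homogeneous l (u l) (u' l)"
    and v: "\<And>l. homogeneous l (v l) (v' l)"
    and init: "\<And>l. u l 0 = 1" "\<And>l. u' l 0 = 0" "\<And>l. v l 0 = 0" "\<And>l. v' l 0 = 1"

lemma (in periodic_hill) coefficient_integrable:
  assumes "0 \<le> p" "q \<le> 2 * T"
  shows "(\<lambda>t. a t + l) absolutely_integrable_on {p..q}"
  by (intro set_integral_add abs_integrable_subinterval[OF a_integrable] assms
      absolutely_integrable_on_const) auto

lemma (in periodic_hill) ex_hill_fundamental:
  "\<exists>u u' v v'. hill_fundamental T a u u' v v'"
proof -
  have "\<exists>F. \<forall>l. homogeneous l (fst (F l)) (snd (F l)) \<and> fst (F l) 0 = \<alpha> \<and> snd (F l) 0 = \<beta>"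
    for \<alpha> \<beta>
  proof (intro choice allI)
    fix l
    have "0 \<le> 2 * T" using T_pos by simp
    show "\<exists>p. homogeneous l (fst p) (snd p) \<and> fst p 0 = \<alpha> \<and> snd p 0 = \<beta>"
      by (rule hill_ivp[OF coefficient_integrable[of 0 "2 * T" l] \<open>0 \<le> 2 * T\<close>, of \<alpha> \<beta>]) auto
  qed
  from this[of 1 0] this[of 0 1] obtain F G where
    "\<forall>l. homogeneous l (fst (F l)) (snd (F l)) \<and> fst (F l) 0 = 1 \<and> snd (F l) 0 = 0"
    "\<forall>l. homogeneous l (fst (G l)) (snd (G l)) \<and> fst (G l) 0 = 0 \<and> snd (G l) 0 = 1"
    by blast
  then have "hill_fundamental T a (\<lambda>l. fst (F l)) (\<lambda>l. snd (F l)) (\<lambda>l. fst (G l)) (\<lambda>l. snd (G l))"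
    by unfold_locales auto
  then show ?thesis by blast
qed

text \<open>The difference \<open>x l - x m\<close> has zero initial data and solves the equation
  with coefficient \<open>a + l\<close> and right-hand side \<open>(m - l) * x m\<close>. By the
  first bound this right-hand side is of order \<open>|l - m|\<close>, and so is the
  difference.\<close>

lemma (in periodic_hill) parameter_bounds:
  fixes x x' :: "real \<Rightarrow> real \<Rightarrow> real"
  assumes x: "\<And>l. homogeneous l (x l) (x' l)"
    and init: "\<And>l. x l 0 = \<alpha>" "\<And>l. x' l 0 = \<beta>" and "B \<ge> 0"
  shows "\<exists>X\<ge>0. \<forall>l\<in>{-B..B}. \<forall>t\<in>{0..2 * T}. \<bar>x l t\<bar> \<le> X \<and> \<bar>x' l t\<bar> \<le> X"
    and "\<exists>L\<ge>0. \<forall>l\<in>{-B..B}. \<forall>m\<in>{-B..B}. \<forall>t\<in>{0..2 * T}.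
            \<bar>x l t - x m t\<bar> \<le> L * \<bar>l - m\<bar> \<and> \<bar>x' l t - x' m t\<bar> \<le> L * \<bar>l - m\<bar>"
proof -
  define A where "A = integral {0..2 * T} (\<lambda>r. \<bar>a r\<bar>) + 2 * T * B"
  have A: "integral {0..2 * T} (\<lambda>r. \<bar>a r + l\<bar>) \<le> A" if "l \<in> {-B..B}" for l
  proof -
    have "integral {0..2 * T} (\<lambda>r. \<bar>a r + l\<bar>) \<le> integral {0..2 * T} (\<lambda>r. \<bar>a r\<bar> + B)"
      using that abs_integrable_onD(2)[OF coefficient_integrable[of 0 "2 * T" l]]
        abs_integrable_onD(2)[OF a_integrable]
      by (intro integral_le integrable_add) auto
    also have "\<dots> = A" unfolding A_def
      using abs_integrable_onD(2)[OF a_integrable] T_pos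
      by (subst hk_add) auto
    finally show ?thesis .
  qed
  have "A \<ge> 0" unfolding A_def
    using abs_integrable_onD(2)[OF a_integrable] T_pos \<open>B \<ge> 0\<close> by (intro add_nonneg_nonneg integral_nonneg) auto
  define X where "X = (A + 1) * (\<bar>\<alpha>\<bar> + \<bar>\<beta>\<bar> * (2 * T)) * exp ((A + 1) * (2 * T))"
  define X' where "X' = \<bar>\<beta>\<bar> + A * ((A + 1) * (\<bar>\<alpha>\<bar> + \<bar>\<beta>\<bar> * (2 * T))) * exp ((A + 1) * (2 * T))"
  have X0: "X \<ge> 0" "X' \<ge> 0" using \<open>A \<ge> 0\<close> T_pos by (auto simp: X_def X'_def)
  have bound: "\<bar>x l t\<bar> \<le> X" "\<bar>x' l t\<bar> \<le> X'" if "l \<in> {-B..B}" "t \<in> {0..2 * T}" for l t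
    using hill_on_bound[OF x coefficient_integrable _ A[OF that(1)] _ that(2), of 0] 
    by (auto simp: init X_def X'_def)
  show "\<exists>X\<ge>0. \<forall>l\<in>{-B..B}. \<forall>t\<in>{0..2 * T}. \<bar>x l t\<bar> \<le> X \<and> \<bar>x' l t\<bar> \<le> X"
    using bound X0 by (intro exI[of _ "max X X'"]) (auto simp: le_max_iff_disj)
  define L1 where "L1 = (A + 1) * (2 * T * X * (2 * T)) * exp ((A + 1) * (2 * T))"
  define L2 where "L2 = 2 * T * X + A * ((A + 1) * (2 * T * X * (2 * T))) * exp ((A + 1) * (2 * T))"
  have L0: "L1 \<ge> 0" "L2 \<ge> 0" using \<open>A \<ge> 0\<close> T_pos X0 by (auto simp: L1_def L2_def)
  have lip: "\<bar>x l t - x m t\<bar> \<le> L1 * \<bar>l - m\<bar>" "\<bar>x' l t - x' m t\<bar> \<le> L2 * \<bar>l - m\<bar>"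
    if lm: "l \<in> {-B..B}" "m \<in> {-B..B}" and t: "t \<in> {0..2 * T}" for l m t
  proof -
    have "hill_on (\<lambda>t. a t + l) (\<lambda>t. (l - m) * x m t) 0 (2 * T) (x m) (x' m)"
      by (rule hill_on_cong[OF x[of m]]) (auto simp: algebra_simps)
    from hill_on_lincomb[OF x[of l] this, of 1 "-1"]
    have z: "hill_on (\<lambda>t. a t + l) (\<lambda>t. (m - l) * x m t) 0 (2 * T) (\<lambda>t. x l t - x m t) (\<lambda>t. x' l t - x' m t)"
      by (rule hill_on_cong) (auto simp: algebra_simps)
    have hi: "(\<lambda>t. (m - l) * x m t) absolutely_integrable_on {0..2 * T}"
      by (intro absolutely_integrable_continuous_real continuous_intros hill_on_continuous[OF x])
    have "integral {0..2 * T} (\<lambda>t. \<bar>(m - l) * x m t\<bar>) \<le> integral {0..2 * T} (\<lambda>t. X * \<bar>l - m\<bar>)"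
    proof (intro integral_le abs_integrable_onD(2)[OF hi])
      fix r assume "r \<in> {0..2 * T}"
      then have "\<bar>x m r\<bar> * \<bar>l - m\<bar> \<le> X * \<bar>l - m\<bar>"
        using bound(1)[OF lm(2)] by (intro mult_right_mono) auto
      then show "\<bar>(m - l) * x m r\<bar> \<le> X * \<bar>l - m\<bar>"
        by (simp add: abs_mult mult.commute abs_minus_commute)
    qed auto
    also have "\<dots> = 2 * T * X * \<bar>l - m\<bar>" using T_pos by simp
    finally have H: "integral {0..2 * T} (\<lambda>t. \<bar>(m - l) * x m t\<bar>) \<le> 2 * T * X * \<bar>l - m\<bar>" .
    have "\<bar>x l t - x m t\<bar> \<le> (A + 1) * (2 * T * X * \<bar>l - m\<bar> * (2 * T)) * exp ((A + 1) * (2 * T))"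
      "\<bar>x' l t - x' m t\<bar> \<le> 2 * T * X * \<bar>l - m\<bar> + A * ((A + 1) * (2 * T * X * \<bar>l - m\<bar> * (2 * T))) * exp ((A + 1) * (2 * T))"
      using hill_on_bound[OF z coefficient_integrable hi A[OF lm(1)] H t] by (auto simp: init)
    then show "\<bar>x l t - x m t\<bar> \<le> L1 * \<bar>l - m\<bar>" "\<bar>x' l t - x' m t\<bar> \<le> L2 * \<bar>l - m\<bar>"
      by (simp_all only: L1_def L2_def) (simp_all only: algebra_simps)
  qed
  show "\<exists>L\<ge>0. \<forall>l\<in>{-B..B}. \<forall>m\<in>{-B..B}. \<forall>t\<in>{0..2 * T}.
            \<bar>x l t - x m t\<bar> \<le> L * \<bar>l - m\<bar> \<and> \<bar>x' l t - x' m t\<bar> \<le> L * \<bar>l - m\<bar>"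
  proof (intro exI[of _ "max L1 L2"] conjI ballI)
    fix l m t assume lmt: "l \<in> {-B..B}" "m \<in> {-B..B}" "t \<in> {0..2 * T}"
    have "L1 * \<bar>l - m\<bar> \<le> max L1 L2 * \<bar>l - m\<bar>" "L2 * \<bar>l - m\<bar> \<le> max L1 L2 * \<bar>l - m\<bar>"
      by (auto intro: mult_right_mono)
    then show "\<bar>x l t - x m t\<bar> \<le> max L1 L2 * \<bar>l - m\<bar>" "\<bar>x' l t - x' m t\<bar> \<le> max L1 L2 * \<bar>l - m\<bar>"
      using lip[OF lmt] by linarith+
  qed (use L0 in auto)
qed

section \<open>Monodromy matrix and positive supersolutions\<close>

context hill_fundamental
begin

lemma wronskian:
  assumes t: "t \<in> {0..2 * T}"
  shows "u l t * v' l t - u' l t * v l t = 1"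
proof -
  have "((\<lambda>r. 0 * v l r - 0 * u l r) has_integral
     (u' l t * v l t - u l t * v' l t) - (u' l 0 * v l 0 - u l 0 * v' l 0)) {0..t}"
    using t by (intro hill_lagrange_identity[OF hill_on_subset[OF u] hill_on_subset[OF v]]
        coefficient_integrable) auto
  then have "((\<lambda>r. 0) has_integral (u' l t * v l t - u l t * v' l t) - (u' l 0 * v l 0 - u l 0 * v' l 0)) {0..t}"
    by simp
  then show ?thesis using has_integral_unique[OF has_integral_0] by (fastforce simp: init)
qed

lemma hill_on_comb: "homogeneous l (\<lambda>t. c * u l t + e * v l t) (\<lambda>t. c * u' l t + e * v' l t)"
  using hill_on_lincomb[OF u[of l] v[of l], of c e] by simp

lemma representation:
  assumes x: "hill_on (\<lambda>t. a t + l) (\<lambda>_. 0) 0 q x x'" and q: "q \<le> 2 * T" and t: "t \<in> {0..q}"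
  shows "x t = x 0 * u l t + x' 0 * v l t" "x' t = x 0 * u' l t + x' 0 * v' l t"
proof -
  let ?z = "\<lambda>t. 1 * x t + (-1) * (x 0 * u l t + x' 0 * v l t)"
  let ?z' = "\<lambda>t. 1 * x' t + (-1) * (x 0 * u' l t + x' 0 * v' l t)"
  have "hill_on (\<lambda>t. a t + l) (\<lambda>_. 0) 0 q (\<lambda>t. x 0 * u l t + x' 0 * v l t) (\<lambda>t. x 0 * u' l t + x' 0 * v' l t)"
    by (rule hill_on_subset[OF hill_on_comb]) (use q in auto)
  from hill_on_lincomb[OF x this, of 1 "-1"]
  have z: "hill_on (\<lambda>t. a t + l) (\<lambda>_. 0) 0 q ?z ?z'" by simp
  from hill_on_bound[OF z coefficient_integrable _ order_refl _ t, of 0] q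
  have "\<bar>?z t\<bar> \<le> 0" "\<bar>?z' t\<bar> \<le> 0" by (simp_all add: init)
  then show "x t = x 0 * u l t + x' 0 * v l t" "x' t = x 0 * u' l t + x' 0 * v' l t" by simp_all
qed

lemma translate:
  assumes x: "homogeneous l x x'" and t: "t \<in> {0..T}"
  shows "x (t + T) = x T * u l t + x' T * v l t" "x' (t + T) = x T * u' l t + x' T * v' l t"
proof -
  have "hill_on (\<lambda>t. a (t + T) + l) (\<lambda>_. 0) 0 T (\<lambda>t. x (t + T)) (\<lambda>t. x' (t + T))"
    using hill_on_shift[OF hill_on_subset[OF x, of T "2 * T"], of T] T_pos by simp
  \<comment> \<open>At \<open>t = 0\<close> the coefficient may differ from its translate, which the
    exceptional set \<open>{0}\<close> absorbs.\<close>
  then have "hill_on (\<lambda>t. a t + l) (\<lambda>_. 0) 0 T (\<lambda>t. x (t + T)) (\<lambda>t. x' (t + T))"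
    by (rule hill_on_spike[where N="{0}"]) (auto simp: a_periodic)
  from representation[OF this _ t] T_pos
  show "x (t + T) = x T * u l t + x' T * v l t" "x' (t + T) = x T * u' l t + x' T * v' l t" by auto
qed

text \<open>The solution that vanishes at \<open>s\<close> with slope 1. Its coefficients come from
  inverting the fundamental matrix at \<open>s\<close>, whose determinant is the Wronskian
  1.\<close>

definition y :: "real \<Rightarrow> real \<Rightarrow> real \<Rightarrow> real" where
  "y l s t = - v l s * u l t + u l s * v l t"

definition y' :: "real \<Rightarrow> real \<Rightarrow> real \<Rightarrow> real" where
  "y' l s t = - v l s * u' l t + u l s * v' l t"

lemma hill_on_y: "homogeneous l (y l s) (y' l s)"
  unfolding y_def y'_def by (rule hill_on_comb)

lemma y_init:
  assumes "s \<in> {0..2 * T}"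
  shows "y l s s = 0" "y' l s s = 1"
  using wronskian[OF assms, of l] by (auto simp: y_def y'_def algebra_simps)

lemma comb_double_zero:
  assumes "t \<in> {0..2 * T}" "c * u l t + e * v l t = 0" "c * u' l t + e * v' l t = 0"
  shows "c = 0" "e = 0"
proof -
  have "c * (u l t * v' l t - u' l t * v l t) = 0" "e * (u l t * v' l t - u' l t * v l t) = 0"
    using assms(2,3) by algebra+
  then show "c = 0" "e = 0" by (simp_all add: wronskian[OF assms(1)])
qed

lemma y_no_double_zero:
  assumes "s \<in> {0..2 * T}" "t \<in> {0..2 * T}" "y l s t = 0"
  shows "y' l s t \<noteq> 0"
proof
  assume "y' l s t = 0"
  then have "- v l s = 0" "u l s = 0"
    using comb_double_zero[OF assms(2), of "- v l s" l "u l s"] assms(3) by (auto simp: y_def y'_def)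
  then show False using wronskian[OF assms(1), of l] by simp
qed

text \<open>The slope 1 makes \<open>y l s\<close> positive just after \<open>s\<close>. If it
  returned to zero at \<open>z\<close>, then \<open>- y l s\<close> would vanish at both ends of
  \<open>[s, z]\<close> and the maximum principle would make it nonnegative in between.\<close>

lemma y_pos_of_supersolution:
  assumes X: "hill_on (\<lambda>t. a t + l) k 0 (2 * T) X X'" "\<And>t. t \<in> {0..2 * T} \<Longrightarrow> k t \<le> 0"
    "\<And>t. t \<in> {0..2 * T} \<Longrightarrow> X t > 0"
    and st: "0 \<le> s" "s < t" "t \<le> 2 * T"
  shows "y l s t > 0"
proof (rule ccontr)
  assume neg: "\<not> 0 < y l s t"
  have "(y l s has_real_derivative 1) (at s within {0..2 * T})"
    using hill_on_deriv[OF hill_on_y, of s l s] y_init(2)[of s l] st by simp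
  from has_real_derivative_pos_inc_right[OF this] obtain d where d: "d > 0"
    "\<And>h. h > 0 \<Longrightarrow> s + h \<in> {0..2 * T} \<Longrightarrow> h < d \<Longrightarrow> y l s s < y l s (s + h)" by auto
  define r where "r = s + min d (t - s) / 2"
  have r: "s < r" "r < t" "r - s < d" unfolding r_def using st d by (auto simp: min_def field_simps)
  have "y l s r > 0" using d(2)[of "r - s"] st r y_init[of s l] by auto
  have "continuous_on {r..t} (y l s)"
    using r st by (intro continuous_on_subset[OF hill_on_continuous[OF hill_on_y]]) auto
  then obtain z where z: "r \<le> z" "z \<le> t" "y l s z = 0"
    using IVT2'[of "y l s" t 0 r] \<open>y l s r > 0\<close> neg r by auto
  have m: "hill_on (\<lambda>t. a t + l) (\<lambda>_. 0) s z (\<lambda>t. - y l s t) (\<lambda>t. - y' l s t)"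
    by (rule hill_on_subset[of _ _ 0 "2 * T"])
      (use hill_on_lincomb[OF hill_on_y[of l s] hill_on_y[of l s], of "-1" 0] z st r in auto)
  have "- y l s r \<ge> 0"
    by (rule hill_max_principle[OF hill_on_subset[OF X(1)] X(2) X(3) m _ _ _ coefficient_integrable])
      (use z st r y_init(1)[of s l] in auto)
  then show False using \<open>y l s r > 0\<close> by simp
qed

text \<open>A trace of at most \<open>-2\<close> yields a real multiplier \<open>r < 0\<close> and a
  solution with \<open>x (t + T) = r * x t\<close>. It changes sign, so it vanishes at some
  \<open>z\<close> and at \<open>z + T\<close>; the maximum principle for \<open>x\<close> and
  \<open>- x\<close> annihilates it in between, and the multiplier everywhere else.\<close>

lemma trace_gt_of_supersolution:
  assumes X: "hill_on (\<lambda>t. a t + l) k 0 (2 * T) X X'" "\<And>t. t \<in> {0..2 * T} \<Longrightarrow> k t \<le> 0"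
    "\<And>t. t \<in> {0..2 * T} \<Longrightarrow> X t > 0"
  shows "u l T + v' l T > -2"
proof (rule ccontr)
  define tr where "tr = u l T + v' l T"
  assume "\<not> u l T + v' l T > -2"
  then have tr: "tr \<le> -2" by (simp add: tr_def)
  \<comment> \<open>The smaller root of \<open>r\<^sup>2 - tr * r + 1\<close>, the characteristic
    polynomial of a matrix with determinant 1; \<open>tr \<le> - 2\<close> makes it real and
    negative.\<close>
  define r where "r = (tr - sqrt (tr\<^sup>2 - 4)) / 2"
  have "tr\<^sup>2 \<ge> 4" using tr power_mono[of 2 "- tr" 2] by simp
  then have "(sqrt (tr\<^sup>2 - 4))\<^sup>2 = tr\<^sup>2 - 4" by simp
  then have rr: "r * r - tr * r + 1 = 0" unfolding r_def by (simp add: field_simps power2_eq_square)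
  have "sqrt (tr\<^sup>2 - 4) \<ge> 0" using \<open>tr\<^sup>2 \<ge> 4\<close> by simp
  then have "tr - sqrt (tr\<^sup>2 - 4) < 0" using tr by linarith
  then have "r < 0" by (simp add: r_def)
  have "u l T * v' l T - u' l T * v l T = 1" using wronskian[of T l] T_pos by simp
  then have "(u l T - r) * (v' l T - r) - v l T * u' l T = 0"
    using rr unfolding tr_def by (simp add: algebra_simps)
  then obtain c e where ce: "(c, e) \<noteq> (0, 0)" "(u l T - r) * c + v l T * e = 0" "u' l T * c + (v' l T - r) * e = 0"
    by (rule singular_matrix2_kernel)
  define x where "x = (\<lambda>t. c * u l t + e * v l t)"
  define x' where "x' = (\<lambda>t. c * u' l t + e * v' l t)"
  have x: "homogeneous l x x'" unfolding x_def x'_def by (rule hill_on_comb)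
  have "x T = r * c" "x' T = r * e" using ce by (auto simp: x_def x'_def algebra_simps)
  then have fl: "x (t + T) = r * x t" if "t \<in> {0..T}" for t
    using translate(1)[OF x that] by (simp add: x_def algebra_simps)
  have "x T = r * x 0" using fl[of 0] T_pos by simp
  have "\<exists>z. 0 \<le> z \<and> z \<le> T \<and> x z = 0"
  proof -
    have cx: "continuous_on {0..T} x" using hill_on_continuous[OF x] T_pos by (auto intro: continuous_on_subset)
    show ?thesis
    proof (cases "x 0 \<ge> 0")
      case True
      then have "x T \<le> 0" using \<open>x T = r * x 0\<close> \<open>r < 0\<close> by (simp add: mult_nonpos_nonneg)
      then show ?thesis using IVT2'[of x T 0 0] cx True T_pos by auto
    next
      case False
      then have "x T \<ge> 0" using \<open>x T = r * x 0\<close> \<open>r < 0\<close> by (simp add: mult_nonpos_nonpos)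
      then show ?thesis using IVT'[of x 0 0 T] cx False T_pos by auto
    qed
  qed
  then obtain z where z: "0 \<le> z" "z \<le> T" "x z = 0" by blast
  then have "x (z + T) = 0" using fl by simp
  have zero: "x t = 0" if t: "t \<in> {z..z + T}" for t
  proof -
    have pos: "e' * x t \<ge> 0" if "e' = 1 \<or> e' = -1" for e' :: real
    proof -
      have "homogeneous l (\<lambda>t. e' * x t) (\<lambda>t. e' * x' t)"
        using hill_on_lincomb[OF x x, of e' 0] by simp
      then have m: "hill_on (\<lambda>t. a t + l) (\<lambda>_. 0) z (z + T) (\<lambda>t. e' * x t) (\<lambda>t. e' * x' t)"
        by (rule hill_on_subset) (use z in auto)
      show ?thesis
        by (rule hill_max_principle[OF hill_on_subset[OF X(1)] X(2) X(3) m _ _ _ coefficient_integrable t])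
          (use z \<open>x (z + T) = 0\<close> in auto)
    qed
    show ?thesis using pos[of 1] pos[of "-1"] by simp
  qed
  have zero': "x t = 0" if "t \<in> {0..T}" for t
  proof (cases "t \<ge> z")
    case True
    then show ?thesis using zero[of t] z that by auto
  next
    case False
    then have "x (t + T) = 0" using zero[of "t + T"] z that by auto
    then show ?thesis using fl[OF that] \<open>r < 0\<close> by simp
  qed
  have "c = 0" using zero'[of 0] T_pos by (simp add: x_def init)
  moreover have "v l T > 0" using y_pos_of_supersolution[OF X, of 0 T] T_pos by (simp add: y_def init)
  then have "e = 0" using zero'[of T] \<open>c = 0\<close> T_pos by (simp add: x_def)
  ultimately show False using ce by simp
qed

end

text \<open>For \<open>S t = \<integral>\<^sub>0\<^sup>t a\<close> the function \<open>X = exp (- \<integral> S)\<close> satisfies \<open>X'' + a X = S\<^sup>2 X\<close>.\<close>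

lemma (in periodic_hill) ex_positive_supersolution:
  obtains l k X X' where "l < 0" "hill_on (\<lambda>t. a t + l) k 0 (2 * T) X X'"
    "\<And>t. t \<in> {0..2 * T} \<Longrightarrow> k t \<le> 0" "\<And>t. t \<in> {0..2 * T} \<Longrightarrow> X t > 0"
proof -
  define S where "S t = integral {0..t} a" for t
  define A where "A = integral {0..2 * T} (\<lambda>r. \<bar>a r\<bar>)"
  define X where "X t = exp (- integral {0..t} S)" for t
  \<comment> \<open>\<open>S\<^sup>2 \<le> A\<^sup>2\<close> makes
    \<open>k = (S\<^sup>2 + l) * X\<close> nonpositive; the additional \<open>-1\<close> keeps
    \<open>l\<close> negative even if \<open>A = 0\<close>.\<close>
  define l where "l = - A\<^sup>2 - 1"
  have ai: "a integrable_on {p..q}" if "0 \<le> p" "q \<le> 2 * T" for p q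
    using abs_integrable_onD(1)[OF a_integrable that] .
  have Sc: "continuous_on {0..2 * T} S"
    unfolding S_def by (intro indefinite_integral_continuous_1 ai) auto
  have SA: "\<bar>S t\<bar> \<le> A" if "t \<in> {0..2 * T}" for t
  proof -
    have "norm (S t) \<le> integral {0..t} (\<lambda>r. \<bar>a r\<bar>)"
      unfolding S_def using that abs_integrable_onD[OF a_integrable, of 0 t]
      by (intro integral_norm_bound_integral) auto
    also have "\<dots> \<le> A" unfolding A_def using that by (intro integral_abs_subinterval_le a_integrable) auto
    finally show ?thesis by simp
  qed
  have SH: "(a has_integral (S t - S s)) {s..t}" if st: "0 \<le> s" "s \<le> t" "t \<le> 2 * T" for s t
  proof -
    have "integral {0..s} a + integral {s..t} a = integral {0..t} a"
      using st by (intro hk_combine ai) auto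
    then have "integral {s..t} a = S t - S s" by (simp add: S_def)
    then show ?thesis using integrable_integral[OF ai[of s t]] st by simp
  qed
  have Xd: "(X has_real_derivative (- S t * X t)) (at t within {0..2 * T})" if "t \<in> {0..2 * T}" for t
    unfolding X_def using that
    by (auto intro!: derivative_eq_intros integral_has_real_derivative Sc)
  have Xc: "continuous_on {0..2 * T} X" by (rule DERIV_continuous_on[OF Xd])
  have "hill_on (\<lambda>t. a t + l) (\<lambda>t. ((S t)\<^sup>2 + l) * X t) 0 (2 * T) X (\<lambda>t. - S t * X t)"
    unfolding hill_on_def
  proof (intro conjI ballI allI impI Xd)
    fix s t assume st: "0 \<le> s" "s \<le> t" "t \<le> 2 * T"
    have Xd': "(X has_real_derivative (- S r * X r)) (at r within {s..t})" if "r \<in> {s..t}" for r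
      using DERIV_subset[OF Xd[of r], of "{s..t}"] st that by simp
    have "((\<lambda>r. a r * X r + S r * (- S r * X r)) has_integral S t * X t - S s * X s) {s..t}"
      by (rule has_integral_by_parts[OF st(2) abs_integrable_subinterval[OF a_integrable] SH Xd'])
        (use st in \<open>auto intro!: continuous_intros continuous_on_subset[OF Sc] continuous_on_subset[OF Xc]\<close>)
    from has_integral_neg[OF this]
    show "((\<lambda>r. ((S r)\<^sup>2 + l) * X r - (a r + l) * X r) has_integral - S t * X t - - S s * X s) {s..t}"
      by (simp add: algebra_simps power2_eq_square)
  qed auto
  moreover have "((S t)\<^sup>2 + l) * X t \<le> 0" if "t \<in> {0..2 * T}" for t
  proof -
    have "(S t)\<^sup>2 \<le> A\<^sup>2" using SA[OF that] by (simp add: abs_le_square_iff[symmetric])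
    then show ?thesis by (intro mult_nonpos_nonneg) (auto simp: l_def X_def)
  qed
  moreover have "l < 0" unfolding l_def using zero_le_power2[of A] by linarith
  moreover have "X t > 0" for t by (simp add: X_def)
  ultimately show thesis using that by blast
qed


section \<open>Zeros at distance \<open>T\<close> and the trace\<close>

context hill_fundamental
begin

text \<open>The translate of \<open>y l s\<close> by \<open>T\<close> and \<open>r * y l s\<close>,
  with \<open>r\<close> the slope at \<open>s + T\<close>, have the same value and slope at
  \<open>s\<close>, so they coincide. Thus \<open>r < 0\<close> is a multiplier, and determinant 1
  gives the trace \<open>r + 1 / r \<le> - 2\<close>.\<close>

lemma trace_le_of_conjugate:
  assumes s: "s \<in> {0..T}" and conj: "y l s (s + T) = 0" and neg: "y' l s (s + T) < 0"
  shows "u l T + v' l T \<le> -2"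
proof -
  define r where "r = y' l s (s + T)"
  have "r < 0" using neg by (simp add: r_def)
  define c1 where "c1 = y l s T - r * (- v l s)"
  define c2 where "c2 = y' l s T - r * u l s"
  have "y l s (t + T) - r * y l s t = c1 * u l t + c2 * v l t"
     "y' l s (t + T) - r * y' l s t = c1 * u' l t + c2 * v' l t"
    if "t \<in> {0..T}" for t
    using translate[OF hill_on_y that, of l s]
    by (auto simp: c1_def c2_def y_def[of l s t] y'_def[of l s t] algebra_simps)
  from this[OF s] have "c1 * u l s + c2 * v l s = 0" "c1 * u' l s + c2 * v' l s = 0"
    using s T_pos by (simp_all add: y_init conj r_def)
  moreover have "s \<in> {0..2 * T}" using s T_pos by auto
  ultimately have "c1 = 0 \<and> c2 = 0" using comb_double_zero by blast
  then have "y l s T = r * (- v l s)" "y' l s T = r * u l s" unfolding c1_def c2_def by linarith+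
  then have e: "u l T * (- v l s) + v l T * u l s = r * (- v l s)" "u' l T * (- v l s) + v' l T * u l s = r * u l s"
    by (simp_all add: y_def y'_def mult.commute)
  have "(- v l s, u l s) \<noteq> (0, 0)" using wronskian[of s l] s T_pos by auto
  from matrix2_eigenvalue_char_poly[OF e this]
  have "r * r - (u l T + v' l T) * r + (u l T * v' l T - u' l T * v l T) = 0" by (simp add: algebra_simps)
  then have "(u l T + v' l T) * r = r * r + 1" using wronskian[of T l] T_pos by simp
  moreover have "r * r + 1 \<ge> - 2 * r" using zero_le_power2[of "r + 1"] by (simp add: power2_eq_square algebra_simps)
  ultimately have "(u l T + v' l T) * r \<ge> (- 2) * r" by simp
  then show ?thesis using \<open>r < 0\<close> by (simp only: mult_le_cancel_right)
qed

lemma parameter_bounds_uv: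
  assumes "B \<ge> 0"
  obtains X L where "X \<ge> 0" "L \<ge> 0"
    "\<And>l s t. l \<in> {-B..B} \<Longrightarrow> s \<in> {0..2 * T} \<Longrightarrow> t \<in> {0..2 * T} \<Longrightarrow> \<bar>y l s t\<bar> \<le> X"
    "\<And>l m s t. l \<in> {-B..B} \<Longrightarrow> m \<in> {-B..B} \<Longrightarrow> s \<in> {0..2 * T} \<Longrightarrow> t \<in> {0..2 * T} \<Longrightarrow>
        \<bar>y l s t - y m s t\<bar> \<le> L * \<bar>l - m\<bar>"
    "\<And>l m. l \<in> {-B..B} \<Longrightarrow> m \<in> {-B..B} \<Longrightarrow>
        \<bar>(u l T + v' l T) - (u m T + v' m T)\<bar> \<le> L * \<bar>l - m\<bar>"
proof -
  from parameter_bounds(1)[OF u init(1,2) assms] obtain X1 where X1: "X1 \<ge> 0"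
    and Xu: "\<And>l t. l \<in> {-B..B} \<Longrightarrow> t \<in> {0..2 * T} \<Longrightarrow> \<bar>u l t\<bar> \<le> X1"
    by blast
  from parameter_bounds(1)[OF v init(3,4) assms] obtain X2 where X2: "X2 \<ge> 0"
    and Xv: "\<And>l t. l \<in> {-B..B} \<Longrightarrow> t \<in> {0..2 * T} \<Longrightarrow> \<bar>v l t\<bar> \<le> X2"
    by blast
  from parameter_bounds(2)[OF u init(1,2) assms] obtain L1 where L1: "L1 \<ge> 0"
    and Lu: "\<And>l m t. l \<in> {-B..B} \<Longrightarrow> m \<in> {-B..B} \<Longrightarrow> t \<in> {0..2 * T} \<Longrightarrow> \<bar>u l t - u m t\<bar> \<le> L1 * \<bar>l - m\<bar>"
    by blast
  from parameter_bounds(2)[OF v init(3,4) assms] obtain L2 where L2: "L2 \<ge> 0"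
    and Lv: "\<And>l m t. l \<in> {-B..B} \<Longrightarrow> m \<in> {-B..B} \<Longrightarrow> t \<in> {0..2 * T} \<Longrightarrow>
        \<bar>v l t - v m t\<bar> \<le> L2 * \<bar>l - m\<bar> \<and> \<bar>v' l t - v' m t\<bar> \<le> L2 * \<bar>l - m\<bar>"
    by blast
  note X = X1 X2 L1 L2
  have prod: "\<bar>v l s * u l t - v m s * u m t\<bar> \<le> (X2 * L1 + X1 * L2) * \<bar>l - m\<bar>"
    if "l \<in> {-B..B}" "m \<in> {-B..B}" "s \<in> {0..2 * T}" "t \<in> {0..2 * T}" for l m s t
  proof -
    have "v l s * u l t - v m s * u m t = v l s * (u l t - u m t) + u m t * (v l s - v m s)"
      by (simp add: algebra_simps)
    also have "\<bar>\<dots>\<bar> \<le> \<bar>v l s\<bar> * \<bar>u l t - u m t\<bar> + \<bar>u m t\<bar> * \<bar>v l s - v m s\<bar>"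
      by (metis abs_mult abs_triangle_ineq)
    also have "\<dots> \<le> X2 * (L1 * \<bar>l - m\<bar>) + X1 * (L2 * \<bar>l - m\<bar>)"
      using that X by (intro add_mono mult_mono Xv Lu Xu Lv[THEN conjunct1]) auto
    finally show ?thesis by (simp add: algebra_simps)
  qed
  let ?L = "max (2 * (X2 * L1 + X1 * L2)) (L1 + L2)"
  show thesis
  proof (rule that[of "2 * (X2 * X1)" "?L"])
    fix l s t assume "l \<in> {-B..B}" "s \<in> {0..2 * T}" "t \<in> {0..2 * T}"
    then have "\<bar>v l s\<bar> * \<bar>u l t\<bar> \<le> X2 * X1" "\<bar>v l t\<bar> * \<bar>u l s\<bar> \<le> X2 * X1"
      using X Xu Xv by (auto intro!: mult_mono)
    then show "\<bar>y l s t\<bar> \<le> 2 * (X2 * X1)"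
      unfolding y_def abs_mult[symmetric] by (simp add: mult.commute)
  next
    fix l m s t assume lm: "l \<in> {-B..B}" "m \<in> {-B..B}" "s \<in> {0..2 * T}" "t \<in> {0..2 * T}"
    have "\<bar>y l s t - y m s t\<bar> \<le> 2 * (X2 * L1 + X1 * L2) * \<bar>l - m\<bar>"
    proof -
      have "2 * (X2 * L1 + X1 * L2) * \<bar>l - m\<bar> = (X2 * L1 + X1 * L2) * \<bar>l - m\<bar> + (X2 * L1 + X1 * L2) * \<bar>l - m\<bar>"
        by simp
      moreover have "y l s t - y m s t = (v l t * u l s - v m t * u m s) - (v l s * u l t - v m s * u m t)"
        by (simp add: y_def)
      ultimately show ?thesis using prod[OF lm] prod[OF lm(1,2) lm(4) lm(3)] by linarith
    qed
    also have "\<dots> \<le> ?L * \<bar>l - m\<bar>" by (intro mult_right_mono) auto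
    finally show "\<bar>y l s t - y m s t\<bar> \<le> ?L * \<bar>l - m\<bar>" .
  next
    fix l m assume lm: "l \<in> {-B..B}" "m \<in> {-B..B}"
    have "\<bar>(u l T + v' l T) - (u m T + v' m T)\<bar> \<le> (L1 + L2) * \<bar>l - m\<bar>"
      using Lu[OF lm, of T] Lv[OF lm, of T] T_pos unfolding distrib_right by auto
    also have "\<dots> \<le> ?L * \<bar>l - m\<bar>" by (intro mult_right_mono) auto
    finally show "\<bar>(u l T + v' l T) - (u m T + v' m T)\<bar> \<le> ?L * \<bar>l - m\<bar>" .
  qed (use X in auto)
qed

text \<open>All the solutions vanish at \<open>s\<close>, so that a minimum over the whole arc would
  always be nonpositive; an initial piece common to all parameters has to be cut off. On it
  \<open>y' \<ge> 1 / 2\<close>, because the change of \<open>y'\<close> is bounded by the integral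
  of \<open>X * (|a| + B)\<close>, which is small independently of \<open>l\<close>.\<close>

lemma y_pos_near_init:
  assumes "B \<ge> 0" "s \<in> {0..T}"
  obtains \<epsilon> where "0 < \<epsilon>" "\<epsilon> < T" "\<And>l t. l \<in> {-B..B} \<Longrightarrow> s < t \<Longrightarrow> t \<le> s + \<epsilon> \<Longrightarrow> y l s t > 0"
proof -
  obtain X L where X: "X \<ge> 0" 
    "\<And>l s t. l \<in> {-B..B} \<Longrightarrow> s \<in> {0..2 * T} \<Longrightarrow> t \<in> {0..2 * T} \<Longrightarrow> \<bar>y l s t\<bar> \<le> X"
    by (rule parameter_bounds_uv[OF assms(1)]) blast
  define F where "F t = X * (integral {s..t} (\<lambda>r. \<bar>a r\<bar>) + B * (t - s))" for t
  have ai: "(\<lambda>r. \<bar>a r\<bar>) integrable_on {s..2 * T}"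
    using abs_integrable_onD(2)[OF a_integrable] assms by auto
  have "continuous_on {s..2 * T} F"
    unfolding F_def by (intro continuous_intros indefinite_integral_continuous_1 ai)
  moreover have "F s = 0" by (simp add: F_def)
  moreover have "s \<in> {s..2 * T}" using assms T_pos by auto
  ultimately have "\<exists>d>0. \<forall>t\<in>{s..2 * T}. dist t s < d \<longrightarrow> dist (F t) 0 < 1 / 2"
    unfolding continuous_on_iff using half_gt_zero[OF zero_less_one] by metis
  then obtain d where d: "d > 0" "\<And>t. t \<in> {s..2 * T} \<Longrightarrow> dist t s < d \<Longrightarrow> dist (F t) 0 < 1 / 2"
    by blast
  define \<epsilon> where "\<epsilon> = min (d / 2) (T / 2)"
  have e: "0 < \<epsilon>" "\<epsilon> < T" "\<epsilon> < d" using d T_pos by (auto simp: \<epsilon>_def min_def)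
  have y'_ge: "y' l s t \<ge> 1 / 2" if l: "l \<in> {-B..B}" and t: "s \<le> t" "t \<le> s + \<epsilon>" for l t
  proof -
    have t2: "t \<in> {s..2 * T}" "t \<le> 2 * T" using t assms e by auto
    have i: "((\<lambda>r. 0 - (a r + l) * y l s r) has_integral (y' l s t - y' l s s)) {s..t}"
      using assms t t2 by (intro hill_on_integral[OF hill_on_y]) auto
    have ai': "(\<lambda>r. \<bar>a r\<bar>) integrable_on {s..t}"
      using integrable_on_subinterval[OF ai, of s t] t2 by auto
    have "norm (y' l s t - y' l s s) \<le> integral {s..t} (\<lambda>r. X * (\<bar>a r\<bar> + B))"
      unfolding integral_unique[OF i, symmetric]
    proof (rule integral_norm_bound_integral[OF has_integral_integrable[OF i]])
      show "(\<lambda>r. X * (\<bar>a r\<bar> + B)) integrable_on {s..t}"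
        using ai' by (intro integrable_on_mult_right integrable_add) auto
      fix r assume "r \<in> {s..t}"
      then have "\<bar>y l s r\<bar> \<le> X" using X(2)[OF l, of s r] assms t2 T_pos by auto
      moreover have "\<bar>a r + l\<bar> \<le> \<bar>a r\<bar> + B" using l by auto
      ultimately have "\<bar>y l s r\<bar> * \<bar>a r + l\<bar> \<le> X * (\<bar>a r\<bar> + B)" using X(1) by (intro mult_mono) auto
      then show "norm (0 - (a r + l) * y l s r) \<le> X * (\<bar>a r\<bar> + B)" by (simp add: abs_mult mult.commute)
    qed
    also have "\<dots> = F t"
    proof -
      have "integral {s..t} (\<lambda>r. \<bar>a r\<bar> + B) = integral {s..t} (\<lambda>r. \<bar>a r\<bar>) + integral {s..t} (\<lambda>r. B)"
        by (rule hk_add[OF ai' integrable_const_ivl])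
      then show ?thesis using t by (simp add: F_def mult.commute)
    qed
    also have "F t < 1 / 2" using d(2)[OF t2(1)] t e by (auto simp: dist_real_def)
    finally have "\<bar>y' l s t - 1\<bar> < 1 / 2" using y_init(2)[of s l] assms by simp
    then show ?thesis by linarith
  qed
  show thesis
  proof (rule that[OF e(1,2)])
    fix l t assume l: "l \<in> {-B..B}" and t: "s < t" "t \<le> s + \<epsilon>"
    have sub: "{s..s + \<epsilon>} \<subseteq> {0..2 * T}" using assms e by auto
    have D: "((\<lambda>r. r / 2) has_real_derivative 1 / 2) (at r within {s..s + \<epsilon>})" for r
      by (auto intro!: derivative_eq_intros)
    have "t / 2 - s / 2 \<le> y l s t - y l s s"
      by (rule increment_le_of_deriv_le[OF D DERIV_subset[OF hill_on_deriv[OF hill_on_y] sub]])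
        (use t l sub y'_ge in auto)
    then show "y l s t > 0" using t y_init(1)[of s l] assms by auto
  qed
qed

text \<open>The minimum \<open>\<mu> m\<close> of \<open>y m s\<close> over
  \<open>[s + \<epsilon>, s + T]\<close> is Lipschitz in \<open>m\<close>, positive at
  \<open>l\<close> and nonpositive at \<open>0\<close>. Where it vanishes, the minimizer can only be
  \<open>s + T\<close>; the solution arrives there from above, with nonzero slope.\<close>

lemma ex_nonneg_conjugate:
  assumes s: "s \<in> {0..T}" and t1: "s < t1" "t1 < s + T" "y 0 s t1 \<le> 0"
    and l: "l < 0" and pos: "\<And>t. s < t \<Longrightarrow> t \<le> s + T \<Longrightarrow> y l s t > 0"
  shows "\<exists>m. l < m \<and> m < 0 \<and> y m s (s + T) = 0 \<and> y' m s (s + T) < 0"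
proof -
  have "- l \<ge> 0" using l by simp
  obtain \<epsilon> where e: "0 < \<epsilon>" "\<epsilon> < T" "\<And>m t. m \<in> {l..-l} \<Longrightarrow> s < t \<Longrightarrow> t \<le> s + \<epsilon> \<Longrightarrow> y m s t > 0"
    using y_pos_near_init[OF \<open>- l \<ge> 0\<close> s] by auto
  obtain X L where L: "L \<ge> 0" 
    "\<And>l' m s t. l' \<in> {l..-l} \<Longrightarrow> m \<in> {l..-l} \<Longrightarrow> s \<in> {0..2 * T} \<Longrightarrow> t \<in> {0..2 * T} \<Longrightarrow>
        \<bar>y l' s t - y m s t\<bar> \<le> L * \<bar>l' - m\<bar>"
    by (rule parameter_bounds_uv[OF \<open>- l \<ge> 0\<close>, unfolded minus_minus]) blast
  define J where "J = {s + \<epsilon>..s + T}"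
  have J: "J \<subseteq> {0..2 * T}" "J \<noteq> {}" "compact J" using s e by (auto simp: J_def)
  have s2: "s \<in> {0..2 * T}" using s T_pos by auto
  define \<mu> where "\<mu> m = (INF t\<in>J. y m s t)" for m
  have "\<exists>t\<in>J. \<forall>r\<in>J. y m s t \<le> y m s r" for m
    using J by (intro continuous_attains_inf continuous_on_subset[OF hill_on_continuous[OF hill_on_y]]) auto
  then have att: "\<exists>t\<in>J. \<mu> m = y m s t \<and> (\<forall>r\<in>J. y m s t \<le> y m s r)" for m
    unfolding \<mu>_def by (metis cINF_greatest cINF_lower J(2) antisym bdd_belowI2)
  have lip: "\<mu> l1 - \<mu> l2 \<le> L * \<bar>l1 - l2\<bar>" if "l1 \<in> {l..-l}" "l2 \<in> {l..-l}" for l1 l2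
  proof -
    obtain t where t: "t \<in> J" "\<mu> l2 = y l2 s t" using att by blast
    then have "\<mu> l1 \<le> y l1 s t" using att by metis
    then show ?thesis using L(2)[OF that s2, of t] t J by auto
  qed
  have cont: "continuous_on {l..0} \<mu>"
  proof (rule lipschitz_on_continuous_on)
    show "L-lipschitz_on {l..0} \<mu>"
    proof (rule lipschitz_onI)
      fix l1 l2 assume "l1 \<in> {l..0}" "l2 \<in> {l..0}"
      then show "dist (\<mu> l1) (\<mu> l2) \<le> L * dist l1 l2"
        using lip[of l1 l2] lip[of l2 l1] l by (auto simp: dist_real_def abs_minus_commute)
    qed (use L in auto)
  qed
  \<comment> \<open>A minimizer with value zero in the interior would be a double zero. The left end
    \<open>s + \<epsilon>\<close> is excluded as well, because the solution is positive
    there.\<close>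
  have interior: "\<mu> m \<noteq> 0" if m: "m \<in> {l..0}" and t: "t \<in> {s..<s + T}" "t \<in> J" "y m s t = \<mu> m" for m t
  proof
    assume "\<mu> m = 0"
    then have t0: "y m s t = 0" using t by simp
    then have "t \<noteq> s + \<epsilon>" using e(1) e(3)[of m t] m l by auto
    then have ti: "s + \<epsilon> < t" "t < s + T" using t by (auto simp: J_def)
    have "(y m s has_real_derivative y' m s t) (at t within {0..2 * T})"
      using t J by (intro hill_on_deriv[OF hill_on_y]) auto
    then have "(y m s has_real_derivative y' m s t) (at t)"
      using ti s e by (simp add: at_within_Icc_at)
    then have "y' m s t = 0"
    proof (rule DERIV_local_min[where d="min (t - (s + \<epsilon>)) (s + T - t)"])
      show "\<forall>r. \<bar>t - r\<bar> < min (t - (s + \<epsilon>)) (s + T - t) \<longrightarrow> y m s t \<le> y m s r"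
      proof (intro allI impI)
        fix r assume "\<bar>t - r\<bar> < min (t - (s + \<epsilon>)) (s + T - t)"
        then have "r \<in> J" by (auto simp: J_def)
        then show "y m s t \<le> y m s r" using att[of m] t(3) by metis
      qed
    qed (use ti in auto)
    then show False using y_no_double_zero[OF s2, of t m] t J t0 by auto
  qed
  have "\<mu> l > 0" using att[of l] pos by (smt (verit) e(1) J_def atLeastAtMost_iff)
  have "\<mu> 0 \<le> 0"
  proof -
    have "t1 \<in> J" using e(3)[of 0 t1] t1 l by (force simp: J_def)
    then show ?thesis using att[of 0] t1(3) by force
  qed
  \<comment> \<open>Otherwise \<open>t1 < s + T\<close> would be a minimizer with value zero,
    against \<open>interior\<close>. Hence the parameter found below is strictly negative.\<close>
  have "\<mu> 0 \<noteq> 0"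
  proof
    assume "\<mu> 0 = 0"
    have "t1 \<in> J" using e(3)[of 0 t1] t1 l by (force simp: J_def)
    then have "y 0 s t1 = \<mu> 0" using att[of 0] t1(3) \<open>\<mu> 0 = 0\<close> by force
    then show False using interior[of 0 t1] t1 l \<open>t1 \<in> J\<close> \<open>\<mu> 0 = 0\<close> by auto
  qed
  obtain m where m: "l \<le> m" "m \<le> 0" "\<mu> m = 0"
    using IVT2'[of \<mu> 0 0 l] \<open>\<mu> 0 \<le> 0\<close> \<open>\<mu> l > 0\<close> cont l by auto
  then have m': "l < m" "m < 0" using \<open>\<mu> 0 \<noteq> 0\<close> \<open>\<mu> l > 0\<close> by (auto simp: less_le)
  obtain t where t: "t \<in> J" "\<mu> m = y m s t" "\<forall>r\<in>J. y m s t \<le> y m s r" using att by blast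
  have "t = s + T"
  proof (rule ccontr)
    assume "t \<noteq> s + T"
    then have "t \<in> {s..<s + T}" using t(1) e by (auto simp: J_def)
    then show False using interior[of m t] t m by auto
  qed
  then have z: "y m s (s + T) = 0" "\<And>r. r \<in> J \<Longrightarrow> y m s r \<ge> 0" using t m by auto
  have "y' m s (s + T) \<le> 0"
  proof (rule ccontr)
    assume "\<not> y' m s (s + T) \<le> 0"
    then have p: "0 < y' m s (s + T)" by simp
    have sT: "s + T \<in> {0..2 * T}" using s T_pos by auto
    from has_real_derivative_pos_inc_left[OF hill_on_deriv[OF hill_on_y sT] p]
    obtain d where d: "d > 0" "\<And>h. h > 0 \<Longrightarrow> s + T - h \<in> {0..2 * T} \<Longrightarrow> h < d \<Longrightarrow> y m s (s + T - h) < y m s (s + T)"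
      by blast
    define h where "h = min (d / 2) (T - \<epsilon>)"
    have h: "h > 0" "h < d" "s + T - h \<in> J" using d(1) e by (auto simp: h_def J_def min_def)
    then show False using d(2)[of h] z J by force
  qed
  moreover have "y' m s (s + T) \<noteq> 0" using y_no_double_zero[OF s2 _ z(1)] s T_pos by auto
  ultimately show ?thesis using m' z by auto
qed

theorem y_positive_of_trace:
  assumes no: "\<And>l. l < 0 \<Longrightarrow> u l T + v' l T \<noteq> -2"
    and s: "s \<in> {0..T}" and t: "s < t" "t < s + T"
  shows "y 0 s t > 0"
proof (rule ccontr)
  assume n: "\<not> 0 < y 0 s t"
  obtain l k X X' where l: "l < 0" and X: "hill_on (\<lambda>t. a t + l) k 0 (2 * T) X X'"
    "\<And>t. t \<in> {0..2 * T} \<Longrightarrow> k t \<le> 0" "\<And>t. t \<in> {0..2 * T} \<Longrightarrow> X t > 0"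
    by (rule ex_positive_supersolution) (rule that; assumption)
  have "y l s t > 0" if "s < t" "t \<le> s + T" for t
    using y_pos_of_supersolution[OF X, of s t] that s by auto
  then obtain m where m: "l < m" "m < 0" "y m s (s + T) = 0" "y' m s (s + T) < 0"
    using ex_nonneg_conjugate[OF s t _ l] n by (metis not_less)
  have "- l \<ge> 0" using l by simp
  obtain L where L: "L \<ge> 0" 
    "\<And>l' m. l' \<in> {l..-l} \<Longrightarrow> m \<in> {l..-l} \<Longrightarrow> \<bar>(u l' T + v' l' T) - (u m T + v' m T)\<bar> \<le> L * \<bar>l' - m\<bar>"
    by (rule parameter_bounds_uv[OF \<open>- l \<ge> 0\<close>, unfolded minus_minus]) blast
  have "continuous_on {l..m} (\<lambda>l. u l T + v' l T)"
  proof (rule lipschitz_on_continuous_on)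
    show "L-lipschitz_on {l..m} (\<lambda>l. u l T + v' l T)"
      by (rule lipschitz_onI) (use L m in \<open>auto simp: dist_real_def\<close>)
  qed
  moreover have "u l T + v' l T > -2" by (rule trace_gt_of_supersolution[OF X])
  moreover have "u m T + v' m T \<le> -2" by (rule trace_le_of_conjugate[OF s m(3,4)])
  ultimately obtain l' where "l' \<le> m" "u l' T + v' l' T = -2"
    using IVT2'[of "\<lambda>l. u l T + v' l T" m "-2" l] m by auto
  then show False using no[of l'] m by auto
qed

end

section \<open>Fixed points of Hammerstein operators\<close>

text \<open>Brouwer's theorem for a cube whose dimension is a number rather than a type, from Kuhn's
  combinatorial lemma; points are sequences of which the first \<open>n\<close> entries matter.\<close>

lemma brouwer_nat_cube:
  fixes \<Phi> :: "(nat \<Rightarrow> real) \<Rightarrow> nat \<Rightarrow> real"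
  assumes maps: "\<And>i x. i < n \<Longrightarrow> (\<And>j. x j \<in> {0..1}) \<Longrightarrow> \<Phi> x i \<in> {0..1}"
    and cont: "\<And>i X x. i < n \<Longrightarrow> (\<And>k j. X k j \<in> {0..1}) \<Longrightarrow> (\<And>j. (\<lambda>k. X k j) \<longlonglongrightarrow> x j) \<Longrightarrow>
                  (\<lambda>k. \<Phi> (X k) i) \<longlonglongrightarrow> \<Phi> x i"
  obtains x where "\<And>j. x j \<in> {0..1}" "\<And>i. i < n \<Longrightarrow> \<Phi> x i = x i"
proof -
  define e where "e p z j = (if j < n then real (z j) / real p else 0)" for p :: nat and z :: "nat \<Rightarrow> nat" and j
  \<comment> \<open>A Kuhn cell offers for each coordinate \<open>i\<close> its own pair of
    vertices, \<open>R i\<close> where coordinate \<open>i\<close> does not decrease and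
    \<open>S i\<close> where it does not increase. All of them converge to the same point, where the
    two inequalities become an equality.\<close>
  have approx: "\<exists>x R S. (\<forall>j. x j \<in> {0..1}) \<and>
      (\<forall>i<n. (\<forall>j. R i j \<in> {0..1} \<and> S i j \<in> {0..1} \<and> \<bar>R i j - x j\<bar> \<le> 1 / real (Suc k) \<and> \<bar>S i j - x j\<bar> \<le> 1 / real (Suc k)) \<and>
          R i i \<le> \<Phi> (R i) i \<and> \<Phi> (S i) i \<le> S i i)" for k
  proof -
    define p where "p = Suc k"
    have "p > 0" by (simp add: p_def)
    have e01: "e p z j \<in> {0..1}" if "\<forall>i<n. z i \<le> p" for z j
      using that \<open>p > 0\<close> by (auto simp: e_def)
    \<comment> \<open>Label 0 means that \<open>\<Phi>\<close> does not decrease coordinate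
      \<open>i\<close>. The lemma demands 1 on the face \<open>z i = p\<close>, which is therefore
      imposed, and 0 on the face \<open>z i = 0\<close>, which follows from
      \<open>\<Phi> \<ge> 0\<close>.\<close>
    define label :: "(nat \<Rightarrow> nat) \<Rightarrow> nat \<Rightarrow> nat"
      where "label z i = (if z i = p then 1 else if e p z i \<le> \<Phi> (e p z) i then 0 else 1)" for z i
    have l0: "label z i = 0" if "\<forall>i<n. z i \<le> p" "i < n" "z i = 0" for z i
      using maps[OF that(2), of "e p z"] e01[OF that(1)] that \<open>p > 0\<close> by (auto simp: label_def e_def[of p z i])
    obtain q where q: "\<forall>i<n. q i < p" "\<forall>i<n. \<exists>r s. (\<forall>j<n. q j \<le> r j \<and> r j \<le> q j + 1) \<and>
        (\<forall>j<n. q j \<le> s j \<and> s j \<le> q j + 1) \<and> label r i \<noteq> label s i"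
    proof (rule kuhn_lemma[of p n label])
      show "\<forall>x. (\<forall>i<n. x i \<le> p) \<longrightarrow> (\<forall>i<n. x i = 0 \<longrightarrow> label x i = 0)" using l0 by blast
    qed (auto simp: label_def \<open>p > 0\<close>)
    have ex: "\<exists>r s. (\<forall>j<n. q j \<le> r j \<and> r j \<le> q j + 1) \<and> (\<forall>j<n. q j \<le> s j \<and> s j \<le> q j + 1) \<and>
        label r i = 0 \<and> label s i = 1" if "i < n" for i
    proof -
      have "label z i = 0 \<or> label z i = 1" for z by (simp add: label_def)
      then show ?thesis using q(2) that by metis
    qed
    have "\<exists>R S. (\<forall>j. R j \<in> {0..1} \<and> S j \<in> {0..1} \<and> \<bar>R j - e p q j\<bar> \<le> 1 / real p \<and> \<bar>S j - e p q j\<bar> \<le> 1 / real p) \<and>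
          R i \<le> \<Phi> R i \<and> \<Phi> S i \<le> S i" if i: "i < n" for i
    proof -
      obtain r s where rs: "\<forall>j<n. q j \<le> r j \<and> r j \<le> q j + 1" "\<forall>j<n. q j \<le> s j \<and> s j \<le> q j + 1"
        "label r i = 0" "label s i = 1" using ex[OF i] by blast
      have rsp: "\<forall>j<n. r j \<le> p" "\<forall>j<n. s j \<le> p" using rs q(1) by fastforce+
      have near: "\<bar>e p z j - e p q j\<bar> \<le> 1 / real p" if "\<forall>j<n. q j \<le> z j \<and> z j \<le> q j + 1" for z j
      proof (cases "j < n")
        case True
        then have "real (q j) \<le> real (z j)" "real (z j) \<le> real (q j) + 1" using that by (auto simp flip: of_nat_Suc)
        then have "\<bar>real (z j) - real (q j)\<bar> / real p \<le> 1 / real p" by (intro divide_right_mono) auto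
        then show ?thesis using True \<open>p > 0\<close> by (simp add: e_def flip: diff_divide_distrib)
      qed (simp add: e_def)
      have "e p r i \<le> \<Phi> (e p r) i" using rs(3) by (auto simp: label_def split: if_splits)
      moreover have "\<Phi> (e p s) i \<le> e p s i"
      proof (cases "s i = p")
        case True
        then have "e p s i = 1" using i \<open>p > 0\<close> by (simp add: e_def)
        then show ?thesis using maps[OF i e01[OF rsp(2)]] by simp
      next
        case False
        then show ?thesis using rs(4) by (auto simp: label_def split: if_splits)
      qed
      ultimately show ?thesis using near[OF rs(1)] near[OF rs(2)] e01[OF rsp(1)] e01[OF rsp(2)] by blast
    qed
    then obtain R S where "\<forall>i<n. (\<forall>j. R i j \<in> {0..1} \<and> S i j \<in> {0..1} \<and> \<bar>R i j - e p q j\<bar> \<le> 1 / real p \<and> \<bar>S i j - e p q j\<bar> \<le> 1 / real p) \<and>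
          R i i \<le> \<Phi> (R i) i \<and> \<Phi> (S i) i \<le> S i i" by metis
    moreover have "\<forall>j. e p q j \<in> {0..1}" using e01 q(1) by (simp add: less_imp_le)
    ultimately show ?thesis unfolding p_def by blast
  qed
  then obtain x R S where x: "\<And>k j. x k j \<in> {0..1}"
    and RS: "\<And>k i j. i < n \<Longrightarrow> R k i j \<in> {0..1} \<and> S k i j \<in> {0..1} \<and> \<bar>R k i j - x k j\<bar> \<le> 1 / real (Suc k) \<and> \<bar>S k i j - x k j\<bar> \<le> 1 / real (Suc k)"
    and \<Phi>: "\<And>k i. i < n \<Longrightarrow> R k i i \<le> \<Phi> (R k i) i \<and> \<Phi> (S k i) i \<le> S k i i"
    by metis
  obtain \<sigma> :: "nat \<Rightarrow> nat" where \<sigma>: "strict_mono \<sigma>" "\<And>j. \<exists>l. (\<lambda>k. x (\<sigma> k) j) \<longlonglongrightarrow> l"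
  proof (rule function_convergent_subsequence[of UNIV x 1])
    show "norm (x k j) \<le> 1" for k j using x[of k j] by auto
  qed auto
  then obtain \<xi> where \<xi>: "\<And>j. (\<lambda>k. x (\<sigma> k) j) \<longlonglongrightarrow> \<xi> j" by metis
  have "(\<lambda>k. 1 / real (Suc (\<sigma> k))) \<longlonglongrightarrow> 0"
    using LIMSEQ_subseq_LIMSEQ[OF LIMSEQ_Suc[OF lim_const_over_n[of 1]] \<sigma>(1)] by (simp add: o_def)
  have conv: "(\<lambda>k. Z (\<sigma> k) j) \<longlonglongrightarrow> \<xi> j" if "\<And>k. \<bar>Z k j - x k j\<bar> \<le> 1 / real (Suc k)" for Z :: "nat \<Rightarrow> nat \<Rightarrow> real" and j
  proof -
    have "(\<lambda>k. Z (\<sigma> k) j - x (\<sigma> k) j) \<longlonglongrightarrow> 0"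
      by (rule tendsto_rabs_zero_cancel, rule tendsto_sandwich[OF _ _ tendsto_const \<open>(\<lambda>k. 1 / real (Suc (\<sigma> k))) \<longlonglongrightarrow> 0\<close>])
        (use that in auto)
    from tendsto_add[OF this \<xi>[of j]] show ?thesis by simp
  qed
  show thesis
  proof (rule that)
    show "\<xi> j \<in> {0..1}" for j
      by (rule closed_sequentially[OF closed_atLeastAtMost _ \<xi>]) (use x in auto)
    fix i assume i: "i < n"
    have R: "\<And>j. (\<lambda>k. R (\<sigma> k) i j) \<longlonglongrightarrow> \<xi> j" and S: "\<And>j. (\<lambda>k. S (\<sigma> k) i j) \<longlonglongrightarrow> \<xi> j"
      using conv[of "\<lambda>k. R k i"] conv[of "\<lambda>k. S k i"] RS[OF i] by auto
    have "(\<lambda>k. \<Phi> (R (\<sigma> k) i) i) \<longlonglongrightarrow> \<Phi> \<xi> i" "(\<lambda>k. \<Phi> (S (\<sigma> k) i) i) \<longlonglongrightarrow> \<Phi> \<xi> i"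
      using RS[OF i] R S by (auto intro!: cont[OF i])
    then show "\<Phi> \<xi> i = \<xi> i"
      using LIMSEQ_le[OF R[of i], of "\<lambda>k. \<Phi> (R (\<sigma> k) i) i"] LIMSEQ_le[OF _ S[of i], of "\<lambda>k. \<Phi> (S (\<sigma> k) i) i"] \<Phi>[OF i]
      by (meson order_antisym)
  qed
qed

lemma continuous_on_slice_snd: "continuous_on (A \<times> B) (\<lambda>(t, s). G t s) \<Longrightarrow> t \<in> A \<Longrightarrow> continuous_on B (G t)"
  using continuous_on_compose2[of "A \<times> B" "\<lambda>(t, s). G t s" B "\<lambda>s. (t, s)"] by (force intro!: continuous_intros)

lemma continuous_on_slice_fst: "continuous_on (A \<times> B) (\<lambda>(t, s). G t s) \<Longrightarrow> s \<in> B \<Longrightarrow> continuous_on A (\<lambda>t. G t s)"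
  using continuous_on_compose2[of "A \<times> B" "\<lambda>(t, s). G t s" A "\<lambda>t. (t, s)"] by (force intro!: continuous_intros)

text \<open>\<open>\<F>\<close> is an abstract operator rather than a superposition, so that it may
  contain a perturbation depending on the whole function. Measurability is asked for step functions
  only, where it is a countable case distinction; the fixed point inherits it as a pointwise limit.
  Brouwer's theorem supplies step functions that agree with their image at the left node of each
  cell.\<close>

lemma hammerstein_fixed_point:
  fixes G :: "real \<Rightarrow> real \<Rightarrow> real" and \<F> :: "(real \<Rightarrow> real) \<Rightarrow> real \<Rightarrow> real" and \<phi> :: "real \<Rightarrow> real"
  assumes T: "T > 0" and R: "R > 0"
    and G: "continuous_on ({0..T} \<times> {0..T}) (\<lambda>(t, s). G t s)"
    and meas: "\<And>c N. (\<And>i. c i \<in> {0..R}) \<Longrightarrow> \<F> (\<lambda>t. c (nat \<lfloor>real N * t / T\<rfloor>)) \<in> borel_measurable (lebesgue_on {0..T})"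
    and \<phi>: "integrable (lebesgue_on {0..T}) \<phi>"
    and bound: "\<And>w. (\<And>t. t \<in> {0..T} \<Longrightarrow> w t \<in> {0..R}) \<Longrightarrow> AE s in lebesgue_on {0..T}. \<bar>\<F> w s\<bar> \<le> \<phi> s"
    and cont: "\<And>W w s. (\<And>n t. t \<in> {0..T} \<Longrightarrow> W n t \<in> {0..R}) \<Longrightarrow> (\<And>t. t \<in> {0..T} \<Longrightarrow> w t \<in> {0..R}) \<Longrightarrow>
          uniform_limit {0..T} W w sequentially \<Longrightarrow> s \<in> {0..T} \<Longrightarrow> (\<lambda>n. \<F> (W n) s) \<longlonglongrightarrow> \<F> w s"
    and maps: "\<And>w t. (\<And>t. t \<in> {0..T} \<Longrightarrow> w t \<in> {0..R}) \<Longrightarrow> \<F> w \<in> borel_measurable (lebesgue_on {0..T}) \<Longrightarrow>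
          t \<in> {0..T} \<Longrightarrow> (LINT s|lebesgue_on {0..T}. G t s * \<F> w s) \<in> {0..R}"
  obtains u where "continuous_on {0..T} u" "\<And>t. t \<in> {0..T} \<Longrightarrow> u t \<in> {0..R}"
    "\<F> u \<in> borel_measurable (lebesgue_on {0..T})"
    "\<And>t. t \<in> {0..T} \<Longrightarrow> u t = (LINT s|lebesgue_on {0..T}. G t s * \<F> u s)"
proof -
  let ?M = "lebesgue_on {0..T}"
  define K where "K w t = (LINT s|?M. G t s * \<F> w s)" for w t
  have Gm: "G t \<in> borel_measurable ?M" if "t \<in> {0..T}" for t
    by (intro continuous_imp_measurable_on_sets_lebesgue continuous_on_slice_snd[OF G] that) auto
  have "compact ((\<lambda>(t, s). G t s) ` ({0..T} \<times> {0..T}))"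
    by (intro compact_continuous_image G compact_Times compact_Icc)
  then have "bounded ((\<lambda>(t, s). G t s) ` ({0..T} \<times> {0..T}))" by (rule compact_imp_bounded)
  then obtain g where "\<forall>x\<in>(\<lambda>(t, s). G t s) ` ({0..T} \<times> {0..T}). norm x \<le> g"
    unfolding bounded_iff by blast
  then have g: "\<bar>G t s\<bar> \<le> g" if "t \<in> {0..T}" "s \<in> {0..T}" for t s using that by force
  have phi_nn: "AE s in ?M. 0 \<le> \<phi> s"
    using bound[of "\<lambda>_. 0"] R by (auto elim!: eventually_mono)
  have bd: "AE s in ?M. norm (k s * \<F> w s) \<le> e * \<phi> s"
    if w: "\<And>t. t \<in> {0..T} \<Longrightarrow> w t \<in> {0..R}" and k: "\<And>s. s \<in> {0..T} \<Longrightarrow> \<bar>k s\<bar> \<le> e" for w k e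
  proof -
    have "AE s in ?M. \<bar>\<F> w s\<bar> \<le> \<phi> s" by (rule bound) (rule w)
    moreover have "AE s in ?M. s \<in> {0..T}" using AE_space[of ?M] by simp
    ultimately show ?thesis
    proof eventually_elim
      case (elim s)
      then have "\<bar>k s\<bar> * \<bar>\<F> w s\<bar> \<le> e * \<phi> s" using k[of s] by (intro mult_mono) auto
      then show ?case by (simp add: abs_mult)
    qed
  qed
  have lim: "(\<lambda>n. K (W n) t) \<longlonglongrightarrow> K w t"
    if W: "\<And>n t. t \<in> {0..T} \<Longrightarrow> W n t \<in> {0..R}" and w: "\<And>t. t \<in> {0..T} \<Longrightarrow> w t \<in> {0..R}"
      and Wm: "\<And>n. \<F> (W n) \<in> borel_measurable ?M" and wm: "\<F> w \<in> borel_measurable ?M"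
      and ul: "uniform_limit {0..T} W w sequentially" and t: "t \<in> {0..T}" for W w t
    unfolding K_def
  proof (rule integral_dominated_convergence[where w="\<lambda>s. g * \<phi> s"])
    show "integrable ?M (\<lambda>s. g * \<phi> s)" using \<phi> by simp
    show "AE s in ?M. (\<lambda>n. G t s * \<F> (W n) s) \<longlonglongrightarrow> G t s * \<F> w s"
      by (intro AE_I2 tendsto_mult_left cont[OF W w ul]) auto
    show "AE s in ?M. norm (G t s * \<F> (W n) s) \<le> g * \<phi> s" for n
      using W g[OF t] by (rule bd)
  qed (use Gm[OF t] wm Wm in measurable)
  have lip: "\<bar>K w t - K w t'\<bar> \<le> \<epsilon> * (LINT s|?M. \<phi> s)"
    if w: "\<And>t. t \<in> {0..T} \<Longrightarrow> w t \<in> {0..R}" and wm: "\<F> w \<in> borel_measurable ?M"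
      and t: "t \<in> {0..T}" "t' \<in> {0..T}" and e: "\<And>s. s \<in> {0..T} \<Longrightarrow> \<bar>G t s - G t' s\<bar> \<le> \<epsilon>" for w t t' \<epsilon>
  proof -
    have int: "integrable ?M (\<lambda>s. G r s * \<F> w s)" if "r \<in> {0..T}" for r
    proof (rule Bochner_Integration.integrable_bound)
      show "integrable ?M (\<lambda>s. g * \<phi> s)" using \<phi> by simp
      have "AE s in ?M. norm (G r s * \<F> w s) \<le> g * \<phi> s" using w g[OF that] by (rule bd)
      then show "AE s in ?M. norm (G r s * \<F> w s) \<le> norm (g * \<phi> s)" by eventually_elim auto
    qed (use Gm[OF that] wm in measurable)
    have "K w t - K w t' = (LINT s|?M. (G t s - G t' s) * \<F> w s)"
      unfolding K_def left_diff_distrib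
      by (rule Bochner_Integration.integral_diff[symmetric]) (intro int t)+
    also have "norm \<dots> \<le> (LINT s|?M. norm ((G t s - G t' s) * \<F> w s))"
      by (rule integral_norm_bound)
    also have "\<dots> \<le> (LINT s|?M. \<epsilon> * \<phi> s)"
    proof (rule integral_mono_AE)
      show "integrable ?M (\<lambda>s. norm ((G t s - G t' s) * \<F> w s))"
        unfolding left_diff_distrib by (intro integrable_norm Bochner_Integration.integrable_diff int t)
      show "AE s in ?M. norm ((G t s - G t' s) * \<F> w s) \<le> \<epsilon> * \<phi> s"
        using w e by (rule bd)
    qed (use \<phi> in simp)
    finally show ?thesis by simp
  qed
  define I where "I = (LINT s|?M. \<phi> s)"
  have "I \<ge> 0" unfolding I_def by (rule integral_nonneg_AE[OF phi_nn])
  \<comment> \<open>\<open>st N c\<close> is \<open>c i\<close> on the \<open>i\<close>-th of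
    \<open>N\<close> cells of length \<open>T / N\<close>, and \<open>c N\<close> at the single
    point \<open>T\<close>; hence the dimension \<open>Suc N\<close> below.
    \<open>\<tau> N t\<close> is the left node of the cell of \<open>t\<close>.\<close>
  define st where "st N c t = c (nat \<lfloor>real N * t / T\<rfloor>)" for N :: nat and c :: "nat \<Rightarrow> real" and t
  define \<tau> where "\<tau> N t = real (nat \<lfloor>real N * t / T\<rfloor>) * T / real N" for N :: nat and t
  have tau: "\<tau> N t \<in> {0..T}" "\<bar>\<tau> N t - t\<bar> \<le> T / real N" "nat \<lfloor>real N * t / T\<rfloor> \<le> N"
    if "N > 0" "t \<in> {0..T}" for N t
  proof -
    have nn: "real N * t / T \<ge> 0" using that T by auto
    have le: "real N * t / T \<le> real N" using that T by (simp add: field_simps mult_left_mono)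
    define i where "i = nat \<lfloor>real N * t / T\<rfloor>"
    have i: "real i \<le> real N * t / T" "real N * t / T < real i + 1"
      using nn unfolding i_def by linarith+
    show "nat \<lfloor>real N * t / T\<rfloor> \<le> N" using le nn by linarith
    have "real i * T / real N \<le> t" using i(1) that T by (simp add: field_simps)
    moreover have "t \<le> real i * T / real N + T / real N" using i(2) that T by (simp add: field_simps)
    ultimately show "\<bar>\<tau> N t - t\<bar> \<le> T / real N" "\<tau> N t \<in> {0..T}"
      unfolding \<tau>_def i_def[symmetric] using that T by (auto simp: abs_le_iff)
  qed
  have "\<exists>c. (\<forall>i. c i \<in> {0..R}) \<and> (\<forall>t\<in>{0..T}. st N c t = K (st N c) (\<tau> N t))" if N: "N > 0" for N
  proof -
    have st_R: "st N (\<lambda>i. R * x i) t \<in> {0..R}" if "\<And>j. x j \<in> {0..1}" for x t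
      using that R by (auto simp: st_def mult_left_le)
    have st_m: "\<F> (st N (\<lambda>i. R * x i)) \<in> borel_measurable ?M" if "\<And>j. x j \<in> {0..1}" for x
      unfolding st_def by (rule meas) (use that R in \<open>auto simp: mult_left_le\<close>)
    have node: "real i * T / real N \<in> {0..T}" if "i < Suc N" for i
      using that N T by (auto simp: field_simps)
    \<comment> \<open>The unknowns are the values at the nodes, divided by \<open>R\<close> in order
      to lie in the unit cube.\<close>
    obtain x where x: "\<And>j. x j \<in> {0..1}"
      "\<And>i. i < Suc N \<Longrightarrow> K (st N (\<lambda>i. R * x i)) (real i * T / real N) / R = x i"
    proof (rule brouwer_nat_cube[of "Suc N" "\<lambda>x i. K (st N (\<lambda>i. R * x i)) (real i * T / real N) / R"])
      fix i and x :: "nat \<Rightarrow> real" assume ix: "i < Suc N" "\<And>j. x j \<in> {0..1}"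
      show "K (st N (\<lambda>i. R * x i)) (real i * T / real N) / R \<in> {0..1}"
        using maps[OF st_R[OF ix(2)] st_m[OF ix(2)] node[OF ix(1)]] R by (auto simp: K_def)
    next
      fix i and X :: "nat \<Rightarrow> nat \<Rightarrow> real" and x
      assume i: "i < Suc N" and X: "\<And>k j. X k j \<in> {0..1}" and Xx: "\<And>j. (\<lambda>k. X k j) \<longlonglongrightarrow> x j"
      have x: "x j \<in> {0..1}" for j
        by (rule closed_sequentially[OF closed_atLeastAtMost _ Xx]) (use X in auto)
      have "(\<lambda>k. K (st N (\<lambda>i. R * X k i)) (real i * T / real N)) \<longlonglongrightarrow> K (st N (\<lambda>i. R * x i)) (real i * T / real N)"
      proof (rule lim[OF st_R[OF X] st_R[OF x] st_m[OF X] st_m[OF x] _ node[OF i]])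
        show "uniform_limit {0..T} (\<lambda>k. st N (\<lambda>i. R * X k i)) (st N (\<lambda>i. R * x i)) sequentially"
        proof (rule uniform_limitI)
          fix \<epsilon> :: real assume "\<epsilon> > 0"
          have "\<forall>\<^sub>F k in sequentially. \<forall>j\<in>{..N}. dist (R * X k j) (R * x j) < \<epsilon>"
            by (intro eventually_ball_finite ballI tendstoD[OF tendsto_mult_left[OF Xx] \<open>\<epsilon> > 0\<close>]) auto
          then show "\<forall>\<^sub>F k in sequentially. \<forall>t\<in>{0..T}. dist (st N (\<lambda>i. R * X k i) t) (st N (\<lambda>i. R * x i) t) < \<epsilon>"
            by eventually_elim (use tau(3)[OF N] in \<open>auto simp: st_def\<close>)
        qed
      qed
      then show "(\<lambda>k. K (st N (\<lambda>i. R * X k i)) (real i * T / real N) / R) \<longlonglongrightarrow> K (st N (\<lambda>i. R * x i)) (real i * T / real N) / R"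
        by (intro tendsto_divide tendsto_const) (use R in auto)
    qed blast
    have "st N (\<lambda>i. R * x i) t = K (st N (\<lambda>i. R * x i)) (\<tau> N t)" if t: "t \<in> {0..T}" for t
    proof -
      have "nat \<lfloor>real N * t / T\<rfloor> < Suc N" using tau(3)[OF N t] by simp
      from x(2)[OF this] show ?thesis using R by (simp add: st_def[of N _ t] \<tau>_def field_simps)
    qed
    then show ?thesis using x(1) R by (intro exI[of _ "\<lambda>i. R * x i"]) (auto simp: mult_left_le)
  qed
  then obtain c where c: "\<And>N i. c (Suc N) i \<in> {0..R}"
    "\<And>N t. t \<in> {0..T} \<Longrightarrow> st (Suc N) (c (Suc N)) t = K (st (Suc N) (c (Suc N))) (\<tau> (Suc N) t)"
    by (metis zero_less_Suc)
  define W where "W N = st (Suc N) (c (Suc N))" for N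
  have WR: "W N t \<in> {0..R}" for N t using c(1) by (simp add: W_def st_def)
  have Wm: "\<F> (W N) \<in> borel_measurable ?M" for N unfolding W_def st_def by (rule meas) (use c(1) in auto)
  have WK: "W N t = K (W N) (\<tau> (Suc N) t)" if "t \<in> {0..T}" for N t using c(2)[OF that] by (simp add: W_def)
  have KR: "K (W N) t \<in> {0..R}" if "t \<in> {0..T}" for N t
    unfolding K_def by (rule maps[OF WR Wm that])
  have Gu: "uniformly_continuous_on ({0..T} \<times> {0..T}) (\<lambda>(t, s). G t s)"
    by (intro compact_uniformly_continuous G compact_Times compact_Icc)
  have equi: "\<exists>d>0. \<forall>N t t'. t \<in> {0..T} \<longrightarrow> t' \<in> {0..T} \<longrightarrow> \<bar>t - t'\<bar> < d \<longrightarrow> \<bar>K (W N) t - K (W N) t'\<bar> < \<epsilon>"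
    if "\<epsilon> > 0" for \<epsilon>
  proof -
    define \<eta> where "\<eta> = \<epsilon> / (I + 1)"
    have "\<eta> > 0" using \<open>\<epsilon> > 0\<close> \<open>I \<ge> 0\<close> by (simp add: \<eta>_def)
    from Gu[unfolded uniformly_continuous_on_def, rule_format, OF this] obtain d where d: "d > 0"
      "\<And>p q. p \<in> {0..T} \<times> {0..T} \<Longrightarrow> q \<in> {0..T} \<times> {0..T} \<Longrightarrow> dist q p < d \<Longrightarrow>
        dist (case q of (t, s) \<Rightarrow> G t s) (case p of (t, s) \<Rightarrow> G t s) < \<eta>" by blast
    have "\<bar>K (W N) t - K (W N) t'\<bar> < \<epsilon>" if t: "t \<in> {0..T}" "t' \<in> {0..T}" "\<bar>t - t'\<bar> < d" for N t t'
    proof -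
      have "\<bar>G t s - G t' s\<bar> \<le> \<eta>" if "s \<in> {0..T}" for s
        using d(2)[of "(t', s)" "(t, s)"] t that by (auto simp: dist_Pair_Pair dist_real_def)
      from lip[OF WR Wm t(1,2) this] have "\<bar>K (W N) t - K (W N) t'\<bar> \<le> \<eta> * I" by (simp add: I_def)
      also have "\<dots> < \<epsilon>" using \<open>\<epsilon> > 0\<close> \<open>I \<ge> 0\<close> by (simp add: \<eta>_def field_simps)
      finally show ?thesis .
    qed
    then show ?thesis using d(1) by blast
  qed
  \<comment> \<open>The \<open>W N\<close> jump and are not equicontinuous, so compactness is
    applied to their images. \<open>W N\<close> is close to its image because it equals that image
    evaluated at the nearby node \<open>\<tau>\<close>.\<close>
  obtain u k where u: "continuous_on {0..T} u" "strict_mono (k :: nat \<Rightarrow> nat)"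
    "\<And>\<epsilon>. 0 < \<epsilon> \<Longrightarrow> \<exists>N. \<forall>n t. n \<ge> N \<and> t \<in> {0..T} \<longrightarrow> norm (K (W (k n)) t - u t) < \<epsilon>"
  proof (rule Arzela_Ascoli[of "{0..T}" "\<lambda>N. K (W N)" R])
    show "norm (K (W N) t) \<le> R" if "t \<in> {0..T}" for N t using KR[OF that, of N] by auto
    show "\<exists>d>0. \<forall>N t'. t' \<in> {0..T} \<and> norm (t - t') < d \<longrightarrow> norm (K (W N) t - K (W N) t') < \<epsilon>"
      if "t \<in> {0..T}" "0 < \<epsilon>" for t \<epsilon> using equi[OF that(2)] that(1) unfolding real_norm_def by blast
  qed (auto intro: that)
  have ul: "uniform_limit {0..T} (\<lambda>n. W (k n)) u sequentially"
  proof (rule uniform_limitI)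
    fix \<epsilon> :: real assume "\<epsilon> > 0"
    then have "\<epsilon> / 2 > 0" by simp
    obtain d where d: "d > 0" "\<And>N t t'. t \<in> {0..T} \<Longrightarrow> t' \<in> {0..T} \<Longrightarrow> \<bar>t - t'\<bar> < d \<Longrightarrow> \<bar>K (W N) t - K (W N) t'\<bar> < \<epsilon> / 2"
      using equi[OF \<open>\<epsilon> / 2 > 0\<close>] by blast
    obtain N1 where N1: "\<And>n t. n \<ge> N1 \<Longrightarrow> t \<in> {0..T} \<Longrightarrow> \<bar>K (W (k n)) t - u t\<bar> < \<epsilon> / 2"
      using u(3)[OF \<open>\<epsilon> / 2 > 0\<close>] unfolding real_norm_def by blast
    obtain N2 :: nat where N2: "T / d < real N2" using reals_Archimedean2 by blast
    have "dist (W (k n) t) (u t) < \<epsilon>" if n: "n \<ge> max N1 N2" and t: "t \<in> {0..T}" for n t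
    proof -
      have "n \<le> k n" using u(2) by (rule strict_mono_imp_increasing)
      then have "real N2 \<le> real (Suc (k n))" using n by simp
      then have "T / d < real (Suc (k n))" using N2 by linarith
      then have "T / real (Suc (k n)) < d" using d(1) by (simp add: field_simps)
      then have "\<bar>\<tau> (Suc (k n)) t - t\<bar> < d" using tau(2)[OF zero_less_Suc t] by (rule le_less_trans[rotated])
      then have "\<bar>W (k n) t - K (W (k n)) t\<bar> < \<epsilon> / 2"
        unfolding WK[OF t, of "k n"] using d(2) tau(1)[OF zero_less_Suc t] t by blast
      moreover have "\<bar>K (W (k n)) t - u t\<bar> < \<epsilon> / 2" using N1 n t by auto
      ultimately show ?thesis unfolding dist_real_def by linarith
    qed
    then show "\<forall>\<^sub>F n in sequentially. \<forall>t\<in>{0..T}. dist (W (k n) t) (u t) < \<epsilon>"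
      unfolding eventually_sequentially by blast
  qed
  have uR: "u t \<in> {0..R}" if "t \<in> {0..T}" for t
    by (rule closed_sequentially[OF closed_atLeastAtMost _ tendsto_uniform_limitI[OF ul that]]) (use WR in auto)
  have Fl: "(\<lambda>n. \<F> (W (k n)) s) \<longlonglongrightarrow> \<F> u s" if "s \<in> {0..T}" for s
    by (rule cont[OF WR uR ul that])
  have um: "\<F> u \<in> borel_measurable ?M"
    by (rule borel_measurable_LIMSEQ_real[where u="\<lambda>n. \<F> (W (k n))"]) (use Fl Wm in auto)
  have "u t = K u t" if t: "t \<in> {0..T}" for t
  proof (rule LIMSEQ_unique)
    show "(\<lambda>n. K (W (k n)) t) \<longlonglongrightarrow> K u t" by (rule lim[OF WR uR Wm um ul t])
    show "(\<lambda>n. K (W (k n)) t) \<longlonglongrightarrow> u t"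
      using u(3) t by (intro LIMSEQ_I) blast
  qed
  then show thesis using that u(1) uR um unfolding K_def by blast
qed

section \<open>Periodic solutions\<close>

lemma L1_iff_abs_integrable: "L1 T h \<longleftrightarrow> h absolutely_integrable_on {0..T}"
  by (simp add: integrable_restrict_space set_integrable_def)

lemma LINT_eq_integral:
  fixes h :: "real \<Rightarrow> real"
  assumes "h absolutely_integrable_on {p..q}"
  shows "(LINT s|lebesgue_on {p..q}. h s) = integral {p..q} h"
  using assms by (intro lebesgue_integral_eq_integral) (simp_all add: integrable_restrict_space set_integrable_def)

lemma AE_lebesgue_on_negligible:
  fixes P :: "real \<Rightarrow> bool"
  assumes "AE t in lebesgue_on {p..q}. P t"
  obtains N where "negligible N" "\<And>t. t \<in> {p..q} \<Longrightarrow> t \<notin> N \<Longrightarrow> P t"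
proof -
  have "AE t in lebesgue. t \<in> {p..q} \<longrightarrow> P t"
    using assms by (simp add: AE_restrict_space_iff)
  then obtain N where "{t \<in> space lebesgue. \<not> (t \<in> {p..q} \<longrightarrow> P t)} \<subseteq> N" "emeasure lebesgue N = 0" "N \<in> sets lebesgue"
    by (rule AE_E)
  then show thesis using that[of N] by (auto simp: negligible_iff_null_sets null_sets_def)
qed

lemma Lp_imp_absolutely_integrable:
  assumes "Lp \<alpha> T a" "\<alpha> \<ge> 1"
  shows "a absolutely_integrable_on {0..T}"
proof -
  have "integrable (lebesgue_on {0..T}) (\<lambda>t. 1 + \<bar>a t\<bar> powr \<alpha>)"
    using assms unfolding Lp_def
    by (intro Bochner_Integration.integrable_add) (auto simp: integrable_restrict_space)
  then have "integrable (lebesgue_on {0..T}) a"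
  proof (rule Bochner_Integration.integrable_bound)
    show "a \<in> borel_measurable (lebesgue_on {0..T})" using assms by (simp add: Lp_def)
    have "\<bar>x\<bar> \<le> 1 + \<bar>x\<bar> powr \<alpha>" for x :: real
    proof (cases "\<bar>x\<bar> \<le> 1")
      case False
      then have "\<bar>x\<bar> powr 1 \<le> \<bar>x\<bar> powr \<alpha>" using assms(2) by (intro powr_mono) auto
      then show ?thesis using False by simp
    qed (simp add: add_increasing2)
    then show "AE t in lebesgue_on {0..T}. norm (a t) \<le> norm (1 + \<bar>a t\<bar> powr \<alpha>)"
      by (intro AE_I2) (auto simp: abs_le_iff add_nonneg_nonneg intro: order_trans)
  qed
  then show ?thesis by (simp add: L1_iff_abs_integrable)
qed

lemma hill_on_of_solution:
  assumes "hill_solution \<epsilon> T a h u" "T > 0"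
  obtains u' where "hill_on a h 0 T u u'" "u 0 = \<epsilon> * u T" "u' 0 = \<epsilon> * u' T"
proof -
  obtain u' u'' where W: "W21 T u u' u''" and ae: "AE t in lebesgue_on {0..T}. u'' t + a t * u t = h t"
    and bc: "u 0 = \<epsilon> * u T" "u' 0 = \<epsilon> * u' T"
    using assms(1) unfolding hill_solution_def by blast
  obtain N where N: "negligible N" "\<And>t. t \<in> {0..T} \<Longrightarrow> t \<notin> N \<Longrightarrow> u'' t + a t * u t = h t"
    using AE_lebesgue_on_negligible[OF ae] by blast
  have ai: "u'' absolutely_integrable_on {0..T}" using W by (simp add: W21_def L1_iff_abs_integrable)
  have u': "u' t = u' 0 + integral {0..t} u''" if "t \<in> {0..T}" for t
  proof -
    have "u' t = u' 0 + (LINT s|lebesgue_on {0..t}. u'' s)" using W that unfolding W21_def by blast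
    also have "(LINT s|lebesgue_on {0..t}. u'' s) = integral {0..t} u''"
      by (rule LINT_eq_integral[OF abs_integrable_subinterval[OF ai]]) (use that in auto)
    finally show ?thesis .
  qed
  have "hill_on a h 0 T u u'"
    unfolding hill_on_def
  proof (intro conjI ballI allI impI)
    show "(u has_real_derivative u' t) (at t within {0..T})" if "t \<in> {0..T}" for t
      using W that unfolding W21_def by blast
    fix s t assume st: "0 \<le> s" "s \<le> t" "t \<le> T"
    have i: "u'' integrable_on {p..q}" if "0 \<le> p" "q \<le> T" for p q
      by (rule abs_integrable_onD(1)[OF ai that])
    have "integral {0..s} u'' + integral {s..t} u'' = integral {0..t} u''"
      using st by (intro hk_combine i) auto
    then have "integral {s..t} u'' = u' t - u' s" using u'[of s] u'[of t] st by simp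
    then have "(u'' has_integral (u' t - u' s)) {s..t}"
      using integrable_integral[OF i[of s t]] st by simp
    then show "((\<lambda>r. h r - a r * u r) has_integral u' t - u' s) {s..t}"
    proof (rule has_integral_spike[OF N(1), rotated])
      show "h r - a r * u r = u'' r" if "r \<in> {s..t} - N" for r using N(2)[of r] that st by auto
    qed
  qed
  then show thesis using that bc by blast
qed

lemma solution_of_hill_on:
  assumes u: "hill_on a h 0 T u u'" and a: "a absolutely_integrable_on {0..T}" and h: "h absolutely_integrable_on {0..T}"
    and bc: "u 0 = \<epsilon> * u T" "u' 0 = \<epsilon> * u' T"
  shows "hill_solution \<epsilon> T a h u"
proof -
  let ?g = "\<lambda>r. h r - a r * u r"
  have g: "?g absolutely_integrable_on {0..T}"
    by (intro set_integral_diff h abs_integrable_mult a hill_on_continuous[OF u])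
  have "W21 T u u' ?g"
    unfolding W21_def L1_iff_abs_integrable
  proof (intro conjI ballI g)
    show "(u has_real_derivative u' t) (at t within {0..T})" if "t \<in> {0..T}" for t
      by (rule hill_on_deriv[OF u that])
    show "u' t = u' 0 + (LINT s|lebesgue_on {0..t}. ?g s)" if "t \<in> {0..T}" for t
      using LINT_eq_integral[OF abs_integrable_subinterval[OF g, of 0 t]] that
        integral_unique[OF hill_on_integral[OF u, of 0 t]] by auto
  qed
  then show ?thesis unfolding hill_solution_def using bc by force
qed

text \<open>Two periods of the periodic extension, with the value at \<open>T\<close> taken from the
  first copy. The coefficient need not agree at \<open>0\<close> and \<open>T\<close>, so the
  translation rule holds without further condition for \<open>t > 0\<close> only.\<close>

definition wrap :: "real \<Rightarrow> (real \<Rightarrow> real) \<Rightarrow> real \<Rightarrow> real" where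
  "wrap T g t = (if t \<le> T then g t else g (t - T))"

lemma wrap_simps: "t \<le> T \<Longrightarrow> wrap T g t = g t" "0 < t \<Longrightarrow> wrap T g (t + T) = g t"
  by (auto simp: wrap_def)

lemma wrap_periodic: "g 0 = g T \<Longrightarrow> 0 \<le> t \<Longrightarrow> t \<le> T \<Longrightarrow> wrap T g (t + T) = g t"
  by (auto simp: wrap_def order_le_less)

lemma absolutely_integrable_wrap:
  assumes g: "g absolutely_integrable_on {0..T}" and "T > 0"
  shows "wrap T g absolutely_integrable_on {0..2 * T}"
proof -
  have w: "wrap T f integrable_on {0..2 * T}" if f: "f integrable_on {0..T}" for f
  proof (rule Henstock_Kurzweil_Integration.integrable_combine)
    show "wrap T f integrable_on {0..T}"
      by (rule integrable_eq[OF f]) (simp add: wrap_def)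
    obtain i where "(f has_integral i) (cbox 0 T)" using f by auto
    from has_integral_affinity[OF this, of 1 "-T"]
    have "((\<lambda>t. f (t - T)) has_integral i) ((\<lambda>z. z + T) ` {0..T})" by simp
    moreover have "(\<lambda>z. z + T) ` {0..T} = {T..2 * T}" by simp
    ultimately have "((\<lambda>t. f (t - T)) has_integral i) {T..2 * T}" by simp
    then have "(wrap T f has_integral i) {T..2 * T}"
      by (rule has_integral_spike_finite[of "{T}", rotated 2]) (auto simp: wrap_def)
    then show "wrap T f integrable_on {T..2 * T}" by blast
  qed (use \<open>T > 0\<close> in auto)
  have "(\<lambda>t. \<bar>wrap T g t\<bar>) = wrap T (\<lambda>t. \<bar>g t\<bar>)" by (auto simp: wrap_def)
  then show ?thesis
    using w[of g] w[of "\<lambda>t. \<bar>g t\<bar>"] abs_integrable_onD[OF g, of 0 T]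
    by (simp add: absolutely_integrable_on_def)
qed

lemma hill_on_glue:
  assumes 1: "hill_on a h p m x x'" and 2: "hill_on a h m q x x'" and "p \<le> m" "m \<le> q"
  shows "hill_on a h p q x x'"
  unfolding hill_on_def
proof (intro conjI ballI allI impI)
  fix t assume t: "t \<in> {p..q}"
  have half: "(x has_real_derivative x' t) (at t within {r..s})" if "hill_on a h r s x x'" for r s
  proof (cases "t \<in> {r..s}")
    case False
    \<comment> \<open>Outside the subinterval the filter is trivial and every number is a
      derivative, so both halves can be treated alike.\<close>
    then have "at t within {r..s} = bot" by (simp add: at_within_eq_bot_iff)
    then show ?thesis by (simp add: has_field_derivative_iff)
  qed (use that hill_on_deriv in blast)
  have "{p..q} = {p..m} \<union> {m..q}" using assms by auto
  then show "(x has_real_derivative x' t) (at t within {p..q})"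
    using half[OF 1] half[OF 2] unfolding has_field_derivative_iff
    by (simp only: at_within_union filterlim_sup)
next
  fix s t assume st: "p \<le> s" "s \<le> t" "t \<le> q"
  show "((\<lambda>r. h r - a r * x r) has_integral x' t - x' s) {s..t}"
  proof (cases "t \<le> m \<or> m \<le> s")
    case True
    then show ?thesis using hill_on_integral[OF 1, of s t] hill_on_integral[OF 2, of s t] st by auto
  next
    case False
    then have "((\<lambda>r. h r - a r * x r) has_integral (x' m - x' s) + (x' t - x' m)) {s..t}"
      using st by (intro has_integral_combine[of s m t] hill_on_integral[OF 1] hill_on_integral[OF 2]) auto
    then show ?thesis by simp
  qed
qed

lemma hill_on_wrap:
  assumes u: "hill_on a h 0 T u u'" and bc: "u 0 = u T" "u' 0 = u' T" and "T > 0"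
  shows "hill_on (wrap T a) (wrap T h) 0 (2 * T) (wrap T u) (wrap T u')"
proof (rule hill_on_glue[of _ _ _ T])
  show "hill_on (wrap T a) (wrap T h) 0 T (wrap T u) (wrap T u')"
    by (rule hill_on_cong[OF u]) (auto simp: wrap_def)
  have "hill_on (\<lambda>t. a (t - T)) (\<lambda>t. h (t - T)) T (2 * T) (\<lambda>t. u (t - T)) (\<lambda>t. u' (t - T))"
    using hill_on_shift[OF u, of "- T"] by simp
  then have "hill_on (\<lambda>t. a (t - T)) (\<lambda>t. h (t - T)) T (2 * T) (wrap T u) (wrap T u')"
    by (rule hill_on_cong) (use bc in \<open>auto simp: wrap_def\<close>)
  then show "hill_on (wrap T a) (wrap T h) T (2 * T) (wrap T u) (wrap T u')"
    by (rule hill_on_spike[where N="{T}"]) (auto simp: wrap_def)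
qed (use \<open>T > 0\<close> in auto)

text \<open>The two spectral hypotheses in the form in which the sign arguments use them, free of
  the fundamental system. The eigenvalue equation is written with right-hand side
  \<open>- l * \<psi>\<close>, so that it has the same coefficient \<open>a\<close> as all other
  solutions.\<close>

locale stable_hill =
  fixes T :: real and a :: "real \<Rightarrow> real"
  assumes T_pos: "T > 0"
    and a_integrable: "a absolutely_integrable_on {0..T}"
    and disconjugate: "\<And>s. s \<in> {0..T} \<Longrightarrow> \<exists>y y'. hill_on (wrap T a) (\<lambda>_. 0) 0 (2 * T) y y' \<and>
          y s = 0 \<and> y' s = 1 \<and> (\<forall>t. s < t \<longrightarrow> t < s + T \<longrightarrow> y t > 0)"
    and negative_eigenvalue: "\<exists>l \<psi> \<psi>'. l < 0 \<and> hill_on a (\<lambda>t. - l * \<psi> t) 0 T \<psi> \<psi>' \<and>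
          \<psi> 0 = \<psi> T \<and> \<psi>' 0 = \<psi>' T \<and> (\<exists>t\<in>{0..T}. \<psi> t \<noteq> 0)"
begin

abbreviation periodic_hill_on :: "(real \<Rightarrow> real) \<Rightarrow> (real \<Rightarrow> real) \<Rightarrow> (real \<Rightarrow> real) \<Rightarrow> bool" where
  "periodic_hill_on h u u' \<equiv> hill_on a h 0 T u u' \<and> u 0 = u T \<and> u' 0 = u' T"

lemma wrap_integrable: "wrap T a absolutely_integrable_on {0..2 * T}"
  by (rule absolutely_integrable_wrap[OF a_integrable T_pos])

text \<open>The solution that leaves zero at \<open>s\<close> is positive on the open arc from
  \<open>s\<close> to \<open>s + T\<close>, and so it serves as comparison function on the closed
  arc \<open>[p, q]\<close> inside.\<close>

lemma arc_max_principle: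
  assumes s: "s \<in> {0..T}" and pq: "s < p" "q < s + T"
    and y: "hill_on (wrap T a) h p q y y'" "\<And>t. t \<in> {p..q} \<Longrightarrow> h t \<le> 0" "y p \<ge> 0" "y q \<ge> 0"
    and t: "t \<in> {p..q}"
  shows "y t \<ge> 0"
proof -
  obtain X X' where X: "hill_on (wrap T a) (\<lambda>_. 0) 0 (2 * T) X X'" "\<And>t. s < t \<Longrightarrow> t < s + T \<Longrightarrow> X t > 0"
    using disconjugate[OF s] by blast
  show ?thesis
    by (rule hill_max_principle[OF hill_on_subset[OF X(1)] _ _ y abs_integrable_subinterval[OF wrap_integrable] t])
      (use s pq X(2) in auto)
qed

text \<open>A zero of a nonnegative function is a minimum, so the derivative vanishes as well. A
  zero at \<open>0\<close> is moved to \<open>T\<close>, which is interior to the doubled interval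
  and allows a two-sided derivative.\<close>

lemma wrap_double_zero:
  assumes u: "periodic_hill_on h u u'" and nn: "\<And>t. t \<in> {0..T} \<Longrightarrow> u t \<ge> 0"
    and z: "t \<in> {0..T}" "u t = 0"
  obtains s where "0 < s" "s \<le> T" "wrap T u s = 0" "wrap T u' s = 0" "u s = 0" "u' s = 0"
proof -
  define s where "s = (if t = 0 then T else t)"
  have s: "0 < s" "s \<le> T" "u s = 0" using z u T_pos by (auto simp: s_def)
  have w: "hill_on (wrap T a) (wrap T h) 0 (2 * T) (wrap T u) (wrap T u')"
    using u T_pos by (intro hill_on_wrap) auto
  have wn: "wrap T u r \<ge> 0" if "r \<in> {0..2 * T}" for r using nn that by (auto simp: wrap_def)
  have ws: "wrap T u s = 0" using s by (simp add: wrap_simps)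
  have "(wrap T u has_real_derivative wrap T u' s) (at s within {0..2 * T})"
    using s by (intro hill_on_deriv[OF w]) auto
  then have "(wrap T u has_real_derivative wrap T u' s) (at s)"
    using s T_pos by (simp add: at_within_Icc_at)
  then have "wrap T u' s = 0"
    by (rule DERIV_local_min[where d="min s T"]) (use s ws wn T_pos in \<open>auto simp: abs_real_def split: if_splits\<close>)
  then show thesis using that s ws by (auto simp: wrap_simps)
qed

text \<open>Self-adjointness of the periodic problem: in Lagrange's identity the boundary terms at
  \<open>0\<close> and at \<open>T\<close> cancel.\<close>

lemma adjoint:
  assumes u: "periodic_hill_on h u u'" and v: "periodic_hill_on k v v'"
    and h: "h absolutely_integrable_on {0..T}" and k: "k absolutely_integrable_on {0..T}"
  shows "integral {0..T} (\<lambda>r. h r * v r) = integral {0..T} (\<lambda>r. k r * u r)"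
proof -
  have "((\<lambda>r. h r * v r - k r * u r) has_integral (u' T * v T - u T * v' T) - (u' 0 * v 0 - u 0 * v' 0)) {0..T}"
    using T_pos
    by (intro hill_lagrange_identity[OF conjunct1[OF u] conjunct1[OF v] _ a_integrable h k]) auto
  then have "((\<lambda>r. h r * v r - k r * u r) has_integral 0) {0..T}" using u v by simp
  moreover have i: "(\<lambda>r. h r * v r) integrable_on {0..T}" "(\<lambda>r. k r * u r) integrable_on {0..T}"
    using u v abs_integrable_mult(1)[OF h, of v] abs_integrable_mult(1)[OF k, of u]
    by (auto simp: absolutely_integrable_on_def dest: hill_on_continuous)
  ultimately show ?thesis
    using has_integral_unique[OF _ has_integral_diff[OF integrable_integral[OF i(1)] integrable_integral[OF i(2)]]]
    by fastforce
qed

text \<open>By continuity \<open>u\<close> is negative near \<open>e\<close> and, after extension,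
  near \<open>e + T\<close>. The remaining closed arc is shorter than \<open>T\<close>, and there
  \<open>- u\<close> is a supersolution with nonnegative end values.\<close>

lemma nonpos_if_negative_somewhere:
  assumes u: "periodic_hill_on h u u'" and h: "\<And>t. t \<in> {0..T} \<Longrightarrow> h t \<ge> 0"
    and e: "e \<in> {0..T}" "u e < 0" and t: "t \<in> {0..T}"
  shows "u t \<le> 0"
proof -
  let ?U = "wrap T u"
  have w: "hill_on (wrap T a) (wrap T h) 0 (2 * T) ?U (wrap T u')"
    using u T_pos by (intro hill_on_wrap) auto
  have Uc: "continuous_on {0..2 * T} ?U" by (rule hill_on_continuous[OF w])
  have Ue: "?U e < 0" "?U (e + T) < 0" using e u by (auto simp: wrap_simps wrap_periodic)
  have "\<exists>d>0. \<forall>r\<in>{0..2 * T}. \<bar>r - s\<bar> < d \<longrightarrow> ?U r < 0" if "s \<in> {0..2 * T}" "?U s < 0" for s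
  proof -
    have "- ?U s > 0" using that(2) by simp
    with Uc[unfolded continuous_on_iff] that(1)
    have "\<exists>d>0. \<forall>r\<in>{0..2 * T}. dist r s < d \<longrightarrow> dist (?U r) (?U s) < - ?U s" by blast
    then obtain d where d: "d > 0" "\<And>r. r \<in> {0..2 * T} \<Longrightarrow> dist r s < d \<Longrightarrow> dist (?U r) (?U s) < - ?U s"
      by blast
    have "?U r < 0" if "r \<in> {0..2 * T}" "\<bar>r - s\<bar> < d" for r
      using d(2)[OF that(1)] that(2) by (auto simp: dist_real_def abs_real_def split: if_splits)
    then show ?thesis using d(1) by blast
  qed
  from this[of e] this[of "e + T"] Ue e T_pos obtain d1 d2 where d: "d1 > 0" "d2 > 0"
    "\<forall>r\<in>{0..2 * T}. \<bar>r - e\<bar> < d1 \<longrightarrow> ?U r < 0" "\<forall>r\<in>{0..2 * T}. \<bar>r - (e + T)\<bar> < d2 \<longrightarrow> ?U r < 0"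
    by auto
  define \<delta> where "\<delta> = min (min d1 d2) T / 3"
  have del: "0 < \<delta>" "\<delta> < d1" "\<delta> < d2" "3 * \<delta> \<le> T" using d T_pos by (auto simp: \<delta>_def min_def)
  have U: "?U r \<le> 0" if r: "r \<in> {e..e + T}" for r
  proof -
    consider "r \<le> e + \<delta>" | "e + T - \<delta> \<le> r" | "r \<in> {e + \<delta>..e + T - \<delta>}" by fastforce
    then show ?thesis
    proof cases
      case 1
      then have "\<bar>r - e\<bar> < d1" "r \<in> {0..2 * T}" using r e del by (auto simp: abs_less_iff)
      then show ?thesis using d(3) by (simp add: less_imp_le)
    next
      case 2
      then have "\<bar>r - (e + T)\<bar> < d2" "r \<in> {0..2 * T}" using r e del by (auto simp: abs_less_iff)
      then show ?thesis using d(4) by (simp add: less_imp_le)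
    next
      case 3
      have "hill_on (wrap T a) (\<lambda>t. - wrap T h t) 0 (2 * T) (\<lambda>t. - ?U t) (\<lambda>t. - wrap T u' t)"
        using hill_on_lincomb[OF w w, of "-1" 0] by simp
      then have m: "hill_on (wrap T a) (\<lambda>t. - wrap T h t) (e + \<delta>) (e + T - \<delta>) (\<lambda>t. - ?U t) (\<lambda>t. - wrap T u' t)"
        by (rule hill_on_subset) (use e del in auto)
      have "- ?U r \<ge> 0"
      proof (rule arc_max_principle[OF e(1) _ _ m _ _ _ 3])
        show "- wrap T h t \<le> 0" if "t \<in> {e + \<delta>..e + T - \<delta>}" for t
          using h[of t] h[of "t - T"] that e del by (auto simp: wrap_def)
        show "0 \<le> - ?U (e + \<delta>)" using bspec[OF d(3), of "e + \<delta>"] e del by auto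
        show "0 \<le> - ?U (e + T - \<delta>)" using bspec[OF d(4), of "e + T - \<delta>"] e del by auto
      qed (use del in auto)
      then show ?thesis by simp
    qed
  qed
  show ?thesis
  proof (cases "e \<le> t")
    case True
    then show ?thesis using U[of t] e t by (auto simp: wrap_simps)
  next
    case False
    then show ?thesis using U[of "t + T"] e t u by (auto simp: wrap_periodic)
  qed
qed

text \<open>A zero is double and therefore spreads to the right. It can be chosen at some
  \<open>s \<le> T\<close>, so the whole second period is reached, including the copy of
  \<open>e\<close>.\<close>

lemma nonneg_supersolution_pos:
  assumes u: "periodic_hill_on h u u'" and h: "\<And>t. t \<in> {0..T} \<Longrightarrow> h t \<le> 0"
    and nn: "\<And>t. t \<in> {0..T} \<Longrightarrow> u t \<ge> 0" and e: "e \<in> {0..T}" "u e \<noteq> 0" and t: "t \<in> {0..T}"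
  shows "u t > 0"
proof (rule ccontr)
  assume "\<not> u t > 0"
  then have "u t = 0" using nn[OF t] by simp
  then obtain s where s: "0 < s" "s \<le> T" "wrap T u s = 0" "wrap T u' s = 0"
    using wrap_double_zero[OF u nn t] by blast
  have w: "hill_on (wrap T a) (wrap T h) 0 (2 * T) (wrap T u) (wrap T u')"
    using u T_pos by (intro hill_on_wrap) auto
  have "wrap T u (e + T) = 0"
  proof (rule hill_on_nonneg_eq_zero[OF hill_on_subset[OF w] abs_integrable_subinterval[OF wrap_integrable] _ _ s(3,4), of "2 * T"])
    show "wrap T u r \<ge> 0" if "r \<in> {s..2 * T}" for r using nn[of r] nn[of "r - T"] that s by (auto simp: wrap_def)
    show "wrap T h r \<le> 0" if "r \<in> {s..2 * T}" for r using h[of r] h[of "r - T"] that s by (auto simp: wrap_def)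
  qed (use s e in auto)
  then show False using e u by (auto simp: wrap_periodic)
qed

text \<open>A nonpositive solution \<open>u \<noteq> 0\<close> would make \<open>-u\<close> a positive supersolution, which is touched from
  below by a multiple of the eigenfunction of the negative eigenvalue.\<close>

lemma no_positive_supersolution:
  assumes u: "periodic_hill_on h u u'" and h: "\<And>t. t \<in> {0..T} \<Longrightarrow> h t \<le> 0"
    and pos: "\<And>t. t \<in> {0..T} \<Longrightarrow> u t > 0"
  shows False
proof -
  obtain l \<psi>0 \<psi>0' where l: "l < 0" and p0: "periodic_hill_on (\<lambda>t. - l * \<psi>0 t) \<psi>0 \<psi>0'" "\<exists>t\<in>{0..T}. \<psi>0 t \<noteq> 0"
    using negative_eigenvalue by blast
  obtain \<psi> \<psi>' where p: "periodic_hill_on (\<lambda>t. - l * \<psi> t) \<psi> \<psi>'" "\<exists>t\<in>{0..T}. \<psi> t > 0"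
  proof (cases "\<exists>t\<in>{0..T}. \<psi>0 t > 0")
    case False
    have "hill_on a (\<lambda>t. - l * (- \<psi>0 t)) 0 T (\<lambda>t. - \<psi>0 t) (\<lambda>t. - \<psi>0' t)"
      using hill_on_lincomb[of a _ 0 T \<psi>0 \<psi>0' _ \<psi>0 \<psi>0' "-1" 0] p0(1) by fastforce
    moreover obtain t where "t \<in> {0..T}" "\<psi>0 t \<noteq> 0" using p0(2) by blast
    then have "\<psi>0 t < 0" using False by force
    then have "\<exists>t\<in>{0..T}. - \<psi>0 t > 0" using \<open>t \<in> {0..T}\<close> by auto
    ultimately show thesis using that[of "\<lambda>t. - \<psi>0 t" "\<lambda>t. - \<psi>0' t"] p0(1) by simp
  qed (use that p0(1) in blast)
  have "continuous_on {0..T} (\<lambda>t. \<psi> t / u t)"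
    using p(1) u pos by (intro continuous_on_divide hill_on_continuous) (auto dest: pos)
  then have "\<exists>s\<in>{0..T}. \<forall>r\<in>{0..T}. \<psi> r / u r \<le> \<psi> s / u s"
    using T_pos by (intro continuous_attains_sup) auto
  then obtain s where s: "s \<in> {0..T}" "\<And>r. r \<in> {0..T} \<Longrightarrow> \<psi> r / u r \<le> \<psi> s / u s" by blast
  \<comment> \<open>The largest value of \<open>\<psi> / u\<close>:
    \<open>\<kappa> * u - \<psi>\<close> is nonnegative and vanishes at \<open>s\<close>.\<close>
  define \<kappa> where "\<kappa> = \<psi> s / u s"
  obtain t where t: "t \<in> {0..T}" "\<psi> t > 0" using p(2) by blast
  have "0 < \<psi> t / u t" using t pos by simp
  then have "\<kappa> > 0" using s(2)[OF t(1)] by (simp add: \<kappa>_def)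
  define z where "z t = \<kappa> * u t + (-1) * \<psi> t" for t
  define z' where "z' t = \<kappa> * u' t + (-1) * \<psi>' t" for t
  define k where "k t = \<kappa> * h t + (-1) * (- l * \<psi> t)" for t
  have z: "periodic_hill_on k z z'"
    using hill_on_lincomb[of a h 0 T u u' "\<lambda>t. - l * \<psi> t" \<psi> \<psi>' \<kappa> "-1"] u p(1)
    unfolding z_def z'_def k_def by auto
  have zn: "z r \<ge> 0" if "r \<in> {0..T}" for r
  proof -
    have "\<psi> r / u r \<le> \<kappa>" using s(2)[OF that] by (simp add: \<kappa>_def)
    then show ?thesis using pos[OF that] by (simp add: z_def pos_divide_le_eq)
  qed
  have "z s = 0" using pos[OF s(1)] by (simp add: z_def \<kappa>_def)
  then obtain r where r: "0 < r" "r \<le> T" "wrap T z r = 0" "wrap T z' r = 0" "z r = 0"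
    using wrap_double_zero[OF z zn s(1)] by blast
  have wz: "hill_on (wrap T a) (wrap T k) 0 (2 * T) (wrap T z) (wrap T z')"
    and wp: "hill_on (wrap T a) (wrap T (\<lambda>t. - l * \<psi> t)) 0 (2 * T) (wrap T \<psi>) (wrap T \<psi>')"
    using z p(1) T_pos by (auto intro!: hill_on_wrap)
  \<comment> \<open>At the contact point \<open>\<psi> = \<kappa> * u > 0\<close>, so
    \<open>\<psi> \<ge> m\<close> nearby, and the right-hand side of the difference is at most
    \<open>l * m < 0\<close> there.\<close>
  define m where "m = \<psi> r / 2"
  have "\<psi> r = \<kappa> * u r" using r(5) by (simp add: z_def)
  then have "m > 0" using \<open>\<kappa> > 0\<close> pos[of r] r by (simp add: m_def)
  have "continuous_on {0..2 * T} (wrap T \<psi>)" by (rule hill_on_continuous[OF wp])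
  moreover have "r \<in> {0..2 * T}" using r by auto
  ultimately obtain d where d: "d > 0" "\<And>q. q \<in> {0..2 * T} \<Longrightarrow> dist q r < d \<Longrightarrow> dist (wrap T \<psi> q) (wrap T \<psi> r) < m"
    using \<open>m > 0\<close> unfolding continuous_on_iff by blast
  define \<delta> where "\<delta> = min d T / 2"
  have del: "0 < \<delta>" "\<delta> < d" "\<delta> < T" using d T_pos by (auto simp: \<delta>_def min_def)
  have psi: "wrap T \<psi> q \<ge> m" if "q \<in> {r..r + \<delta>}" for q
  proof -
    have "dist (wrap T \<psi> q) (wrap T \<psi> r) < m" using d(2)[of q] that r del by (auto simp: dist_real_def)
    then show ?thesis using r by (auto simp: wrap_simps m_def dist_real_def abs_real_def split: if_splits)
  qed
  have kk: "wrap T k q \<le> l * m" if q: "q \<in> {r..r + \<delta>}" for q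
  proof -
    define q' where "q' = (if q \<le> T then q else q - T)"
    have q': "q' \<in> {0..T}" "wrap T k q = k q'" "wrap T \<psi> q = \<psi> q'" using q r del by (auto simp: q'_def wrap_def)
    have "\<kappa> * h q' \<le> 0" using h[OF q'(1)] \<open>\<kappa> > 0\<close> by (simp add: mult_nonneg_nonpos)
    moreover have "l * \<psi> q' \<le> l * m" using psi[OF q] q'(3) l by simp
    ultimately show ?thesis using q'(2) by (simp add: k_def)
  qed
  have "l * m < 0" using l \<open>m > 0\<close> by (simp add: mult_neg_pos)
  have wz': "hill_on (wrap T a) (wrap T k) r (r + \<delta>) (wrap T z) (wrap T z')"
    by (rule hill_on_subset[OF wz]) (use r del in auto)
  have wzn: "wrap T z q \<ge> 0" if "q \<in> {r..r + \<delta>}" for q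
    using zn[of q] zn[of "q - T"] that r del by (auto simp: wrap_def)
  have zero: "wrap T z q = 0" if "q \<in> {r..r + \<delta>}" for q
    by (rule hill_on_nonneg_eq_zero[OF wz' abs_integrable_subinterval[OF wrap_integrable] wzn _ r(3,4) that])
      (use kk \<open>l * m < 0\<close> r del in fastforce)+
  \<comment> \<open>With \<open>z = 0\<close> the equation says that \<open>z'\<close> decreases at
    least at the rate \<open>- l * m > 0\<close>. Integrated once more, this makes \<open>z\<close>
    negative at \<open>r + \<delta>\<close>, a contradiction.\<close>
  have "wrap T z' q \<le> l * m * (q - r)" if q: "q \<in> {r..r + \<delta>}" for q
  proof -
    have "((\<lambda>t. wrap T k t - wrap T a t * wrap T z t) has_integral (wrap T z' q - wrap T z' r)) {r..q}"
      using hill_on_integral[OF wz'] q by auto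
    moreover have "((\<lambda>t. l * m) has_integral l * m * (q - r)) {r..q}"
      using has_integral_const_real[of "l * m" r q] q by (simp add: mult.commute)
    ultimately have "wrap T z' q - wrap T z' r \<le> l * m * (q - r)"
      by (rule has_integral_le) (use zero kk q in auto)
    then show ?thesis using r(4) by simp
  qed
  moreover have "((\<lambda>q. l * m / 2 * (q - r)\<^sup>2) has_real_derivative l * m * (q - r)) (at q within {r..r + \<delta>})" for q
    by (auto intro!: derivative_eq_intros)
  ultimately have "wrap T z (r + \<delta>) - wrap T z r \<le> l * m / 2 * (r + \<delta> - r)\<^sup>2 - l * m / 2 * (r - r)\<^sup>2"
    by (intro increment_le_of_deriv_le[OF hill_on_deriv[OF wz']]) (use del in auto)
  then have "0 \<le> l * m / 2 * \<delta>\<^sup>2" using zero[of "r + \<delta>"] zero[of r] del by simp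
  moreover have "l * m / 2 * \<delta>\<^sup>2 < 0" using \<open>l * m < 0\<close> del by (intro mult_neg_pos) auto
  ultimately show False by linarith
qed

text \<open>A solution that is negative somewhere is nonpositive everywhere, then strictly negative,
  and its negative is a positive supersolution, which the negative eigenvalue excludes.\<close>

theorem periodic_solution_nonneg:
  assumes u: "periodic_hill_on h u u'" and h: "\<And>t. t \<in> {0..T} \<Longrightarrow> h t \<ge> 0" and t: "t \<in> {0..T}"
  shows "u t \<ge> 0"
proof (rule ccontr)
  assume "\<not> u t \<ge> 0"
  then have np: "u r \<le> 0" if "r \<in> {0..T}" for r
    using nonpos_if_negative_somewhere[OF u h t _ that] by simp
  have v: "periodic_hill_on (\<lambda>t. - h t) (\<lambda>t. - u t) (\<lambda>t. - u' t)"
    using hill_on_lincomb[of a h 0 T u u' h u u' "-1" 0] u by auto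
  have "- u r > 0" if "r \<in> {0..T}" for r
    by (rule nonneg_supersolution_pos[OF v _ _ t _ that]) (use h np \<open>\<not> u t \<ge> 0\<close> in auto)
  then show False by (intro no_positive_supersolution[OF v]) (use h in auto)
qed

end

section \<open>The periodic Green's function\<close>

text \<open>Pointwise statements about the continuous kernel are derived from its action on
  indicators of intervals; this lemma removes the indicators again.\<close>

lemma nonneg_of_interval_integrals:
  fixes g :: "real \<Rightarrow> real"
  assumes g: "continuous_on {0..T} g" and "T > 0"
    and int: "\<And>p q. 0 \<le> p \<Longrightarrow> p < q \<Longrightarrow> q \<le> T \<Longrightarrow> integral {p..q} g \<ge> 0"
    and t: "t \<in> {0..T}"
  shows "g t \<ge> 0"
proof (rule ccontr)
  assume "\<not> g t \<ge> 0"
  then have "- g t / 2 > 0" by simp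
  with g t have "\<exists>d>0. \<forall>r\<in>{0..T}. dist r t < d \<longrightarrow> dist (g r) (g t) < - g t / 2"
    unfolding continuous_on_iff by blast
  then obtain d where d: "d > 0" "\<And>r. r \<in> {0..T} \<Longrightarrow> dist r t < d \<Longrightarrow> dist (g r) (g t) < - g t / 2"
    by blast
  define \<delta> where "\<delta> = min d T / 2"
  have del: "0 < \<delta>" "\<delta> < d" "\<delta> \<le> T / 2" using d \<open>T > 0\<close> by (auto simp: \<delta>_def min_def)
  \<comment> \<open>The short interval starts at \<open>t\<close> in the left half of
    \<open>[0, T]\<close> and ends at \<open>t\<close> in the right half, so that it never leaves
    \<open>[0, T]\<close>.\<close>
  define p where "p = (if t \<le> T / 2 then t else t - \<delta>)"
  have p: "0 \<le> p" "p + \<delta> \<le> T" "\<And>r. r \<in> {p..p + \<delta>} \<Longrightarrow> \<bar>r - t\<bar> < d"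
    using t del by (auto simp: p_def abs_less_iff split: if_splits)
  have "integral {p..p + \<delta>} g \<le> integral {p..p + \<delta>} (\<lambda>_. g t / 2)"
  proof (rule integral_le)
    show "g integrable_on {p..p + \<delta>}"
      using p by (intro integrable_continuous_real continuous_on_subset[OF g]) auto
    fix r assume r: "r \<in> {p..p + \<delta>}"
    then have "dist (g r) (g t) < - g t / 2" using d(2)[of r] p by (auto simp: dist_real_def)
    then show "g r \<le> g t / 2" unfolding dist_real_def by linarith
  qed auto
  also have "\<dots> = \<delta> * (g t / 2)" using del by simp
  also have "\<dots> < 0" using del \<open>\<not> g t \<ge> 0\<close> by (intro mult_pos_neg) auto
  finally show False using int[of p "p + \<delta>"] p del by simp
qed

locale stable_hill_green = stable_hill +
  fixes G :: "real \<Rightarrow> real \<Rightarrow> real"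
  assumes green: "periodic_green T a G"
begin

section \<open>Sign and symmetry of the kernel\<close>

definition sol :: "(real \<Rightarrow> real) \<Rightarrow> real \<Rightarrow> real" where
  "sol h t = (LINT s|lebesgue_on {0..T}. G t s * h s)"

abbreviation ind :: "real \<Rightarrow> real \<Rightarrow> real \<Rightarrow> real" where
  "ind p q \<equiv> indicat_real {p..q}"

lemma G_continuous: "continuous_on ({0..T} \<times> {0..T}) (\<lambda>(t, s). G t s)"
  using green by (simp add: periodic_green_def)

lemmas G_continuous_fst = continuous_on_slice_fst[OF G_continuous]
  and G_continuous_snd = continuous_on_slice_snd[OF G_continuous]

lemma sol_solution: "periodic_solution T a h (sol h)" if "h absolutely_integrable_on {0..T}"
  using green that unfolding periodic_green_def sol_def L1_iff_abs_integrable by blast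

lemma sol_hill_on:
  assumes "h absolutely_integrable_on {0..T}"
  obtains u' where "periodic_hill_on h (sol h) u'"
  using hill_on_of_solution[OF sol_solution[OF assms] T_pos] by force

lemma sol_eq_integral:
  assumes "h absolutely_integrable_on {0..T}" "t \<in> {0..T}"
  shows "sol h t = integral {0..T} (\<lambda>s. G t s * h s)" "(\<lambda>s. G t s * h s) absolutely_integrable_on {0..T}"
proof -
  show "(\<lambda>s. G t s * h s) absolutely_integrable_on {0..T}"
    by (intro abs_integrable_mult assms G_continuous_snd)
  then show "sol h t = integral {0..T} (\<lambda>s. G t s * h s)"
    unfolding sol_def by (rule LINT_eq_integral)
qed

lemma ind_integrable: "ind p q absolutely_integrable_on {0..T}"
proof -
  have "integrable (lebesgue_on {0..T}) (ind p q)"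
  proof (rule Bochner_Integration.integrable_bound[where f="\<lambda>_. 1 :: real"])
    show "integrable (lebesgue_on {0..T}) (\<lambda>_. 1 :: real)" by (auto simp: integrable_restrict_space)
    show "ind p q \<in> borel_measurable (lebesgue_on {0..T})"
      by (intro measurable_restrict_space1 borel_measurable_indicator) simp
  qed (auto simp: indicator_def)
  then show ?thesis by (simp add: L1_iff_abs_integrable)
qed

lemma integral_ind:
  fixes g :: "real \<Rightarrow> real"
  assumes "0 \<le> p" "q \<le> T"
  shows "integral {0..T} (\<lambda>s. g s * ind p q s) = integral {p..q} g"
    and "integral {0..T} (\<lambda>s. ind p q s * g s) = integral {p..q} g"
proof -
  have "integral {0..T} (\<lambda>s. g s * ind p q s) = integral {0..T} (\<lambda>s. if s \<in> {p..q} then g s else 0)"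
    by (rule hk_cong) (auto simp: indicator_def)
  also have "\<dots> = integral ({p..q} \<inter> {0..T}) g" by (rule integral_restrict_Int)
  also have "{p..q} \<inter> {0..T} = {p..q}" using assms by auto
  finally show *: "integral {0..T} (\<lambda>s. g s * ind p q s) = integral {p..q} g" .
  then show "integral {0..T} (\<lambda>s. ind p q s * g s) = integral {p..q} g" by (simp add: mult.commute)
qed

lemma sol_ind: "sol (ind p q) t = integral {p..q} (G t)" if "0 \<le> p" "q \<le> T" "t \<in> {0..T}"
  using sol_eq_integral(1)[OF ind_integrable that(3)] integral_ind(1)[OF that(1,2)] by simp

lemma G_nonneg:
  assumes "t \<in> {0..T}" "s \<in> {0..T}"
  shows "G t s \<ge> 0"
proof (rule nonneg_of_interval_integrals[OF G_continuous_snd[OF assms(1)] T_pos _ assms(2)])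
  fix p q assume pq: "0 \<le> p" "p < q" "q \<le> T"
  obtain u' where "periodic_hill_on (ind p q) (sol (ind p q)) u'" by (rule sol_hill_on[OF ind_integrable])
  from periodic_solution_nonneg[OF this _ assms(1)] show "integral {p..q} (G t) \<ge> 0"
    using sol_ind[of p q t] pq assms by simp
qed

lemma adjoint_sol:
  assumes "h absolutely_integrable_on {0..T}" "k absolutely_integrable_on {0..T}"
  shows "integral {0..T} (\<lambda>r. h r * sol k r) = integral {0..T} (\<lambda>r. k r * sol h r)"
proof -
  obtain u' where u': "periodic_hill_on h (sol h) u'" using sol_hill_on[OF assms(1)] by blast
  obtain v' where v': "periodic_hill_on k (sol k) v'" using sol_hill_on[OF assms(2)] by blast
  show ?thesis by (rule adjoint[OF u' v' assms])
qed

lemma sol_continuous: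
  assumes "h absolutely_integrable_on {0..T}"
  shows "continuous_on {0..T} (sol h)"
proof -
  obtain u' where "periodic_hill_on h (sol h) u'" using sol_hill_on[OF assms] by blast
  then show ?thesis by (blast intro: hill_on_continuous)
qed

lemma integral_swap_G:
  assumes "0 \<le> p" "q \<le> T" "0 \<le> p'" "q' \<le> T"
  shows "integral {p..q} (\<lambda>t. integral {p'..q'} (\<lambda>s. G s t)) = integral {p'..q'} (\<lambda>s. integral {p..q} (G s))"
    and "continuous_on {p..q} (\<lambda>t. integral {p'..q'} (\<lambda>s. G s t))"
proof -
  have "continuous_on (cbox (p, p') (q, q')) ((\<lambda>(t, s). G t s) \<circ> (\<lambda>(t, s). (s, t)))"
  proof (rule continuous_on_compose)
    show "continuous_on (cbox (p, p') (q, q')) (\<lambda>(t, s). (s, t))"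
      unfolding case_prod_beta by (intro continuous_intros)
    show "continuous_on ((\<lambda>(t, s). (s, t)) ` cbox (p, p') (q, q')) (\<lambda>(t, s). G t s)"
      by (rule continuous_on_subset[OF G_continuous]) (use assms in \<open>auto simp: cbox_Pair_eq\<close>)
  qed
  then have c: "continuous_on (cbox (p, p') (q, q')) (\<lambda>(t, s). G s t)"
    by (simp add: o_def case_prod_unfold)
  from integral_swap_continuous[OF c]
  show "integral {p..q} (\<lambda>t. integral {p'..q'} (\<lambda>s. G s t)) = integral {p'..q'} (\<lambda>s. integral {p..q} (G s))"
    by simp
  have "continuous_on (cbox p q \<times> cbox p' q') (\<lambda>(t, s). G s t)" using c by (simp add: cbox_Pair_eq)
  then show "continuous_on {p..q} (\<lambda>t. integral {p'..q'} (\<lambda>s. G s t))"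
    using integral_continuous_on_param[of "{p..q}" p' q' "\<lambda>t s. G s t"] by simp
qed

text \<open>Adjointness for two indicators, together with interchanging integrals, says that
  \<open>G t s - G s t\<close> has integral zero over every rectangle. The indicators are removed
  one variable at a time; the factor \<open>e\<close>, later \<open>1\<close> and \<open>-1\<close>,
  provides both inequalities at once.\<close>

lemma G_symmetric_le:
  assumes st: "s \<in> {0..T}" "t \<in> {0..T}"
  shows "e * (G t s - G s t) \<ge> 0"
proof -
  have J: "e * (integral {p..q} (G r) - integral {p..q} (\<lambda>s. G s r)) \<ge> 0"
    if pq: "0 \<le> p" "p < q" "q \<le> T" and r: "r \<in> {0..T}" for p q r
  proof (rule nonneg_of_interval_integrals[OF _ T_pos _ r])
    have c1: "continuous_on {0..T} (\<lambda>r. integral {p..q} (G r))"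
      by (rule continuous_on_eq[OF sol_continuous[OF ind_integrable, of p q]]) (use sol_ind[of p q] pq in auto)
    have c2: "continuous_on {0..T} (\<lambda>r. integral {p..q} (\<lambda>s. G s r))"
      by (rule integral_swap_G(2)) (use pq in auto)
    show "continuous_on {0..T} (\<lambda>r. e * (integral {p..q} (G r) - integral {p..q} (\<lambda>s. G s r)))"
      by (intro continuous_intros c1 c2)
    fix p' q' assume pq': "0 \<le> p'" "p' < q'" "q' \<le> T"
    have i: "(\<lambda>r. integral {p..q} (G r)) integrable_on {p'..q'}" "(\<lambda>r. integral {p..q} (\<lambda>s. G s r)) integrable_on {p'..q'}"
      using pq' by (auto intro!: integrable_continuous_real continuous_on_subset[OF c1] continuous_on_subset[OF c2])
    have "integral {p'..q'} (\<lambda>r. integral {p..q} (G r)) = integral {p'..q'} (sol (ind p q))"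
      by (rule hk_cong) (use sol_ind[of p q] pq pq' in auto)
    also have "\<dots> = integral {p..q} (sol (ind p' q'))"
      using adjoint_sol[OF ind_integrable ind_integrable, of p' q' p q] integral_ind(2) pq pq' by simp
    also have "\<dots> = integral {p..q} (\<lambda>s. integral {p'..q'} (G s))"
      by (rule hk_cong) (use sol_ind[of p' q'] pq pq' in auto)
    also have "\<dots> = integral {p'..q'} (\<lambda>r. integral {p..q} (\<lambda>s. G s r))"
      by (rule integral_swap_G(1)[symmetric]) (use pq pq' in auto)
    finally show "integral {p'..q'} (\<lambda>r. e * (integral {p..q} (G r) - integral {p..q} (\<lambda>s. G s r))) \<ge> 0"
      using i by (simp add: hk_diff)
  qed
  show ?thesis
  proof (rule nonneg_of_interval_integrals[OF _ T_pos _ st(1), of "\<lambda>s. e * (G t s - G s t)"])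
    show "continuous_on {0..T} (\<lambda>s. e * (G t s - G s t))"
      by (intro continuous_intros G_continuous_fst G_continuous_snd st)
    fix p q assume pq: "0 \<le> p" "p < q" "q \<le> T"
    have "G t integrable_on {p..q}" "(\<lambda>s. G s t) integrable_on {p..q}"
      using pq by (auto intro!: integrable_continuous_real continuous_on_subset[OF G_continuous_fst]
         continuous_on_subset[OF G_continuous_snd] st)
    then show "integral {p..q} (\<lambda>s. e * (G t s - G s t)) \<ge> 0"
      using J[OF pq st(2)] by (simp add: hk_diff)
  qed
qed

lemma G_symmetric: "G t s = G s t" if "s \<in> {0..T}" "t \<in> {0..T}"
  using G_symmetric_le[OF that, of 1] G_symmetric_le[OF that, of "-1"] by simp

lemma sol_nonneg:
  assumes "h absolutely_integrable_on {0..T}" "\<And>s. s \<in> {0..T} \<Longrightarrow> h s \<ge> 0" "t \<in> {0..T}"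
  shows "sol h t \<ge> 0"
  unfolding sol_eq_integral(1)[OF assms(1,3)] using sol_eq_integral(2)[OF assms(1,3)]
  by (intro integral_nonneg) (auto simp: absolutely_integrable_on_def intro!: mult_nonneg_nonneg assms G_nonneg)

text \<open>At a zero \<open>s\<close> the solution with right-hand side \<open>ind c d\<close> and its derivative vanish, and again at
  \<open>s + T\<close>. Lagrange's identity then makes \<open>ind c d\<close> orthogonal to a solution of the homogeneous
  equation that is positive between \<open>s\<close> and \<open>s + T\<close>.\<close>

lemma sol_ind_pos:
  assumes cd: "0 \<le> c" "c < d" "d \<le> T" and t: "t \<in> {0..T}"
  shows "sol (ind c d) t > 0"
proof (rule ccontr)
  define v where "v = sol (ind c d)"
  obtain v' where v: "periodic_hill_on (ind c d) v v'" unfolding v_def by (rule sol_hill_on[OF ind_integrable])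
  have vn: "v r \<ge> 0" if "r \<in> {0..T}" for r unfolding v_def by (rule sol_nonneg[OF ind_integrable _ that]) auto
  assume "\<not> sol (ind c d) t > 0"
  then have "v t = 0" using vn[OF t] by (simp add: v_def)
  then obtain s where s: "0 < s" "s \<le> T" "v s = 0" "v' s = 0" using wrap_double_zero[OF v vn t] by blast
  obtain y y' where y: "hill_on (wrap T a) (\<lambda>_. 0) 0 (2 * T) y y'" and yp: "\<And>t. s < t \<Longrightarrow> t < s + T \<Longrightarrow> y t > 0"
    and ys: "y s = 0"
    using disconjugate[of s] s by auto
  have w: "hill_on (wrap T a) (wrap T (ind c d)) 0 (2 * T) (wrap T v) (wrap T v')"
    using v T_pos by (intro hill_on_wrap) auto
  have k: "wrap T (ind c d) absolutely_integrable_on {s..s + T}"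
    by (rule abs_integrable_subinterval[OF absolutely_integrable_wrap[OF ind_integrable T_pos]]) (use s in auto)
  have "((\<lambda>r. wrap T (ind c d) r * y r - 0 * wrap T v r) has_integral
     (wrap T v' (s + T) * y (s + T) - wrap T v (s + T) * y' (s + T)) - (wrap T v' s * y s - wrap T v s * y' s)) {s..s + T}"
    using s T_pos
    by (intro hill_lagrange_identity[OF hill_on_subset[OF w] hill_on_subset[OF y] _
          abs_integrable_subinterval[OF wrap_integrable] k]) auto
  then have I: "((\<lambda>r. wrap T (ind c d) r * y r) has_integral 0) {s..s + T}"
    using s by (simp add: wrap_simps)
  have yc: "continuous_on {s..s + T} y" by (rule continuous_on_subset[OF hill_on_continuous[OF y]]) (use s in auto)
  \<comment> \<open>An interval strictly inside the arc on which the extended indicator is 1. If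
    \<open>s < d\<close>, it is the right half of the part of \<open>[c, d]\<close> beyond
    \<open>s\<close>; otherwise it is the middle third of the copy of \<open>[c, d]\<close> in the
    second period.\<close>
  have "\<exists>p q. s < p \<and> p < q \<and> q < s + T \<and> (\<forall>r\<in>{p..q}. wrap T (ind c d) r = 1)"
  proof (cases "s < d")
    case True
    then show ?thesis using cd s
      by (intro exI[of _ "(max s c + d) / 2"] exI[of _ d])
        (auto simp: wrap_def indicator_def max_def field_simps)
  next
    case False
    then show ?thesis using cd s
      by (intro exI[of _ "c + T + (d - c) / 3"] exI[of _ "c + T + 2 * (d - c) / 3"])
        (auto simp: wrap_def indicator_def field_simps)
  qed
  then obtain p q where pq: "s < p" "p < q" "q < s + T" "\<And>r. r \<in> {p..q} \<Longrightarrow> wrap T (ind c d) r = 1"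
    by blast
  have "\<exists>z\<in>{p..q}. \<forall>r\<in>{p..q}. y z \<le> y r"
    using pq by (intro continuous_attains_inf continuous_on_subset[OF yc]) auto
  then obtain z where z: "z \<in> {p..q}" "\<And>r. r \<in> {p..q} \<Longrightarrow> y z \<le> y r" by blast
  have "y z > 0" using yp z pq by auto
  have "(q - p) * y z = integral {p..q} (\<lambda>_. y z)" using pq by simp
  also have "\<dots> \<le> integral {p..q} (\<lambda>r. wrap T (ind c d) r * y r)"
  proof (rule integral_le)
    show "(\<lambda>r. wrap T (ind c d) r * y r) integrable_on {p..q}"
      using has_integral_integrable[OF I] pq by (auto intro: integrable_on_subinterval)
  qed (use pq z in auto)
  also have "\<dots> \<le> integral {s..s + T} (\<lambda>r. wrap T (ind c d) r * y r)"
  proof (rule integral_subset_le)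
    show "(\<lambda>r. wrap T (ind c d) r * y r) integrable_on {p..q}"
      using has_integral_integrable[OF I] pq by (auto intro: integrable_on_subinterval)
    show "(\<lambda>r. wrap T (ind c d) r * y r) integrable_on {s..s + T}" by (rule has_integral_integrable[OF I])
    \<comment> \<open>Positivity is known on the open arc only; at \<open>s + T\<close> a negative
      value would force an earlier zero.\<close>
    have "y r \<ge> 0" if "r \<in> {s..s + T}" for r
    proof -
      have "y (s + T) \<ge> 0"
      proof (rule ccontr)
        assume neg: "\<not> y (s + T) \<ge> 0"
        have "continuous_on {q..s + T} y" using pq by (intro continuous_on_subset[OF yc]) auto
        then obtain x where "q \<le> x" "x \<le> s + T" "y x = 0"
          using IVT2'[of y "s + T" 0 q] neg yp[of q] pq by auto
        then show False using yp[of x] neg pq by (cases "x = s + T") auto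
      qed
      then show ?thesis using that yp[of r] ys by (cases "r = s \<or> r = s + T") (auto intro: less_imp_le)
    qed
    then show "\<forall>r\<in>{s..s + T}. 0 \<le> wrap T (ind c d) r * y r" by (auto simp: wrap_def)
  qed (use pq in auto)
  also have "\<dots> = 0" by (rule integral_unique[OF I])
  finally have "(q - p) * y z \<le> 0" .
  moreover have "(q - p) * y z > 0" using \<open>y z > 0\<close> pq by (intro mult_pos_pos) auto
  ultimately show False by simp
qed

text \<open>Outside \<open>[c, d]\<close> the function \<open>M v - m G(\<cdot>, t)\<close> with \<open>v = sol (ind c d)\<close> is a supersolution, and it is
  nonnegative on \<open>[c, d]\<close>; the complementary arc is shorter than \<open>T\<close>. The Dirac mass is replaced by
  indicators of intervals.\<close>

lemma G_le_sol_ind: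
  assumes cd: "0 \<le> c" "c < d" "d \<le> T" and "m \<ge> 0"
    and m: "\<And>s. s \<in> {c..d} \<Longrightarrow> m \<le> sol (ind c d) s"
    and M: "\<And>t s. t \<in> {0..T} \<Longrightarrow> s \<in> {0..T} \<Longrightarrow> G t s \<le> M"
    and st: "s \<in> {0..T}" "t \<in> {0..T}"
  shows "m * G s t \<le> M * sol (ind c d) s"
proof -
  have "0 \<in> {0..T}" using T_pos by simp
  then have "M \<ge> 0" using G_nonneg[of 0 0] M[of 0 0] by linarith
  have "M * sol (ind c d) s - m * G s t \<ge> 0"
  proof (rule nonneg_of_interval_integrals[OF _ T_pos _ st(2), of "\<lambda>t. M * sol (ind c d) s - m * G s t"])
    show "continuous_on {0..T} (\<lambda>t. M * sol (ind c d) s - m * G s t)"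
      by (intro continuous_intros G_continuous_snd st)
    fix p q assume pq: "0 \<le> p" "p < q" "q \<le> T"
    \<comment> \<open>The integral over \<open>t\<close> in \<open>[p, q]\<close> of
      \<open>M * v - m * G r t\<close>, where \<open>v = sol (ind c d)\<close>, as a function of
      \<open>r\<close>; unlike the integrand it solves an equation with integrable right-hand
      side.\<close>
    define w where "w r = ((q - p) * M) * sol (ind c d) r + (- m) * sol (ind p q) r" for r
    define k where "k r = ((q - p) * M) * ind c d r + (- m) * ind p q r" for r
    obtain u' where u': "periodic_hill_on (ind c d) (sol (ind c d)) u'" by (rule sol_hill_on[OF ind_integrable])
    obtain v' where v': "periodic_hill_on (ind p q) (sol (ind p q)) v'" by (rule sol_hill_on[OF ind_integrable])
    define w' where "w' r = ((q - p) * M) * u' r + (- m) * v' r" for r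
    have w: "periodic_hill_on k w w'"
      using hill_on_lincomb[OF conjunct1[OF u'] conjunct1[OF v'], of "(q - p) * M" "- m"] u' v'
      unfolding k_def w_def w'_def by simp
    have W: "hill_on (wrap T a) (wrap T k) 0 (2 * T) (wrap T w) (wrap T w')"
      using w T_pos by (intro hill_on_wrap) auto
    have inner: "w r \<ge> 0" if r: "r \<in> {c..d}" for r
    proof -
      have r0: "r \<in> {0..T}" using r cd by auto
      have "sol (ind p q) r = integral {p..q} (G r)" by (rule sol_ind) (use pq r0 in auto)
      also have "\<dots> \<le> integral {p..q} (\<lambda>_. M)"
        using pq r0 M by (intro integral_le integrable_continuous_real continuous_on_subset[OF G_continuous_snd[OF r0]]) auto
      also have "\<dots> = (q - p) * M" using pq by simp
      finally have "m * sol (ind p q) r \<le> m * ((q - p) * M)" using \<open>m \<ge> 0\<close> by (rule mult_left_mono)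
      moreover have "((q - p) * M) * m \<le> ((q - p) * M) * sol (ind c d) r"
        using m[OF r] pq \<open>M \<ge> 0\<close> by (intro mult_left_mono) auto
      ultimately show ?thesis by (simp add: w_def mult.commute)
    qed
    have ends: "wrap T w d \<ge> 0" "wrap T w (c + T) \<ge> 0"
      using inner[of d] inner[of c] cd w by (auto simp: wrap_simps wrap_periodic)
    \<comment> \<open>At the end points of the closed arc the extended indicator of
      \<open>[c, d]\<close> is still 1 and may make the right-hand side positive; resetting these
      two values leaves the integrated equation intact.\<close>
    define k' where "k' r = (if r \<in> {d, c + T} then 0 else wrap T k r)" for r
    have W': "hill_on (wrap T a) k' d (c + T) (wrap T w) (wrap T w')"
      by (rule hill_on_spike[OF hill_on_subset[OF W], of _ _ "{d, c + T}"]) (use cd in \<open>auto simp: k'_def\<close>)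
    have k'_le: "k' r \<le> 0" if "r \<in> {d..c + T}" for r
      using that cd \<open>m \<ge> 0\<close> by (auto simp: k'_def k_def wrap_def indicator_def)
    \<comment> \<open>The disconjugacy arc starts at the midpoint of \<open>[c, d]\<close>, so that
      \<open>[d, c + T]\<close> lies strictly inside it.\<close>
    have outer: "wrap T w r \<ge> 0" if "r \<in> {d..c + T}" for r
      by (rule arc_max_principle[OF _ _ _ W' k'_le ends that, of "(c + d) / 2"]) (use cd in auto)
    have "w s \<ge> 0"
    proof (cases "s \<in> {c..d}")
      case False
      then show ?thesis using outer[of s] outer[of "s + T"] st w cd by (auto simp: wrap_simps wrap_periodic not_le)
    qed (rule inner)
    moreover have "integral {p..q} (\<lambda>t. M * sol (ind c d) s - m * G s t) = w s"
    proof -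
      have "G s integrable_on {p..q}"
        using pq by (intro integrable_continuous_real continuous_on_subset[OF G_continuous_snd[OF st(1)]]) auto
      then have "integral {p..q} (\<lambda>t. M * sol (ind c d) s - m * G s t)
          = integral {p..q} (\<lambda>t. M * sol (ind c d) s) - integral {p..q} (\<lambda>t. m * G s t)"
        by (intro hk_diff integrable_on_mult_right) auto
      then show ?thesis using pq sol_ind[of p q s] st by (simp add: w_def mult.assoc)
    qed
    ultimately show "integral {p..q} (\<lambda>t. M * sol (ind c d) s - m * G s t) \<ge> 0" by simp
  qed
  then show ?thesis by simp
qed

text \<open>By symmetry the kernel estimate reads \<open>m * G t s \<le> M * v s\<close> with
  \<open>v = sol (ind c d)\<close>. Integrated against \<open>h\<close> it produces the integral of
  \<open>h * v\<close>, which by adjointness is the integral of \<open>sol h\<close> over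
  \<open>[c, d]\<close>.\<close>

lemma sol_le_integral:
  assumes cd: "0 \<le> c" "c < d" "d \<le> T" and "m \<ge> 0"
    and m: "\<And>s. s \<in> {c..d} \<Longrightarrow> m \<le> sol (ind c d) s"
    and M: "\<And>t s. t \<in> {0..T} \<Longrightarrow> s \<in> {0..T} \<Longrightarrow> G t s \<le> M"
    and h: "h absolutely_integrable_on {0..T}" "\<And>s. s \<in> {0..T} \<Longrightarrow> h s \<ge> 0" and t: "t \<in> {0..T}"
  shows "m * sol h t \<le> M * integral {0..T} (sol h)"
proof -
  have "0 \<in> {0..T}" using T_pos by simp
  then have "M \<ge> 0" using G_nonneg[of 0 0] M[of 0 0] by linarith
  have hv: "(\<lambda>s. h s * sol (ind c d) s) absolutely_integrable_on {0..T}"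
    by (intro abs_integrable_mult h(1) sol_continuous ind_integrable)
  have "m * sol h t = integral {0..T} (\<lambda>s. m * (G t s * h s))"
    by (simp add: sol_eq_integral(1)[OF h(1) t])
  also have "\<dots> \<le> integral {0..T} (\<lambda>s. M * (h s * sol (ind c d) s))"
  proof (rule integral_le)
    fix s assume s: "s \<in> {0..T}"
    have "m * G t s * h s \<le> M * sol (ind c d) s * h s"
      using G_le_sol_ind[OF cd \<open>m \<ge> 0\<close> m M s t] G_symmetric[OF s t] h(2)[OF s] by (intro mult_right_mono) auto
    then show "m * (G t s * h s) \<le> M * (h s * sol (ind c d) s)" by (simp add: ac_simps)
  qed (use hv sol_eq_integral(2)[OF h(1) t] in \<open>auto simp: absolutely_integrable_on_def intro!: integrable_on_mult_right\<close>)
  also have "\<dots> = M * integral {c..d} (sol h)"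
    using adjoint_sol[OF h(1) ind_integrable, of c d] integral_ind(2)[OF cd(1,3)] by simp
  also have "\<dots> \<le> M * integral {0..T} (sol h)"
  proof (intro mult_left_mono integral_subset_le \<open>M \<ge> 0\<close>)
    show "sol h integrable_on {c..d}" "sol h integrable_on {0..T}"
      using cd by (auto intro!: integrable_continuous_real continuous_on_subset[OF sol_continuous[OF h(1)]])
  qed (use cd sol_nonneg[OF h] in auto)
  finally show ?thesis .
qed

end

section \<open>Existence of a positive solution\<close>

text \<open>Trace \<open>-2\<close> and determinant 1 make \<open>-1\<close> an eigenvalue of the
  monodromy matrix, and an eigenvector gives the initial data of an antiperiodic solution. So the
  trace avoids \<open>-2\<close> at all negative parameters, which is what disconjugacy
  requires.\<close>

lemma stable_hill_of_eigenvalues: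
  assumes "T > 0" and a: "a absolutely_integrable_on {0..T}"
    and antiper: "\<And>l. hill_eigenvalue (-1) T a l \<Longrightarrow> 0 \<le> l"
    and per: "hill_eigenvalue 1 T a lP" "lP < 0"
  shows "stable_hill T a"
proof -
  interpret periodic_hill T "wrap T a"
    by unfold_locales (use \<open>T > 0\<close> a in \<open>auto simp: absolutely_integrable_wrap wrap_simps\<close>)
  obtain u u' v v' where "hill_fundamental T (wrap T a) u u' v v'" using ex_hill_fundamental by blast
  then interpret hill_fundamental T "wrap T a" u u' v v' .
  have no: "u l T + v' l T \<noteq> -2" if "l < 0" for l
  proof
    assume tr: "u l T + v' l T = -2"
    have "u l T * v' l T - u' l T * v l T = 1" using wronskian[of T l] \<open>T > 0\<close> by simp
    then have "(u l T + 1) * (v' l T + 1) - v l T * u' l T = 0" using tr by (simp add: algebra_simps)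
    then obtain c e where ce: "(c, e) \<noteq> (0, 0)" "(u l T + 1) * c + v l T * e = 0" "u' l T * c + (v' l T + 1) * e = 0"
      by (rule singular_matrix2_kernel)
    define x where "x = (\<lambda>t. c * u l t + e * v l t)"
    define x' where "x' = (\<lambda>t. c * u' l t + e * v' l t)"
    have "hill_on (\<lambda>t. wrap T a t + l) (\<lambda>_. 0) 0 T x x'"
      unfolding x_def x'_def by (rule hill_on_subset[OF hill_on_comb]) (use \<open>T > 0\<close> in auto)
    then have x: "hill_on (\<lambda>t. a t + l) (\<lambda>_. 0) 0 T x x'"
      by (rule hill_on_cong) (auto simp: wrap_simps)
    have "hill_solution (-1) T (\<lambda>t. a t + l) (\<lambda>_. 0) x"
    proof (rule solution_of_hill_on[OF x])
      show "(\<lambda>t. a t + l) absolutely_integrable_on {0..T}"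
        by (intro set_integral_add a absolutely_integrable_on_const) auto
    qed (use ce in \<open>auto simp: x_def x'_def init algebra_simps\<close>)
    moreover have "\<exists>t\<in>{0..T}. x t \<noteq> 0"
    proof (cases "c = 0")
      case False
      then show ?thesis using \<open>T > 0\<close> by (intro bexI[of _ 0]) (auto simp: x_def init)
    next
      case True
      have "(v l has_real_derivative 1) (at 0 within {0..2 * T})"
        using hill_on_deriv[OF v, of 0 l] \<open>T > 0\<close> by (simp add: init)
      from has_real_derivative_pos_inc_right[OF this] obtain d where d: "d > 0"
        "\<And>h. h > 0 \<Longrightarrow> 0 + h \<in> {0..2 * T} \<Longrightarrow> h < d \<Longrightarrow> v l 0 < v l (0 + h)" by auto
      define t where "t = min d T / 2"
      have "0 < t" "t < d" "t \<le> T" using d \<open>T > 0\<close> by (auto simp: t_def min_def)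
      then have "v l t > 0" using d(2)[of t] \<open>T > 0\<close> by (simp add: init)
      then show ?thesis using True ce(1) \<open>0 < t\<close> \<open>t \<le> T\<close> by (intro bexI[of _ t]) (auto simp: x_def)
    qed
    ultimately have "hill_eigenvalue (-1) T a l" unfolding hill_eigenvalue_def by blast
    then show False using antiper \<open>l < 0\<close> by force
  qed
  show ?thesis
  proof
    fix s assume s: "s \<in> {0..T}"
    have "hill_on (wrap T a) (\<lambda>_. 0) 0 (2 * T) (y 0 s) (y' 0 s)"
      using hill_on_y[of 0 s] by simp
    moreover have "y 0 s s = 0" "y' 0 s s = 1" using y_init[of s 0] s \<open>T > 0\<close> by auto
    ultimately show "\<exists>y y'. hill_on (wrap T a) (\<lambda>_. 0) 0 (2 * T) y y' \<and>
          y s = 0 \<and> y' s = 1 \<and> (\<forall>t. s < t \<longrightarrow> t < s + T \<longrightarrow> y t > 0)"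
      using y_positive_of_trace[OF no s] by blast
  next
    obtain \<psi> where psi: "hill_solution 1 T (\<lambda>t. a t + lP) (\<lambda>_. 0) \<psi>" "\<exists>t\<in>{0..T}. \<psi> t \<noteq> 0"
      using per(1) unfolding hill_eigenvalue_def by blast
    obtain \<psi>' where psi': "hill_on (\<lambda>t. a t + lP) (\<lambda>_. 0) 0 T \<psi> \<psi>'" "\<psi> 0 = \<psi> T" "\<psi>' 0 = \<psi>' T"
      using hill_on_of_solution[OF psi(1) \<open>T > 0\<close>] by auto
    have "hill_on a (\<lambda>t. - lP * \<psi> t) 0 T \<psi> \<psi>'"
      by (rule hill_on_cong[OF psi'(1)]) (auto simp: algebra_simps)
    then show "\<exists>l \<psi> \<psi>'. l < 0 \<and> hill_on a (\<lambda>t. - l * \<psi> t) 0 T \<psi> \<psi>' \<and>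
          \<psi> 0 = \<psi> T \<and> \<psi>' 0 = \<psi>' T \<and> (\<exists>t\<in>{0..T}. \<psi> t \<noteq> 0)"
      using psi(2) psi'(2,3) per(2) by blast
  qed (use \<open>T > 0\<close> a in auto)
qed

section \<open>Continuity of suprema and the two growth conditions\<close>

lemma SUP_le_SUP_add:
  fixes v w :: "'a \<Rightarrow> real"
  assumes "A \<noteq> {}" "bdd_above (w ` A)" "\<And>t. t \<in> A \<Longrightarrow> v t \<le> w t + e"
  shows "(SUP t\<in>A. v t) \<le> (SUP t\<in>A. w t) + e"
proof (rule cSUP_least[OF assms(1)])
  fix t assume t: "t \<in> A"
  then show "v t \<le> (SUP t\<in>A. w t) + e" using assms(3)[OF t] cSUP_upper[OF t assms(2)] by linarith
qed

lemma tendsto_SUP_uniform_limit: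
  fixes W :: "nat \<Rightarrow> 'a \<Rightarrow> real"
  assumes "A \<noteq> {}" and W: "\<And>n t. t \<in> A \<Longrightarrow> W n t \<le> R" and w: "\<And>t. t \<in> A \<Longrightarrow> w t \<le> R"
    and ul: "uniform_limit A W w sequentially"
  shows "(\<lambda>n. SUP t\<in>A. W n t) \<longlonglongrightarrow> (SUP t\<in>A. w t)"
proof (rule tendstoI)
  fix e :: real assume "e > 0"
  then have "\<forall>\<^sub>F n in sequentially. \<forall>t\<in>A. dist (W n t) (w t) < e / 2"
    by (intro uniform_limitD[OF ul]) auto
  then show "\<forall>\<^sub>F n in sequentially. dist (SUP t\<in>A. W n t) (SUP t\<in>A. w t) < e"
  proof eventually_elim
    case (elim n)
    have "W n t \<le> w t + e / 2" "w t \<le> W n t + e / 2" if "t \<in> A" for t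
      using bspec[OF elim that] unfolding dist_real_def by linarith+
    then have "(SUP t\<in>A. W n t) \<le> (SUP t\<in>A. w t) + e / 2" "(SUP t\<in>A. w t) \<le> (SUP t\<in>A. W n t) + e / 2"
      using W w by (auto intro!: SUP_le_SUP_add assms(1) bdd_aboveI2[where M=R])
    then show ?case using \<open>e > 0\<close> unfolding dist_real_def by linarith
  qed
qed

lemma superlinear_at_0D:
  fixes f :: "real \<Rightarrow> real \<Rightarrow> real"
  assumes "((\<lambda>x. INF t\<in>A. ereal (f t x / x)) \<longlongrightarrow> \<infinity>) (at_right 0)"
  obtains \<delta> where "\<delta> > 0" "\<And>t x. t \<in> A \<Longrightarrow> 0 < x \<Longrightarrow> x < \<delta> \<Longrightarrow> B * x \<le> f t x"
proof -
  have "\<forall>\<^sub>F x in at_right 0. ereal B < (INF t\<in>A. ereal (f t x / x))"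
    using assms by (rule order_tendstoD) simp
  then obtain \<delta> where d: "\<delta> > 0" "\<And>x. x > 0 \<Longrightarrow> x < \<delta> \<Longrightarrow> ereal B < (INF t\<in>A. ereal (f t x / x))"
    unfolding eventually_at_right_field by auto
  show thesis
  proof (rule that[OF d(1)])
    fix t x assume "t \<in> A" "0 < x" "x < \<delta>"
    then have "ereal B < ereal (f t x / x)" using d(2)[of x] by (meson INF_lower less_le_trans)
    then show "B * x \<le> f t x" using \<open>0 < x\<close> by (simp add: pos_less_divide_eq less_imp_le)
  qed
qed

lemma sublinear_at_topD:
  fixes f :: "real \<Rightarrow> real \<Rightarrow> real"
  assumes "((\<lambda>x. SUP t\<in>A. ereal (f t x / x)) \<longlongrightarrow> 0) at_top" "\<epsilon> > 0"
  obtains X where "X > 0" "\<And>t x. t \<in> A \<Longrightarrow> X \<le> x \<Longrightarrow> f t x \<le> \<epsilon> * x"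
proof -
  have "\<forall>\<^sub>F x in at_top. (SUP t\<in>A. ereal (f t x / x)) < ereal \<epsilon>"
    using assms(1) by (rule order_tendstoD) (use assms(2) in simp)
  then obtain X where X: "\<And>x. x \<ge> X \<Longrightarrow> (SUP t\<in>A. ereal (f t x / x)) < ereal \<epsilon>"
    unfolding eventually_at_top_linorder by blast
  show thesis
  proof (rule that[of "max X 1"])
    fix t x assume "t \<in> A" "max X 1 \<le> x"
    then have "ereal (f t x / x) < ereal \<epsilon>" using X[of x] by (meson SUP_upper le_less_trans max.boundedE)
    then show "f t x \<le> \<epsilon> * x" using \<open>max X 1 \<le> x\<close> by (simp add: pos_divide_less_eq less_imp_le)
  qed simp
qed

text \<open>The nonlinearity is perturbed by \<open>max 0 (\<delta> - sup w)\<close>, which keeps the trivial function from being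
  a fixed point. Superlinearity at zero on \<open>[c, d]\<close> rules out fixed points with supremum below \<open>\<delta>\<close>,
  and on all others the perturbation vanishes.\<close>

context stable_hill_green
begin

lemma ex_positive_fixed_point:
  assumes cd: "0 \<le> c" "c < d" "d \<le> T" and "m > 0" "M > 0"
    and m: "\<And>s. s \<in> {c..d} \<Longrightarrow> m \<le> sol (ind c d) s"
    and M: "\<And>t s. t \<in> {0..T} \<Longrightarrow> s \<in> {0..T} \<Longrightarrow> G t s \<le> M"
    and f_nonneg: "\<And>t x. t \<in> {0..T} \<Longrightarrow> x \<ge> 0 \<Longrightarrow> f t x \<ge> 0"
    and f_meas: "\<And>x. x \<ge> 0 \<Longrightarrow> (\<lambda>t. f t x) \<in> borel_measurable (lebesgue_on {0..T})"
    and f_cont: "\<And>t. t \<in> {0..T} \<Longrightarrow> continuous_on {0..} (f t)"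
    and f_bound: "\<And>r. r > 0 \<Longrightarrow> \<exists>\<phi>. L1 T \<phi> \<and> (AE t in lebesgue_on {0..T}. \<forall>x\<in>{0..r}. f t x \<le> \<phi> t)"
    and \<delta>: "\<delta> > 0" and f_zero: "AE t in lebesgue_on {0..T}. t \<in> {c..d} \<longrightarrow> (\<forall>x. 0 < x \<longrightarrow> x < \<delta> \<longrightarrow> 2 / m * x \<le> f t x)"
    and X: "X > 0" and f_top: "\<And>t x. t \<in> {0..T} \<Longrightarrow> X \<le> x \<Longrightarrow> f t x \<le> 1 / (2 * M * T) * x"
  shows "\<exists>u. (\<forall>t\<in>{0..T}. u t \<ge> 0) \<and> (\<exists>t\<in>{0..T}. u t \<noteq> 0) \<and> (\<lambda>t. f t (u t)) absolutely_integrable_on {0..T} \<and>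
      (\<forall>t\<in>{0..T}. u t = sol (\<lambda>s. f s (u s)) t)"
proof -
  let ?M = "lebesgue_on {0..T}"
  define \<epsilon> where "\<epsilon> = 1 / (2 * M * T)"
  have "\<epsilon> > 0" using \<open>M > 0\<close> T_pos by (simp add: \<epsilon>_def)
  obtain \<phi> where phi: "L1 T \<phi>" "AE t in ?M. \<forall>x\<in>{0..X}. f t x \<le> \<phi> t" using f_bound[OF X] by blast
  have aeI: "AE t in ?M. t \<in> {0..T}" using AE_space[of ?M] by simp
  have phi0: "AE t in ?M. 0 \<le> \<phi> t"
    using phi(2) aeI
  proof eventually_elim
    case (elim t)
    then have "f t 0 \<le> \<phi> t" using X by auto
    then show ?case using f_nonneg[OF elim(2), of 0] by linarith
  qed
  have growth: "AE t in ?M. \<forall>x\<ge>0. f t x \<le> \<phi> t + \<epsilon> * x"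
    using phi(2) phi0 aeI
  proof eventually_elim
    case (elim t)
    show ?case
    proof (intro allI impI)
      fix x :: real assume "x \<ge> 0"
      show "f t x \<le> \<phi> t + \<epsilon> * x"
      proof (cases "x \<le> X")
        case True
        then have "f t x \<le> \<phi> t" using elim(1) \<open>x \<ge> 0\<close> by simp
        then show ?thesis using \<open>\<epsilon> > 0\<close> \<open>x \<ge> 0\<close> by (simp add: add_increasing2)
      next
        case False
        then show ?thesis using f_top[OF elim(3), of x] elim(2) by (simp add: \<epsilon>_def)
      qed
    qed
  qed
  define \<Phi> where "\<Phi> = (LINT t|?M. \<phi> t)"
  have "\<Phi> \<ge> 0" unfolding \<Phi>_def by (rule integral_nonneg_AE[OF phi0])
  \<comment> \<open>\<open>R\<close> solves
    \<open>M * (\<Phi> + (\<epsilon> * R + \<delta>) * T) = R\<close>: with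
    \<open>\<epsilon> = 1 / (2 * M * T)\<close> the part growing with \<open>R\<close> contributes
    exactly \<open>R / 2\<close>, and the rest must be the other half. This makes
    \<open>[0, R]\<close> invariant.\<close>
  define R where "R = 2 * M * (\<Phi> + \<delta> * T)"
  have "R > 0" using \<open>M > 0\<close> \<open>\<Phi> \<ge> 0\<close> \<delta> T_pos by (simp add: R_def add_nonneg_pos)
  define \<eta> where "\<eta> w = max 0 (\<delta> - (SUP t\<in>{0..T}. w t))" for w :: "real \<Rightarrow> real"
  define \<F> where "\<F> w s = f s (w s) + \<eta> w" for w s
  define b where "b s = \<phi> s + (\<epsilon> * R + \<delta>)" for s
  have ne: "{0..T} \<noteq> {}" using T_pos by simp
  have measT: "measure ?M {0..T} = T" using T_pos by (simp add: measure_restrict_space)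
  have const: "integrable ?M (\<lambda>_. k :: real)" for k by (auto simp: integrable_restrict_space)
  have b: "integrable ?M b" unfolding b_def by (intro Bochner_Integration.integrable_add phi(1) const)
  have lb: "(LINT s|?M. b s) = \<Phi> + (\<epsilon> * R + \<delta>) * T"
    unfolding b_def by (subst Bochner_Integration.integral_add[OF phi(1) const]) (simp add: \<Phi>_def measT)
  have "M * (\<epsilon> * R * T) = R / 2" using \<open>M > 0\<close> T_pos by (simp add: \<epsilon>_def)
  moreover have "M * (\<Phi> + \<delta> * T) = R / 2" by (simp add: R_def)
  moreover have "M * (\<Phi> + (\<epsilon> * R + \<delta>) * T) = M * (\<epsilon> * R * T) + M * (\<Phi> + \<delta> * T)"
    by (simp add: algebra_simps)
  ultimately have bR: "M * (LINT s|?M. b s) = R" unfolding lb by linarith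
  have eta: "0 \<le> \<eta> w" "\<eta> w \<le> \<delta>" if "\<forall>t\<in>{0..T}. w t \<in> {0..R}" for w
  proof -
    have "0 \<le> w 0" using that T_pos by simp
    also have "w 0 \<le> (SUP t\<in>{0..T}. w t)"
      by (rule cSUP_upper) (use that T_pos in \<open>auto intro!: bdd_aboveI2[where M=R]\<close>)
    finally show "0 \<le> \<eta> w" "\<eta> w \<le> \<delta>" using \<delta> by (auto simp: \<eta>_def)
  qed
  have F_nonneg: "0 \<le> \<F> w s" if "\<forall>t\<in>{0..T}. w t \<in> {0..R}" "s \<in> {0..T}" for w s
    using f_nonneg[OF that(2), of "w s"] that eta(1)[OF that(1)] by (auto simp: \<F>_def)
  have F_bound: "AE s in ?M. \<bar>\<F> w s\<bar> \<le> b s" if w: "\<forall>t\<in>{0..T}. w t \<in> {0..R}" for w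
    using growth aeI
  proof eventually_elim
    case (elim s)
    have ws: "0 \<le> w s" "w s \<le> R" using w elim(2) by auto
    have "f s (w s) \<le> \<phi> s + \<epsilon> * w s" using elim(1) ws by blast
    also have "\<epsilon> * w s \<le> \<epsilon> * R" using ws \<open>\<epsilon> > 0\<close> by simp
    finally show ?case using eta(2)[OF w] F_nonneg[OF w elim(2)] by (simp add: \<F>_def b_def)
  qed
  have F_int: "integrable ?M (\<F> w)"
    if w: "\<forall>t\<in>{0..T}. w t \<in> {0..R}" and wm: "\<F> w \<in> borel_measurable ?M" for w
  proof (rule Bochner_Integration.integrable_bound[OF b wm])
    show "AE s in ?M. norm (\<F> w s) \<le> norm (b s)"
      using F_bound[OF w] by eventually_elim auto
  qed
  obtain u where u: "continuous_on {0..T} u" "\<And>t. t \<in> {0..T} \<Longrightarrow> u t \<in> {0..R}" "\<F> u \<in> borel_measurable ?M"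
    "\<And>t. t \<in> {0..T} \<Longrightarrow> u t = (LINT s|?M. G t s * \<F> u s)"
  proof (rule hammerstein_fixed_point[OF T_pos \<open>R > 0\<close> G_continuous _ b, of \<F>])
    show "AE s in ?M. \<bar>\<F> w s\<bar> \<le> b s" if "\<And>t. t \<in> {0..T} \<Longrightarrow> w t \<in> {0..R}" for w
      using that by (intro F_bound ballI)
  next
    fix k :: "nat \<Rightarrow> real" and N :: nat
    assume k: "\<And>i. k i \<in> {0..R}"
    have "(\<lambda>t. f t (k (nat \<lfloor>real N * t / T\<rfloor>))) \<in> borel_measurable ?M"
    proof (rule measurable_compose_countable[where f="\<lambda>i t. f t (k i)" and g="\<lambda>t. nat \<lfloor>real N * t / T\<rfloor>"])
      show "(\<lambda>t. f t (k i)) \<in> borel_measurable ?M" for i using f_meas k by simp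
      have "(\<lambda>t. nat \<lfloor>real N * t / T\<rfloor>) \<in> borel \<rightarrow>\<^sub>M count_space UNIV" by measurable
      then have "(\<lambda>t. nat \<lfloor>real N * t / T\<rfloor>) \<in> lebesgue \<rightarrow>\<^sub>M count_space UNIV"
        by (intro measurable_completion) simp
      then show "(\<lambda>t. nat \<lfloor>real N * t / T\<rfloor>) \<in> ?M \<rightarrow>\<^sub>M count_space UNIV" by (rule measurable_restrict_space1)
    qed
    then show "\<F> (\<lambda>t. k (nat \<lfloor>real N * t / T\<rfloor>)) \<in> borel_measurable ?M"
      unfolding \<F>_def by (intro borel_measurable_add) auto
  next
    fix W :: "nat \<Rightarrow> real \<Rightarrow> real" and w s
    assume W: "\<And>n t. t \<in> {0..T} \<Longrightarrow> W n t \<in> {0..R}" and w: "\<And>t. t \<in> {0..T} \<Longrightarrow> w t \<in> {0..R}"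
      and ul: "uniform_limit {0..T} W w sequentially" and s: "s \<in> {0..T}"
    have "(\<lambda>n. SUP t\<in>{0..T}. W n t) \<longlonglongrightarrow> (SUP t\<in>{0..T}. w t)"
      by (rule tendsto_SUP_uniform_limit[OF ne _ _ ul, of R]) (use W w in auto)
    then have "(\<lambda>n. \<eta> (W n)) \<longlonglongrightarrow> \<eta> w" unfolding \<eta>_def by (intro tendsto_max tendsto_diff tendsto_const)
    moreover have "(\<lambda>n. f s (W n s)) \<longlonglongrightarrow> f s (w s)"
      by (rule continuous_on_tendsto_compose[OF f_cont[OF s] tendsto_uniform_limitI[OF ul s]]) (use W w s in auto)
    ultimately show "(\<lambda>n. \<F> (W n) s) \<longlonglongrightarrow> \<F> w s" unfolding \<F>_def by (intro tendsto_add)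
  next
    fix w t assume w0: "\<And>t. t \<in> {0..T} \<Longrightarrow> w t \<in> {0..R}" and wm: "\<F> w \<in> borel_measurable ?M" and t: "t \<in> {0..T}"
    have w: "\<forall>t\<in>{0..T}. w t \<in> {0..R}" using w0 by blast
    have int: "integrable ?M (\<F> w)" by (rule F_int[OF w wm])
    then have ai: "\<F> w absolutely_integrable_on {0..T}" by (simp only: L1_iff_abs_integrable)
    have "sol (\<F> w) t \<ge> 0" by (rule sol_nonneg[OF ai F_nonneg[OF w] t])
    moreover have "sol (\<F> w) t \<le> (LINT s|?M. M * b s)"
      unfolding sol_def
    proof (rule integral_mono_AE)
      show "integrable ?M (\<lambda>s. G t s * \<F> w s)"
        unfolding L1_iff_abs_integrable by (rule sol_eq_integral(2)[OF ai t])
      show "AE s in ?M. G t s * \<F> w s \<le> M * b s"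
        using F_bound[OF w] aeI
      proof eventually_elim
        case (elim s)
        then show ?case using M[OF t elim(2)] F_nonneg[OF w elim(2)] \<open>M > 0\<close> by (intro mult_mono) auto
      qed
    qed (use b in simp)
    ultimately show "(LINT s|?M. G t s * \<F> w s) \<in> {0..R}" using bR by (simp add: sol_def)
  qed blast
  have uR: "\<forall>t\<in>{0..T}. u t \<in> {0..R}" using u(2) by blast
  have Fi: "\<F> u absolutely_integrable_on {0..T}"
    using F_int[OF uR u(3)] by (simp only: L1_iff_abs_integrable)
  have uS: "u t = sol (\<F> u) t" if "t \<in> {0..T}" for t using u(4)[OF that] by (simp add: sol_def)
  have bdd: "bdd_above (u ` {0..T})" using u(2) by (intro bdd_aboveI2[where M=R]) auto
  have "\<eta> u = 0"
  proof (rule ccontr)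
    assume "\<eta> u \<noteq> 0"
    then have "\<eta> u > 0" using eta(1)[OF uR] by simp
    then have small: "u t < \<delta>" if "t \<in> {0..T}" for t
      using cSUP_upper[OF that bdd] by (simp add: \<eta>_def)
    have ui: "u integrable_on {c..d}"
      using cd by (intro integrable_continuous_real continuous_on_subset[OF u(1)]) auto
    have vF: "(\<lambda>s. \<F> u s * sol (ind c d) s) absolutely_integrable_on {0..T}"
      by (intro abs_integrable_mult Fi sol_continuous ind_integrable)
    have vF': "(\<lambda>s. \<F> u s * sol (ind c d) s) integrable_on {c..d}"
      using abs_integrable_onD(1)[OF vF] cd by simp
    \<comment> \<open>Test the equation with \<open>v = sol (ind c d)\<close>. The slope
      \<open>2 / m\<close> of \<open>f\<close> near zero meets \<open>v \<ge> m\<close>, so by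
      adjointness the integral of \<open>u\<close> over \<open>[c, d]\<close> would be at least
      twice itself plus a positive amount.\<close>
    have "AE s in ?M. s \<in> {c..d} \<longrightarrow> 2 * u s + m * \<eta> u \<le> \<F> u s * sol (ind c d) s"
      using f_zero aeI
    proof eventually_elim
      case (elim s)
      show ?case
      proof
        assume s: "s \<in> {c..d}"
        have "2 / m * u s \<le> f s (u s)"
          using elim s small[OF elim(2)] u(2)[OF elim(2)] f_nonneg[OF elim(2), of 0] by (cases "u s = 0") auto
        then have "(2 / m * u s + \<eta> u) * m \<le> \<F> u s * sol (ind c d) s"
          using m[OF s] \<open>m > 0\<close> F_nonneg[OF uR elim(2)] by (intro mult_mono) (auto simp: \<F>_def)
        then show "2 * u s + m * \<eta> u \<le> \<F> u s * sol (ind c d) s" using \<open>m > 0\<close> by (simp add: algebra_simps)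
      qed
    qed
    then obtain N where N: "negligible N"
      "\<And>s. s \<in> {0..T} \<Longrightarrow> s \<notin> N \<Longrightarrow> s \<in> {c..d} \<longrightarrow> 2 * u s + m * \<eta> u \<le> \<F> u s * sol (ind c d) s"
      using AE_lebesgue_on_negligible by blast
    have "integral {c..d} (\<lambda>s. 2 * u s + m * \<eta> u) \<le> integral {c..d} (\<lambda>s. \<F> u s * sol (ind c d) s)"
    proof -
      \<comment> \<open>Redefined on the null set, the majorant satisfies the inequality at every
        point without changing its integral.\<close>
      let ?q = "\<lambda>s. if s \<in> N then 2 * u s + m * \<eta> u else \<F> u s * sol (ind c d) s"
      have "?q integrable_on {c..d}" by (rule integrable_spike[OF vF' N(1)]) auto
      then have "integral {c..d} (\<lambda>s. 2 * u s + m * \<eta> u) \<le> integral {c..d} ?q"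
        using ui N(2) cd by (intro integral_le integrable_add integrable_on_mult_right) auto
      also have "\<dots> = integral {c..d} (\<lambda>s. \<F> u s * sol (ind c d) s)"
        by (rule integral_spike[OF N(1)]) auto
      finally show ?thesis .
    qed
    also have "\<dots> \<le> integral {0..T} (\<lambda>s. \<F> u s * sol (ind c d) s)"
    proof (rule integral_subset_le[OF _ vF'])
      show "(\<lambda>s. \<F> u s * sol (ind c d) s) integrable_on {0..T}" using abs_integrable_onD(1)[OF vF] by simp
      show "\<forall>s\<in>{0..T}. 0 \<le> \<F> u s * sol (ind c d) s"
        using F_nonneg[OF uR] sol_nonneg[OF ind_integrable] by (auto intro!: mult_nonneg_nonneg)
    qed (use cd in auto)
    also have "\<dots> = integral {c..d} (sol (\<F> u))"
      using adjoint_sol[OF Fi ind_integrable, of c d] integral_ind(2)[OF cd(1,3)] by simp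
    also have "\<dots> = integral {c..d} u"
      by (rule hk_cong) (use uS cd in auto)
    finally have le: "integral {c..d} (\<lambda>s. 2 * u s + m * \<eta> u) \<le> integral {c..d} u" .
    have "integral {c..d} (\<lambda>s. 2 * u s + m * \<eta> u) = integral {c..d} (\<lambda>s. 2 * u s) + integral {c..d} (\<lambda>s. m * \<eta> u)"
      by (intro hk_add integrable_on_mult_right ui integrable_const_ivl)
    then have "2 * integral {c..d} u + (d - c) * (m * \<eta> u) \<le> integral {c..d} u"
      using le cd by (simp add: mult.left_commute[of m])
    moreover have "integral {c..d} u \<ge> 0" using u(2) cd by (intro integral_nonneg ui) auto
    moreover have "(d - c) * (m * \<eta> u) > 0" using cd \<open>m > 0\<close> \<open>\<eta> u > 0\<close> by simp
    ultimately show False by linarith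
  qed
  then have Fu: "\<F> u = (\<lambda>s. f s (u s))" by (simp add: \<F>_def fun_eq_iff)
  have "\<exists>t\<in>{0..T}. u t \<noteq> 0"
  proof (rule ccontr)
    assume "\<not> (\<exists>t\<in>{0..T}. u t \<noteq> 0)"
    then have "(SUP t\<in>{0..T}. u t) \<le> 0" by (intro cSUP_least ne) auto
    then show False using \<open>\<eta> u = 0\<close> \<delta> by (simp add: \<eta>_def)
  qed
  then show ?thesis using u(2) uS Fi unfolding Fu by (intro exI[of _ u]) auto
qed

end

theorem corollary3p5:
  fixes T \<alpha> c d lP lA :: real
    and a :: "real \<Rightarrow> real"
    and f G :: "real \<Rightarrow> real \<Rightarrow> real"
  assumes "T > 0"
    and "\<alpha> \<ge> 1" and "Lp \<alpha> T a"
    and "smallest_periodic_eigenvalue T a lP"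
    and "smallest_antiperiodic_eigenvalue T a lA"
    and "lP < 0" and "0 \<le> lA"
    and "periodic_green T a G"
    and "{c..d} \<subseteq> {0..T}" and "c < d"
    and "\<And>t x. t \<in> {0..T} \<Longrightarrow> x \<ge> 0 \<Longrightarrow> f t x \<ge> 0"
    and "L1_caratheodory T f"
    and "((\<lambda>x. INF t\<in>{c..d}. ereal (f t x / x)) \<longlongrightarrow> \<infinity>) (at_right 0)"
    and "((\<lambda>x. SUP t\<in>{0..T}. ereal (f t x / x)) \<longlongrightarrow> 0) at_top"
  shows "\<exists>u. periodic_solution T a (\<lambda>t. f t (u t)) u \<and>
             u \<in> positive_cone T (green_sigma T c d G) \<and> (\<exists>t\<in>{0..T}. u t \<noteq> 0)"
proof -
  have a: "a absolutely_integrable_on {0..T}" by (rule Lp_imp_absolutely_integrable[OF assms(3,2)])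
  have "stable_hill T a"
    by (rule stable_hill_of_eigenvalues[OF assms(1) a, of lP])
      (use assms(4-7) in \<open>auto simp: smallest_eigenvalue_def intro: order_trans\<close>)
  then interpret stable_hill_green T a G
    using assms(8) by (simp add: stable_hill_green_def stable_hill_green_axioms_def)
  have cd: "0 \<le> c" "c < d" "d \<le> T" using assms(9,10) by auto
  define m where "m = (INF s\<in>{c..d}. LINT t|lebesgue_on {c..d}. G t s)"
  define M where "M = (SUP (t, s)\<in>{0..T} \<times> {0..T}. G t s)"
  \<comment> \<open>The definition of \<open>\<sigma>\<close> integrates over the first argument;
    symmetry of \<open>G\<close> turns this into the solution \<open>v\<close>, whose minimum over
    \<open>[c, d]\<close> is attained and positive.\<close>
  have Gv: "(LINT t|lebesgue_on {c..d}. G t s) = sol (ind c d) s" if s: "s \<in> {c..d}" for s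
  proof -
    have s0: "s \<in> {0..T}" using s cd by auto
    have "(LINT t|lebesgue_on {c..d}. G t s) = integral {c..d} (\<lambda>t. G t s)"
      by (intro LINT_eq_integral absolutely_integrable_continuous_real continuous_on_subset[OF G_continuous_fst[OF s0]])
        (use cd in auto)
    also have "\<dots> = integral {c..d} (G s)"
      by (rule hk_cong) (use G_symmetric s0 cd in auto)
    finally show ?thesis using sol_ind[OF cd(1,3) s0] by simp
  qed
  have "m = (INF s\<in>{c..d}. sol (ind c d) s)" unfolding m_def by (rule INF_cong) (use Gv in auto)
  moreover have "\<exists>s\<in>{c..d}. \<forall>r\<in>{c..d}. sol (ind c d) s \<le> sol (ind c d) r"
    using cd by (intro continuous_attains_inf continuous_on_subset[OF sol_continuous[OF ind_integrable]]) auto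
  then obtain s where s: "s \<in> {c..d}" "\<And>r. r \<in> {c..d} \<Longrightarrow> sol (ind c d) s \<le> sol (ind c d) r" by blast
  moreover have "(INF r\<in>{c..d}. sol (ind c d) r) = sol (ind c d) s"
    by (rule cInf_eq_minimum) (use s in auto)
  ultimately have m: "m > 0" "\<And>r. r \<in> {c..d} \<Longrightarrow> m \<le> sol (ind c d) r"
    using sol_ind_pos[OF cd, of s] cd by auto
  have "bdd_above ((\<lambda>(t, s). G t s) ` ({0..T} \<times> {0..T}))"
    by (intro compact_imp_bounded[THEN bounded_imp_bdd_above] compact_continuous_image G_continuous compact_Times compact_Icc)
  then have M: "G t s \<le> M" if "t \<in> {0..T}" "s \<in> {0..T}" for t s
    unfolding M_def using cSUP_upper[of "(t, s)" "{0..T} \<times> {0..T}" "\<lambda>(t, s). G t s"] that by auto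
  have "M > 0"
  proof -
    have s0: "s \<in> {0..T}" using s(1) cd by auto
    have "0 < sol (ind c d) s" by (rule sol_ind_pos[OF cd s0])
    also have "\<dots> = integral {c..d} (G s)" by (rule sol_ind[OF cd(1,3) s0])
    also have "\<dots> \<le> integral {c..d} (\<lambda>_. M)"
      using cd s0 M by (intro integral_le integrable_continuous_real continuous_on_subset[OF G_continuous_snd[OF s0]]) auto
    also have "\<dots> = (d - c) * M" using cd by simp
    finally show ?thesis using cd by (simp add: zero_less_mult_iff)
  qed
  have sigma: "green_sigma T c d G = m / M" by (simp add: green_sigma_def m_def M_def)
  obtain \<delta> where delta: "\<delta> > 0" "\<And>t x. t \<in> {c..d} \<Longrightarrow> 0 < x \<Longrightarrow> x < \<delta> \<Longrightarrow> 2 / m * x \<le> f t x"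
    using superlinear_at_0D[OF assms(13)] by blast
  have "1 / (2 * M * T) > 0" using \<open>M > 0\<close> \<open>T > 0\<close> by simp
  then obtain X where X: "X > 0" "\<And>t x. t \<in> {0..T} \<Longrightarrow> X \<le> x \<Longrightarrow> f t x \<le> 1 / (2 * M * T) * x"
    using sublinear_at_topD[OF assms(14)] by blast
  have car: "\<And>x. x \<ge> 0 \<Longrightarrow> (\<lambda>t. f t x) \<in> borel_measurable (lebesgue_on {0..T})"
    "AE t in lebesgue_on {0..T}. continuous_on {0..} (f t)"
    "\<And>r. r > 0 \<Longrightarrow> \<exists>\<phi>. L1 T \<phi> \<and> (AE t in lebesgue_on {0..T}. \<forall>x\<in>{0..r}. f t x \<le> \<phi> t)"
    using assms(12) unfolding L1_caratheodory_def by auto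
  obtain N where N: "{t \<in> space (lebesgue_on {0..T}). \<not> continuous_on {0..} (f t)} \<subseteq> N"
    "emeasure (lebesgue_on {0..T}) N = 0" "N \<in> sets (lebesgue_on {0..T})"
    using AE_E[OF car(2)] by blast
  have notN: "AE t in lebesgue_on {0..T}. t \<notin> N"
    using N(2,3) by (intro AE_not_in) (simp add: null_sets_def)
  \<comment> \<open>\<open>f t\<close> may be discontinuous for \<open>t\<close> in a null set.
    Setting it to zero there gives continuity for every \<open>t\<close>, at the price that the
    lower bound near \<open>x = 0\<close> holds only almost everywhere; the solutions do not notice
    the change.\<close>
  define g where "g t x = (if t \<in> N then 0 else f t x)" for t x
  have "\<exists>u. (\<forall>t\<in>{0..T}. u t \<ge> 0) \<and> (\<exists>t\<in>{0..T}. u t \<noteq> 0) \<and> (\<lambda>t. g t (u t)) absolutely_integrable_on {0..T} \<and>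
      (\<forall>t\<in>{0..T}. u t = sol (\<lambda>s. g s (u s)) t)"
  proof (rule ex_positive_fixed_point[OF cd m(1) \<open>M > 0\<close> m(2) M])
    show "g t x \<ge> 0" if "t \<in> {0..T}" "x \<ge> 0" for t x using assms(11) that by (simp add: g_def)
    show "(\<lambda>t. g t x) \<in> borel_measurable (lebesgue_on {0..T})" if "x \<ge> 0" for x
      unfolding g_def by (intro measurable_If_set car(1) that borel_measurable_const) (use N(3) in \<open>auto intro: sets.Int\<close>)
    show "continuous_on {0..} (g t)" if "t \<in> {0..T}" for t
      using N(1) that by (cases "t \<in> N") (auto simp: g_def[abs_def])
    show "\<exists>\<phi>. L1 T \<phi> \<and> (AE t in lebesgue_on {0..T}. \<forall>x\<in>{0..r}. g t x \<le> \<phi> t)" if r: "r > 0" for r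
    proof -
      obtain \<phi> where phi: "L1 T \<phi>" "AE t in lebesgue_on {0..T}. \<forall>x\<in>{0..r}. f t x \<le> \<phi> t" using car(3)[OF r] by blast
      have "AE t in lebesgue_on {0..T}. \<forall>x\<in>{0..r}. g t x \<le> \<phi> t"
        using phi(2) notN by eventually_elim (auto simp: g_def)
      then show ?thesis using phi(1) by blast
    qed
    show "AE t in lebesgue_on {0..T}. t \<in> {c..d} \<longrightarrow> (\<forall>x. 0 < x \<longrightarrow> x < \<delta> \<longrightarrow> 2 / m * x \<le> g t x)"
      using notN by eventually_elim (use delta(2) in \<open>auto simp: g_def\<close>)
    show "g t x \<le> 1 / (2 * M * T) * x" if "t \<in> {0..T}" "X \<le> x" for t x
      using X that \<open>M > 0\<close> \<open>T > 0\<close> by (auto simp: g_def)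
  qed (use delta(1) X(1) in auto)
  then obtain w where w: "\<forall>t\<in>{0..T}. w t \<ge> 0" "\<exists>t\<in>{0..T}. w t \<noteq> 0"
    "(\<lambda>t. g t (w t)) absolutely_integrable_on {0..T}" "\<And>t. t \<in> {0..T} \<Longrightarrow> w t = sol (\<lambda>s. g s (w s)) t"
    by blast
  define h where "h t = g t (w t)" for t
  \<comment> \<open>\<open>w\<close> is determined on \<open>[0, T]\<close> only;
    \<open>sol h\<close> agrees with it there and is the function known to solve the linear
    problem.\<close>
  define u where "u = sol h"
  have h: "h absolutely_integrable_on {0..T}" using w(3) by (simp add: h_def[abs_def])
  have h_nonneg: "h t \<ge> 0" if "t \<in> {0..T}" for t using assms(11)[OF that] w(1) that by (simp add: h_def g_def)
  have uw: "u t = w t" if "t \<in> {0..T}" for t using w(4)[OF that] by (simp add: u_def h_def[abs_def])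
  have hf: "AE t in lebesgue_on {0..T}. h t = f t (u t)"
    using notN AE_space[of "lebesgue_on {0..T}"] by eventually_elim (use uw in \<open>auto simp: h_def g_def\<close>)
  have "periodic_solution T a (\<lambda>t. f t (u t)) u"
  proof -
    obtain u' u'' where u: "W21 T u u' u''" "AE t in lebesgue_on {0..T}. u'' t + a t * u t = h t"
      "u 0 = 1 * u T" "u' 0 = 1 * u' T"
      using sol_solution[OF h] unfolding u_def[symmetric] hill_solution_def by blast
    have "AE t in lebesgue_on {0..T}. u'' t + a t * u t = f t (u t)"
      using u(2) hf by eventually_elim auto
    then show ?thesis unfolding hill_solution_def using u by blast
  qed
  moreover have "u \<in> positive_cone T (green_sigma T c d G)"
    unfolding positive_cone_def
  proof (intro CollectI conjI ballI)
    show uc: "continuous_on {0..T} u" unfolding u_def by (rule sol_continuous[OF h])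
    show un: "0 \<le> u t" if "t \<in> {0..T}" for t using uw w(1) that by simp
    have "(LINT s|lebesgue_on {0..T}. u s) = integral {0..T} u"
      by (intro LINT_eq_integral absolutely_integrable_continuous_real uc)
    moreover have "(SUP t\<in>{0..T}. \<bar>u t\<bar>) \<le> M / m * integral {0..T} u"
    proof (rule cSUP_least)
      fix t assume t: "t \<in> {0..T}"
      have "m * u t \<le> M * integral {0..T} u"
        unfolding u_def by (rule sol_le_integral[OF cd _ m(2) M h h_nonneg t]) (use m(1) in auto)
      then show "\<bar>u t\<bar> \<le> M / m * integral {0..T} u" using un[OF t] m(1) by (simp add: field_simps)
    qed (use \<open>T > 0\<close> in auto)
    then have "m / M * (SUP t\<in>{0..T}. \<bar>u t\<bar>) \<le> m / M * (M / m * integral {0..T} u)"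
      using m(1) \<open>M > 0\<close> by (intro mult_left_mono) auto
    ultimately show "(LINT s|lebesgue_on {0..T}. u s) \<ge> green_sigma T c d G * (SUP t\<in>{0..T}. \<bar>u t\<bar>)"
      using m(1) \<open>M > 0\<close> by (simp add: sigma)
  qed
  moreover have "\<exists>t\<in>{0..T}. u t \<noteq> 0" using w(2) uw by auto
  ultimately show ?thesis by blast
qed

end
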